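(* For all $n\ge 1$, Jones' $n$-subgroup $\overrightarrow{F}_n$ (the set of all reduced $n$-good diagrams in R. Thompson's group $F$) coincides with its commensurator in $F$; hence the linearization of the permutational representation of $F$ on $F/\overrightarrow{F}_n$ is irreducible.
   Context: The commensurator of a subgroup $H$ of a group $G$ is the set of all $g\in G$ such that $H\cap gHg^{-1}$ has finite index in both $H$ and $gHg^{-1}$. The linearization of the permutational representation of $G$ on the coset space $G/H$ is the unitary representation of $G$ on $\ell^2(G/H)$ by permuting cosets; irreducible means no closed invariant subspaces other than $0$ and the whole space. $F$ is the group of all piecewise-linear increasing homeomorphisms of $[0,1]$ with all slopes powers of $2$ and all break points of the derivative dyadic fractions; products are composed from left to right. Diagrams: the cell $\pi$ is the plane directed graph whose top path is one edge and whose bottom path consists of two edges, with the same initial and terminal vertices (all edges are directed left to right). Diagrams over $\langle x\mid x=x^2\rangle$ are the plane graphs (up to isotopy) obtained from the single edge $\mathbf 1$ and from $\pi$ by addition $\Delta_1+\Delta_2$ (identify the terminal vertex of $\Delta_1$ with the initial vertex of $\Delta_2$), multiplication $\Delta_1\circ\Delta_2$ (identify the bottom path of $\Delta_1$ with the top path of $\Delta_2$ when they have the same length), and inversion (reflection in a horizontal line). A diagram $\Delta$ has an initial vertex $\iota(\Delta)$ and a terminal vertex $\tau(\Delta)$; the other vertices are called inner. A dipole is a subdiagram $\pi\circ\pi^{-1}$ or $\pi^{-1}\circ\pi$; it is eliminated by removing its two cells and identifying its top and bottom paths. A diagram is reduced if it has no dipoles; each diagram is equivalent via dipole moves to a unique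 reduced diagram. "Diagrams in $F$" are those whose top path and bottom path are single edges; reduced such diagrams, with product = reduced form of $\Delta_1\circ\Delta_2$, form a group identified with $F$ as follows. A reduced $\Delta$ is cut by its longest positive path from $\iota(\Delta)$ to $\tau(\Delta)$ as $\Delta=\Delta^+\circ\Delta^-$, where $\Delta^+$ consists of cells $\pi$ and $\Delta^-$ of cells $\pi^{-1}$. Assign $[0,1]$ to the top edge of $\Delta^+$ and, for each cell, the left and right halves of the interval of its top edge to its left and right bottom edges; the bottom path of $\Delta^+$ gives a dyadic subdivision of $[0,1]$ (top subdivision). Doing the same with $(\Delta^-)^{-1}$ gives the bottom subdivision. $\Delta$ corresponds to the homeomorphism mapping each segment of the top subdivision linearly onto the corresponding segment of the bottom subdivision. Thompson graph $T(\Delta)$: its vertices are all vertices of $\Delta$ except $\tau(\Delta)$; its edges are, for every inner vertex $v$ of $\Delta$, the top-most incoming edge of $v$ in $\Delta$ (upper edge) and the bottom-most incoming edge of $v$ in $\Delta$ (lower edge), counted as two distinct edges if they coincide. The top (resp. bottom) path from $\iota(\Delta)$ to an inner vertex $v$ is the unique positive (left-to-right) path in $T(\Delta)$ from $\iota(\Delta)$ to $v$ composed entirely of upper (resp. lower) edges. $\Delta$ is $n$-good if for every inner vertex $v$ the lengths of the top path and of the bottom path from $\iota(\Delta)$ to $v$ are equal modulo $n$. $\overrightarrow{F}_n$ is the set of all reduced $n$-good diagrams in $F$ (it is a subgroup of $F$). *)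

theory Defs
  imports
    "HOL-Analysis.Analysis"
    "HOL-Algebra.Bij"
    "HOL-Algebra.Left_Coset"
    "HOL-Number_Theory.Cong"
    "Graph_Theory.Arc_Walk"
begin

section \<open>Commensurators\<close>

definition finite_index :: "('a, 'b) monoid_scheme \<Rightarrow> 'a set \<Rightarrow> 'a set \<Rightarrow> bool" where
  "finite_index G K L \<longleftrightarrow> K \<subseteq> L \<and> finite (rcosets\<^bsub>G\<lparr>carrier := L\<rparr>\<^esub> K)"

definition conjugate :: "('a, 'b) monoid_scheme \<Rightarrow> 'a \<Rightarrow> 'a set \<Rightarrow> 'a set" where
  "conjugate G g H = g <#\<^bsub>G\<^esub> (H #>\<^bsub>G\<^esub> inv\<^bsub>G\<^esub> g)"

definition commensurator :: "('a, 'b) monoid_scheme \<Rightarrow> 'a set \<Rightarrow> 'a set" where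
  "commensurator G H = {g \<in> carrier G.
     finite_index G (H \<inter> conjugate G g H) H \<and>
     finite_index G (H \<inter> conjugate G g H) (conjugate G g H)}"


section \<open>The linearized permutational representation on \<open>\<ell>\<^sup>2(G/H)\<close>\<close>

text \<open>
  Vectors of \<open>\<ell>\<^sup>2(S)\<close> are represented by functions on the whole type that vanish outside \<open>S\<close>.
\<close>

definition ell2 :: "'a set \<Rightarrow> ('a \<Rightarrow> complex) set" where
  "ell2 S = {\<phi>. (\<forall>x. x \<notin> S \<longrightarrow> \<phi> x = 0) \<and> (\<lambda>x. (cmod (\<phi> x))\<^sup>2) summable_on S}"

definition ell2_norm :: "'a set \<Rightarrow> ('a \<Rightarrow> complex) \<Rightarrow> real" where
  "ell2_norm S \<phi> = sqrt (\<Sum>\<^sub>\<infinity>x\<in>S. (cmod (\<phi> x))\<^sup>2)"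

definition closed_ell2_subspace :: "'a set \<Rightarrow> ('a \<Rightarrow> complex) set \<Rightarrow> bool" where
  "closed_ell2_subspace S V \<longleftrightarrow>
     V \<subseteq> ell2 S \<and>
     (\<lambda>x. 0) \<in> V \<and>
     (\<forall>\<phi>\<in>V. \<forall>\<psi>\<in>V. (\<lambda>x. \<phi> x + \<psi> x) \<in> V) \<and>
     (\<forall>c. \<forall>\<phi>\<in>V. (\<lambda>x. c * \<phi> x) \<in> V) \<and>
     (\<forall>\<Phi> \<psi>. (\<forall>k::nat. \<Phi> k \<in> V) \<and> \<psi> \<in> ell2 S \<and>
        (\<lambda>k. ell2_norm S (\<lambda>x. \<Phi> k x - \<psi> x)) \<longlonglongrightarrow> 0 \<longrightarrow> \<psi> \<in> V)"

definition irreducible_rep ::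
    "('g, 'm) monoid_scheme \<Rightarrow> 'a set \<Rightarrow> ('g \<Rightarrow> ('a \<Rightarrow> complex) \<Rightarrow> ('a \<Rightarrow> complex)) \<Rightarrow> bool" where
  "irreducible_rep G S \<rho> \<longleftrightarrow>
     (\<forall>V. closed_ell2_subspace S V \<and> (\<forall>g\<in>carrier G. \<forall>\<phi>\<in>V. \<rho> g \<phi> \<in> V) \<longrightarrow>
        V = {\<lambda>x. 0} \<or> V = ell2 S)"

text \<open>
  The operator of \<open>g\<close> sends the basis vector at the coset \<open>C\<close> to the basis vector at
  \<open>g C\<close>; on functions this is precomposition with the action of the inverse of \<open>g\<close>.
\<close>

definition linearization ::
    "('a, 'b) monoid_scheme \<Rightarrow> 'a set \<Rightarrow> 'a \<Rightarrow> ('a set \<Rightarrow> complex) \<Rightarrow> ('a set \<Rightarrow> complex)" where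
  "linearization G H g \<phi> =
     (\<lambda>C. if C \<in> lcosets\<^bsub>G\<^esub> H then \<phi> (inv\<^bsub>G\<^esub> g <#\<^bsub>G\<^esub> C) else 0)"


section \<open>Thompson's group \<open>F\<close>\<close>

definition dyadic_fractions :: "real set" where
  "dyadic_fractions = {of_int m / 2 ^ k | (m::int) (k::nat). True}"

definition thompson_homeos :: "(real \<Rightarrow> real) set" where
  "thompson_homeos = {f \<in> Bij {0..1}.
     (\<exists>g. homeomorphism {0..1} {0..1} f g) \<and>
     strict_mono_on {0..1} f \<and>
     (\<exists>B. finite B \<and> B \<subseteq> dyadic_fractions \<and>
        (\<forall>a b. 0 \<le> a \<and> a < b \<and> b \<le> 1 \<and> {a<..<b} \<inter> B = {} \<longrightarrow>
           (\<exists>(k::int) c. \<forall>x\<in>{a..b}. f x = 2 powi k * x + c)))}"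

text \<open>Products are composed from left to right: in \<open>f g\<close> the map \<open>f\<close> is applied first.\<close>

definition thompson_F :: "(real \<Rightarrow> real) monoid" where
  "thompson_F = \<lparr>carrier = thompson_homeos,
     mult = (\<lambda>f g. compose {0..1} g f),
     one = (\<lambda>x\<in>{0..1}. x)\<rparr>"


section \<open>Diagrams over \<open>\<langle>x | x = x\<^sup>2\<rangle>\<close>\<close>

text \<open>
  A diagram, taken up to isotopy, is recorded combinatorially: by its directed edges, its cells
  (each given by its top path and its bottom path), and its own top and bottom paths. This is the
  full incidence structure of the plane graph with all its faces. An edge is a triple
  \<open>(u, v, k)\<close> from \<open>u\<close> to \<open>v\<close>; the tag \<open>k\<close> separates parallel edges.
\<close>

type_synonym edge = "nat \<times> nat \<times> nat"

record diagram =
  d_edges :: "edge set"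
  d_cells :: "(edge list \<times> edge list) set"
  d_top :: "edge list"
  d_bot :: "edge list"

definition e_tail :: "edge \<Rightarrow> nat" where
  "e_tail e = fst e"

definition e_head :: "edge \<Rightarrow> nat" where
  "e_head e = fst (snd e)"

definition d_verts :: "diagram \<Rightarrow> nat set" where
  "d_verts D = e_tail ` d_edges D \<union> e_head ` d_edges D"

definition d_graph :: "diagram \<Rightarrow> (nat, edge) pre_digraph" where
  "d_graph D = \<lparr>verts = d_verts D, arcs = d_edges D, tail = e_tail, head = e_head\<rparr>"

definition d_init :: "diagram \<Rightarrow> nat" where
  "d_init D = e_tail (hd (d_top D))"

definition d_term :: "diagram \<Rightarrow> nat" where
  "d_term D = e_head (last (d_top D))"

definition inner_verts :: "diagram \<Rightarrow> nat set" where
  "inner_verts D = d_verts D - {d_init D, d_term D}"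

text \<open>
  Sums and products are unions of representatives that overlap exactly in the vertex, respectively
  the path, that is to be identified. Since vertex names and tags are arbitrary, any two
  diagrams have isotopic copies in such a position.
\<close>

definition d_add :: "diagram \<Rightarrow> diagram \<Rightarrow> diagram" where
  "d_add D1 D2 = \<lparr>d_edges = d_edges D1 \<union> d_edges D2, d_cells = d_cells D1 \<union> d_cells D2,
     d_top = d_top D1 @ d_top D2, d_bot = d_bot D1 @ d_bot D2\<rparr>"

definition addable :: "diagram \<Rightarrow> diagram \<Rightarrow> bool" where
  "addable D1 D2 \<longleftrightarrow> d_term D1 = d_init D2 \<and> d_verts D1 \<inter> d_verts D2 = {d_term D1}"

definition d_mult :: "diagram \<Rightarrow> diagram \<Rightarrow> diagram" where
  "d_mult D1 D2 = \<lparr>d_edges = d_edges D1 \<union> d_edges D2, d_cells = d_cells D1 \<union> d_cells D2,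
     d_top = d_top D1, d_bot = d_bot D2\<rparr>"

definition multipliable :: "diagram \<Rightarrow> diagram \<Rightarrow> bool" where
  "multipliable D1 D2 \<longleftrightarrow> d_bot D1 = d_top D2 \<and>
     d_edges D1 \<inter> d_edges D2 = set (d_bot D1) \<and>
     d_verts D1 \<inter> d_verts D2 = e_tail ` set (d_bot D1) \<union> e_head ` set (d_bot D1)"

definition d_inv :: "diagram \<Rightarrow> diagram" where
  "d_inv D = \<lparr>d_edges = d_edges D, d_cells = (d_cells D)\<inverse>, d_top = d_bot D, d_bot = d_top D\<rparr>"

inductive is_diagram :: "diagram \<Rightarrow> bool" where
  edge: "u \<noteq> v \<Longrightarrow>
    is_diagram \<lparr>d_edges = {(u, v, k)}, d_cells = {}, d_top = [(u, v, k)], d_bot = [(u, v, k)]\<rparr>"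
| cell: "distinct [u, w, v] \<Longrightarrow>
    is_diagram \<lparr>d_edges = {(u, v, k), (u, w, l), (w, v, m)},
      d_cells = {([(u, v, k)], [(u, w, l), (w, v, m)])},
      d_top = [(u, v, k)], d_bot = [(u, w, l), (w, v, m)]\<rparr>"
| add: "is_diagram D1 \<Longrightarrow> is_diagram D2 \<Longrightarrow> addable D1 D2 \<Longrightarrow> is_diagram (d_add D1 D2)"
| mult: "is_diagram D1 \<Longrightarrow> is_diagram D2 \<Longrightarrow> multipliable D1 D2 \<Longrightarrow> is_diagram (d_mult D1 D2)"
| inv: "is_diagram D \<Longrightarrow> is_diagram (d_inv D)"

definition has_dipole :: "diagram \<Rightarrow> bool" where
  "has_dipole D \<longleftrightarrow>
     (\<exists>e f g e'. ([e], [f, g]) \<in> d_cells D \<and> ([f, g], [e']) \<in> d_cells D) \<or>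
     (\<exists>f g e f' g'. ([f, g], [e]) \<in> d_cells D \<and> ([e], [f', g']) \<in> d_cells D)"

definition reduced_diagram_in_F :: "diagram \<Rightarrow> bool" where
  "reduced_diagram_in_F D \<longleftrightarrow>
     is_diagram D \<and> \<not> has_dipole D \<and> length (d_top D) = 1 \<and> length (d_bot D) = 1"


subsection \<open>The homeomorphism of a reduced diagram\<close>

definition longest_positive_path :: "diagram \<Rightarrow> edge list \<Rightarrow> bool" where
  "longest_positive_path D p \<longleftrightarrow>
     is_arg_max length (\<lambda>q. pre_digraph.awalk (d_graph D) (d_init D) q (d_term D)) p"

definition splits_as :: "diagram \<Rightarrow> diagram \<Rightarrow> diagram \<Rightarrow> bool" where
  "splits_as D P N \<longleftrightarrow>
     is_diagram P \<and> is_diagram N \<and> multipliable P N \<and> D = d_mult P N \<and>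
     longest_positive_path D (d_bot P) \<and>
     (\<forall>(p, q)\<in>d_cells P. length p = 1 \<and> length q = 2) \<and>
     (\<forall>(p, q)\<in>d_cells N. length p = 2 \<and> length q = 1)"

inductive edge_interval :: "diagram \<Rightarrow> edge \<Rightarrow> real \<Rightarrow> real \<Rightarrow> bool" for D where
  top: "d_top D = [e] \<Longrightarrow> edge_interval D e 0 1"
| left: "edge_interval D e a b \<Longrightarrow> ([e], [f, g]) \<in> d_cells D \<Longrightarrow> edge_interval D f a ((a + b) / 2)"
| right: "edge_interval D e a b \<Longrightarrow> ([e], [f, g]) \<in> d_cells D \<Longrightarrow> edge_interval D g ((a + b) / 2) b"

text \<open>
  The \<open>i\<close>-th segments of the two subdivisions belong to the same edge of the path along which
  \<open>D\<close> is cut, because \<open>d_bot P = d_top N = d_bot (d_inv N)\<close>.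
\<close>

definition diagram_homeo :: "diagram \<Rightarrow> (real \<Rightarrow> real) \<Rightarrow> bool" where
  "diagram_homeo D f \<longleftrightarrow> (\<exists>P N. splits_as D P N \<and>
     (\<forall>e\<in>set (d_bot P). \<exists>a b c d. edge_interval P e a b \<and> edge_interval (d_inv N) e c d \<and>
        (\<forall>x\<in>{a..b}. f x = c + (d - c) / (b - a) * (x - a))))"


subsection \<open>Thompson graphs and Jones' subgroups\<close>

text \<open>
  Two vertically adjacent incoming edges of a vertex are the last edges of the top and of the
  bottom path of a cell that ends in that vertex. The reflexive-transitive closure of this relation
  is the vertical order of the incoming edges of each vertex.
\<close>

definition directly_above :: "diagram \<Rightarrow> (edge \<times> edge) set" where
  "directly_above D = {(last p, last q) | p q. (p, q) \<in> d_cells D}"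

definition topmost_incoming :: "diagram \<Rightarrow> nat \<Rightarrow> edge \<Rightarrow> bool" where
  "topmost_incoming D v e \<longleftrightarrow> e \<in> d_edges D \<and> e_head e = v \<and>
     (\<forall>e'\<in>d_edges D. e_head e' = v \<longrightarrow> (e, e') \<in> (directly_above D)\<^sup>*)"

definition bottommost_incoming :: "diagram \<Rightarrow> nat \<Rightarrow> edge \<Rightarrow> bool" where
  "bottommost_incoming D v e \<longleftrightarrow> e \<in> d_edges D \<and> e_head e = v \<and>
     (\<forall>e'\<in>d_edges D. e_head e' = v \<longrightarrow> (e', e) \<in> (directly_above D)\<^sup>*)"

datatype thompson_arc = Upper (arc_edge: edge) | Lower (arc_edge: edge)

definition thompson_graph :: "diagram \<Rightarrow> (nat, thompson_arc) pre_digraph" where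
  "thompson_graph D = \<lparr>verts = d_verts D - {d_term D},
     arcs = {Upper e | e v. v \<in> inner_verts D \<and> topmost_incoming D v e} \<union>
            {Lower e | e v. v \<in> inner_verts D \<and> bottommost_incoming D v e},
     tail = e_tail \<circ> arc_edge,
     head = e_head \<circ> arc_edge\<rparr>"

definition top_path :: "diagram \<Rightarrow> nat \<Rightarrow> thompson_arc list" where
  "top_path D v = (THE p. pre_digraph.awalk (thompson_graph D) (d_init D) p v \<and> set p \<subseteq> range Upper)"

definition bottom_path :: "diagram \<Rightarrow> nat \<Rightarrow> thompson_arc list" where
  "bottom_path D v = (THE p. pre_digraph.awalk (thompson_graph D) (d_init D) p v \<and> set p \<subseteq> range Lower)"

definition n_good :: "nat \<Rightarrow> diagram \<Rightarrow> bool" where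
  "n_good n D \<longleftrightarrow>
     (\<forall>v\<in>inner_verts D. [length (top_path D v) = length (bottom_path D v)] (mod n))"

definition Jones_subgroup :: "nat \<Rightarrow> (real \<Rightarrow> real) set" where
  "Jones_subgroup n = {f \<in> carrier thompson_F.
     \<exists>D. reduced_diagram_in_F D \<and> n_good n D \<and> diagram_homeo D f}"

end

theory Submission
  imports Defs
begin

text \<open>
  Jones' \<open>n\<close>-subgroup is the stabilizer, modulo \<open>n\<close>, of binary digit sums: it consists of the elements \<open>f\<close>
  of Thompson's group such that \<open>f x\<close> and \<open>x\<close> have congruent digit sums for all dyadic \<open>x\<close> below \<open>1\<close>
  (\<open>Jones_subgroup_eq\<close>). Indeed, cut a reduced diagram of \<open>f\<close> along its longest positive path. An inner
  vertex \<open>v\<close> sits at a break point \<open>x\<close> of the top subdivision and at the break point \<open>f x\<close> of the bottom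
  subdivision. Its top-most incoming edge comes from the cell that halves an interval at \<open>x\<close>, and the
  tail of this edge is the left end of that interval, that is, \<open>x\<close> with its last digit \<open>1\<close> erased.
  So the top path to \<open>v\<close> has as many edges as \<open>x\<close> has digits \<open>1\<close>, and in the same way the bottom path
  counts the digits \<open>1\<close> of \<open>f x\<close> (\<open>length_top_path\<close>, \<open>n_good_iff\<close>). Between break points \<open>f\<close> exchanges
  prefixes of binary expansions, so a congruence at the break points spreads to all dyadic points.
  Conversely, every \<open>f\<close> has a reduced diagram, built from the maximal standard dyadic intervals that \<open>f\<close>
  maps affinely onto standard dyadic intervals (\<open>reduced_diagram_exists\<close>).

  Now let \<open>g\<close> lie outside the subgroup. Its coset determines the nonempty set of dyadic points where \<open>g\<close>
  changes the digit sum modulo \<open>n\<close>; this set has a positive infimum, since near \<open>0\<close> the element \<open>g\<close> is multiplication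
  by a power of \<open>2\<close>. The subgroup contains an explicit element, \<open>push n\<close>, which moves every point of
  the open interval to the right. Its powers shift the infimum, and therefore they take the coset of
  \<open>g\<close> to infinitely many different cosets (\<open>push_moves_cosets\<close>).

  Both claims follow from this single element. If \<open>g\<close> commensurated the subgroup, the orbit of its
  coset would be finite (\<open>commensurator_eqI\<close>). For irreducibility, average a vector over the
  powers of \<open>push n\<close>: as its only finite orbit on cosets is the base coset, the averages converge to
  a multiple of the basis vector there. So a nonzero closed invariant subspace contains this basis
  vector, hence all basis vectors, hence everything (\<open>average_tendsto\<close>, \<open>irreducible_linearizationI\<close>).
\<close>

section \<open>Averaging over a permutation in \<open>\<ell>\<^sup>2\<close>\<close>

definition basis_vector :: "'a \<Rightarrow> 'a \<Rightarrow> complex" where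
  "basis_vector a = (\<lambda>x. if x = a then 1 else 0)"

lemma sum_along_injection_le:
  fixes f :: "'b \<Rightarrow> real"
  assumes "inj_on g A" "finite A" "finite B" "\<And>y. 0 \<le> f y" "\<And>y. y \<notin> B \<Longrightarrow> f y = 0"
  shows "(\<Sum>x\<in>A. f (g x)) \<le> (\<Sum>y\<in>B. f y)"
proof -
  have "(\<Sum>x\<in>A. f (g x)) = (\<Sum>y\<in>g ` A. f y)"
    using assms(1) by (simp add: sum.reindex)
  also have "\<dots> = (\<Sum>y\<in>g ` A \<inter> B. f y)"
    using assms by (intro sum.mono_neutral_right) auto
  also have "\<dots> \<le> (\<Sum>y\<in>B. f y)"
    using assms by (intro sum_mono2) auto
  finally show ?thesis .
qed

definition average :: "'a set \<Rightarrow> ('a \<Rightarrow> 'a) \<Rightarrow> nat \<Rightarrow> ('a \<Rightarrow> complex) \<Rightarrow> ('a \<Rightarrow> complex)" where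
  "average S \<sigma> N \<phi> = (\<lambda>x. if x \<in> S then (\<Sum>i<N. \<phi> ((\<sigma> ^^ i) x)) / of_nat N else 0)"

text \<open>
  Split \<open>\<phi>\<close>, away from the fixed point \<open>b\<close>, into its part \<open>a\<close> on the finite set \<open>A\<close> and the small rest
  \<open>r\<close>. By convexity of the square, averaging does not increase the norm of \<open>r\<close>. For \<open>a\<close>, an orbit that
  never returns meets each point of \<open>A\<close> at most once, so the average is at most \<open>L / N\<close> everywhere,
  while its \<open>\<ell>\<^sup>1\<close>-norm stays at most \<open>L\<close>; hence its squared norm is at most \<open>L\<^sup>2 / N\<close>.
\<close>

lemma average_bound:
  fixes \<phi> :: "'a \<Rightarrow> complex"
  assumes inj: "inj_on \<sigma> S" and maps: "\<sigma> ` S \<subseteq> S"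
    and base: "b \<in> S" "\<sigma> b = b"
    and free: "\<And>x t. x \<in> S \<Longrightarrow> x \<noteq> b \<Longrightarrow> 1 \<le> t \<Longrightarrow> (\<sigma> ^^ t) x \<noteq> x"
    and A: "finite A" "A \<subseteq> S"
    and tail: "\<And>F. finite F \<Longrightarrow> F \<subseteq> S - A \<Longrightarrow> (\<Sum>x\<in>F. (cmod (\<phi> x))\<^sup>2) \<le> \<epsilon>"
    and F: "finite F" "F \<subseteq> S" and N: "0 < N"
  shows "(\<Sum>x\<in>F. (cmod (average S \<sigma> N \<phi> x - \<phi> b * basis_vector b x))\<^sup>2)
     \<le> 2 * (\<Sum>y\<in>A. cmod (\<phi> y))\<^sup>2 / real N + 2 * \<epsilon>"
proof -
  define L where "L = (\<Sum>y\<in>A. cmod (\<phi> y))"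
  define a where "a y = (if y \<in> A \<and> y \<noteq> b then \<phi> y else 0)" for y
  define r where "r y = (if y \<notin> A \<and> y \<noteq> b then \<phi> y else 0)" for y
  define Aa where "Aa x = (\<Sum>i<N. cmod (a ((\<sigma> ^^ i) x))) / real N" for x
  define Ar where "Ar x = (\<Sum>i<N. cmod (r ((\<sigma> ^^ i) x))) / real N" for x
  have inS: "(\<sigma> ^^ i) x \<in> S" if "x \<in> S" for i x
    using that maps by (induction i) auto
  have inji: "inj_on (\<sigma> ^^ i) S" for i
  proof (induction i)
    case (Suc i)
    have "inj_on (\<sigma> \<circ> (\<sigma> ^^ i)) S"
      using Suc inj inS by (intro comp_inj_on) (auto intro: inj_on_subset)
    then show ?case by (simp add: o_def)
  qed auto
  have bi: "(\<sigma> ^^ i) b = b" for i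
    using base by (induction i) auto
  have neb: "(\<sigma> ^^ i) x \<noteq> b" if "x \<in> S" "x \<noteq> b" for i x
    using inji[of i] bi[of i] that base by (metis inj_onD)
  have orbit_lt: "(\<sigma> ^^ i) x \<noteq> (\<sigma> ^^ j) x" if "x \<in> S" "x \<noteq> b" "i < j" for x i j
  proof
    assume eq: "(\<sigma> ^^ i) x = (\<sigma> ^^ j) x"
    have "(\<sigma> ^^ j) x = (\<sigma> ^^ i) ((\<sigma> ^^ (j - i)) x)"
      using that(3) by (metis funpow_add comp_apply le_add_diff_inverse less_imp_le)
    then have "(\<sigma> ^^ (j - i)) x = x"
      using inji[of i] eq inS that(1) by (metis inj_onD)
    then show False using free that by (metis Suc_leI zero_less_diff One_nat_def)
  qed
  have orbit: "inj_on (\<lambda>i. (\<sigma> ^^ i) x) {..<N}" if "x \<in> S" "x \<noteq> b" for x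
    using orbit_lt[OF that] by (intro inj_onI) (metis linorder_neqE_nat)
  have Lnn: "0 \<le> L" unfolding L_def by (simp add: sum_nonneg)
  have suma: "(\<Sum>y\<in>A. cmod (a y)) \<le> L"
    unfolding L_def a_def by (intro sum_mono) auto
  have Aa1: "Aa x \<le> L / real N" if "x \<in> S" "x \<noteq> b" for x
  proof -
    have "(\<Sum>i<N. cmod (a ((\<sigma> ^^ i) x))) \<le> (\<Sum>y\<in>A. cmod (a y))"
      by (rule sum_along_injection_le[OF orbit[OF that]]) (use A in \<open>auto simp: a_def\<close>)
    then show ?thesis using suma N unfolding Aa_def by (intro divide_right_mono) auto
  qed
  define F' where "F' = F - {b}"
  have F': "finite F'" "F' \<subseteq> S" "b \<notin> F'" using F by (auto simp: F'_def)
  have Aa2: "(\<Sum>x\<in>F'. Aa x) \<le> L"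
  proof -
    have "(\<Sum>x\<in>F'. Aa x) = (\<Sum>i<N. \<Sum>x\<in>F'. cmod (a ((\<sigma> ^^ i) x))) / real N"
      unfolding Aa_def sum_divide_distrib[symmetric] by (subst sum.swap) simp
    also have "\<dots> \<le> (\<Sum>i<N. L) / real N"
    proof (intro divide_right_mono sum_mono)
      fix i
      have "(\<Sum>x\<in>F'. cmod (a ((\<sigma> ^^ i) x))) \<le> (\<Sum>y\<in>A. cmod (a y))"
        by (rule sum_along_injection_le) (use A F' inji[of i] in \<open>auto simp: a_def intro: inj_on_subset\<close>)
      then show "(\<Sum>x\<in>F'. cmod (a ((\<sigma> ^^ i) x))) \<le> L" using suma by simp
    qed auto
    also have "\<dots> = L" using N by simp
    finally show ?thesis .
  qed
  have Aann: "0 \<le> Aa x" for x unfolding Aa_def by (simp add: sum_nonneg)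
  have "(\<Sum>x\<in>F'. (Aa x)\<^sup>2) \<le> (\<Sum>x\<in>F'. L / real N * Aa x)"
    unfolding power2_eq_square
    by (intro sum_mono mult_right_mono Aa1 Aann) (use F' in auto)
  also have "\<dots> = L / real N * (\<Sum>x\<in>F'. Aa x)" by (simp add: sum_distrib_left)
  also have "\<dots> \<le> L / real N * L" using Aa2 Lnn by (intro mult_left_mono) auto
  finally have sqa: "(\<Sum>x\<in>F'. (Aa x)\<^sup>2) \<le> L\<^sup>2 / real N" by (simp add: power2_eq_square)
  have Ar1: "(Ar x)\<^sup>2 \<le> (\<Sum>i<N. (cmod (r ((\<sigma> ^^ i) x)))\<^sup>2) / real N" for x
  proof -
    have "(\<Sum>i<N. cmod (r ((\<sigma> ^^ i) x)))\<^sup>2 \<le> (\<Sum>i<N. (cmod (r ((\<sigma> ^^ i) x)))\<^sup>2) * real N"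
      using sum_squared_le_sum_of_squares[of "\<lambda>i. cmod (r ((\<sigma> ^^ i) x))" "{..<N}"]
      by (simp add: mult.commute)
    then have "(\<Sum>i<N. cmod (r ((\<sigma> ^^ i) x)))\<^sup>2 / (real N)\<^sup>2
        \<le> (\<Sum>i<N. (cmod (r ((\<sigma> ^^ i) x)))\<^sup>2) * real N / (real N)\<^sup>2"
      by (intro divide_right_mono) auto
    then show ?thesis using N by (simp add: Ar_def power_divide power2_eq_square)
  qed
  have "(\<Sum>x\<in>F'. (Ar x)\<^sup>2) \<le> (\<Sum>x\<in>F'. (\<Sum>i<N. (cmod (r ((\<sigma> ^^ i) x)))\<^sup>2) / real N)"
    by (intro sum_mono Ar1)
  also have "\<dots> = (\<Sum>i<N. \<Sum>x\<in>F'. (cmod (r ((\<sigma> ^^ i) x)))\<^sup>2) / real N"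
    unfolding sum_divide_distrib[symmetric] by (subst sum.swap) simp
  also have "\<dots> \<le> (\<Sum>i<N. \<epsilon>) / real N"
  proof (intro divide_right_mono sum_mono)
    fix i
    have "(\<Sum>x\<in>F'. (cmod (r ((\<sigma> ^^ i) x)))\<^sup>2) = (\<Sum>y\<in>(\<sigma> ^^ i) ` F'. (cmod (r y))\<^sup>2)"
      using inj_on_subset[OF inji F'(2), of i] by (simp add: sum.reindex)
    also have "\<dots> = (\<Sum>y\<in>(\<sigma> ^^ i) ` F' - A. (cmod (r y))\<^sup>2)"
      using F' by (intro sum.mono_neutral_right) (auto simp: r_def)
    also have "\<dots> \<le> (\<Sum>y\<in>(\<sigma> ^^ i) ` F' - A. (cmod (\<phi> y))\<^sup>2)"
      by (intro sum_mono) (auto simp: r_def)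
    also have "\<dots> \<le> \<epsilon>" using F' inS by (intro tail) auto
    finally show "(\<Sum>x\<in>F'. (cmod (r ((\<sigma> ^^ i) x)))\<^sup>2) \<le> \<epsilon>" .
  qed auto
  also have "\<dots> = \<epsilon>" using N by simp
  finally have sqr: "(\<Sum>x\<in>F'. (Ar x)\<^sup>2) \<le> \<epsilon>" .
  have pt: "(cmod (average S \<sigma> N \<phi> x - \<phi> b * basis_vector b x))\<^sup>2 \<le> 2 * (Aa x)\<^sup>2 + 2 * (Ar x)\<^sup>2"
    if "x \<in> F'" for x
  proof -
    have x: "x \<in> S" "x \<noteq> b" using that F' by auto
    have "cmod (average S \<sigma> N \<phi> x - \<phi> b * basis_vector b x) = cmod (\<Sum>i<N. \<phi> ((\<sigma> ^^ i) x)) / real N"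
      using x by (simp add: average_def basis_vector_def norm_divide)
    also have "\<dots> \<le> (\<Sum>i<N. cmod (\<phi> ((\<sigma> ^^ i) x))) / real N"
      by (intro divide_right_mono norm_sum) auto
    also have "\<dots> = Aa x + Ar x"
      unfolding Aa_def Ar_def add_divide_distrib[symmetric] sum.distrib[symmetric]
      by (intro arg_cong2[where f = "(/)"] sum.cong refl)
        (use neb[OF x] in \<open>auto simp: a_def r_def\<close>)
    finally have "(cmod (average S \<sigma> N \<phi> x - \<phi> b * basis_vector b x))\<^sup>2 \<le> (Aa x + Ar x)\<^sup>2"
      by (intro power_mono) auto
    also have "\<dots> \<le> 2 * (Aa x)\<^sup>2 + 2 * (Ar x)\<^sup>2"
      using zero_le_power2[of "Aa x - Ar x"] by (simp add: power2_eq_square algebra_simps)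
    finally show ?thesis .
  qed
  have "(\<Sum>x\<in>F. (cmod (average S \<sigma> N \<phi> x - \<phi> b * basis_vector b x))\<^sup>2)
      = (\<Sum>x\<in>F'. (cmod (average S \<sigma> N \<phi> x - \<phi> b * basis_vector b x))\<^sup>2)"
    using F base bi N
    by (intro sum.mono_neutral_right) (auto simp: F'_def average_def basis_vector_def)
  also have "\<dots> \<le> (\<Sum>x\<in>F'. 2 * (Aa x)\<^sup>2 + 2 * (Ar x)\<^sup>2)" by (intro sum_mono pt)
  also have "\<dots> = 2 * (\<Sum>x\<in>F'. (Aa x)\<^sup>2) + 2 * (\<Sum>x\<in>F'. (Ar x)\<^sup>2)"
    by (simp add: sum.distrib sum_distrib_left)
  also have "\<dots> \<le> 2 * L\<^sup>2 / real N + 2 * \<epsilon>" using sqa sqr by simp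
  finally show ?thesis unfolding L_def .
qed

lemma ell2_tail:
  fixes \<phi> :: "'a \<Rightarrow> complex"
  assumes "\<phi> \<in> ell2 S" "0 < \<epsilon>"
  obtains A where "finite A" "A \<subseteq> S"
    "\<And>F. finite F \<Longrightarrow> F \<subseteq> S - A \<Longrightarrow> (\<Sum>x\<in>F. (cmod (\<phi> x))\<^sup>2) \<le> \<epsilon>"
proof -
  let ?f = "\<lambda>x. (cmod (\<phi> x))\<^sup>2"
  have s: "?f summable_on S" using assms by (simp add: ell2_def)
  obtain A where A: "finite A" "A \<subseteq> S" "dist (sum ?f A) (infsum ?f S) \<le> \<epsilon>"
    using infsum_finite_approximation[OF s assms(2)] by metis
  have "(\<Sum>x\<in>F. ?f x) \<le> \<epsilon>" if F: "finite F" "F \<subseteq> S - A" for F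
  proof -
    have "sum ?f A + sum ?f F = sum ?f (A \<union> F)"
      using A F by (intro sum.union_disjoint[symmetric]) auto
    also have "\<dots> \<le> infsum ?f S"
      using A F s by (intro finite_sum_le_infsum) auto
    finally show ?thesis using A(3) by (simp add: dist_real_def)
  qed
  then show ?thesis using that A by blast
qed

lemma ell2_norm_le:
  assumes "\<And>F. finite F \<Longrightarrow> F \<subseteq> S \<Longrightarrow> (\<Sum>x\<in>F. (cmod (\<psi> x))\<^sup>2) \<le> c"
  shows "ell2_norm S \<psi> \<le> sqrt c"
proof -
  have "(\<lambda>x. (cmod (\<psi> x))\<^sup>2) summable_on S"
    using assms by (intro nonneg_bounded_partial_sums_imp_summable_on[of _ _ c])
      (auto intro: eventually_finite_subsets_at_top_weakI)
  then show ?thesis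
    unfolding ell2_norm_def using assms by (intro real_sqrt_le_mono infsum_le_finite_sums) auto
qed

lemma ell2_norm_nonneg: "0 \<le> ell2_norm S \<psi>"
  unfolding ell2_norm_def by (simp add: infsum_nonneg)

text \<open>
  The elementary form of the mean ergodic theorem for a permutation whose only finite orbit is a
  fixed point \<open>b\<close>: the averages converge to the orthogonal projection onto the invariant vectors,
  which are the multiples of the basis vector at \<open>b\<close>.
\<close>

lemma average_tendsto:
  fixes \<phi> :: "'a \<Rightarrow> complex"
  assumes inj: "inj_on \<sigma> S" and maps: "\<sigma> ` S \<subseteq> S"
    and base: "b \<in> S" "\<sigma> b = b"
    and free: "\<And>x t. x \<in> S \<Longrightarrow> x \<noteq> b \<Longrightarrow> 1 \<le> t \<Longrightarrow> (\<sigma> ^^ t) x \<noteq> x"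
    and \<phi>: "\<phi> \<in> ell2 S"
  shows "(\<lambda>N. ell2_norm S (\<lambda>x. average S \<sigma> N \<phi> x - \<phi> b * basis_vector b x)) \<longlonglongrightarrow> 0"
proof (rule LIMSEQ_I)
  fix e :: real assume e: "0 < e"
  define \<epsilon> where "\<epsilon> = e\<^sup>2 / 8"
  have \<epsilon>: "0 < \<epsilon>" using e by (simp add: \<epsilon>_def)
  obtain A where A: "finite A" "A \<subseteq> S"
    "\<And>F. finite F \<Longrightarrow> F \<subseteq> S - A \<Longrightarrow> (\<Sum>x\<in>F. (cmod (\<phi> x))\<^sup>2) \<le> \<epsilon>"
    using ell2_tail[OF \<phi> \<epsilon>] by metis
  define L where "L = (\<Sum>y\<in>A. cmod (\<phi> y))"
  obtain N0 :: nat where N0: "2 * L\<^sup>2 / \<epsilon> < real N0" using reals_Archimedean2 by blast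
  have "norm (ell2_norm S (\<lambda>x. average S \<sigma> N \<phi> x - \<phi> b * basis_vector b x) - 0) < e"
    if N: "N \<ge> Suc N0" for N
  proof -
    have Npos: "0 < N" using N by simp
    have "2 * L\<^sup>2 < real N0 * \<epsilon>" using N0 \<epsilon> by (simp add: pos_divide_less_eq)
    also have "\<dots> \<le> real N * \<epsilon>" using N \<epsilon> by (intro mult_right_mono) auto
    finally have small: "2 * L\<^sup>2 / real N \<le> \<epsilon>" using Npos by (simp add: pos_divide_le_eq mult.commute)
    have "ell2_norm S (\<lambda>x. average S \<sigma> N \<phi> x - \<phi> b * basis_vector b x) \<le> sqrt (3 * \<epsilon>)"
    proof (rule ell2_norm_le)
      fix F assume "finite F" "F \<subseteq> S"
      from average_bound[OF inj maps base free A this Npos]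
      show "(\<Sum>x\<in>F. (cmod (average S \<sigma> N \<phi> x - \<phi> b * basis_vector b x))\<^sup>2) \<le> 3 * \<epsilon>"
        using small by (simp add: L_def)
    qed
    also have "\<dots> < sqrt (e\<^sup>2)" using e by (intro real_sqrt_less_mono) (simp add: \<epsilon>_def)
    finally show ?thesis using e ell2_norm_nonneg[of S] by simp
  qed
  then show "\<exists>no. \<forall>N\<ge>no. norm (ell2_norm S (\<lambda>x. average S \<sigma> N \<phi> x - \<phi> b * basis_vector b x) - 0) < e"
    by blast
qed

lemma closed_ell2_subspace_sum:
  assumes "closed_ell2_subspace S V" "finite I" "\<And>i. i \<in> I \<Longrightarrow> \<Phi> i \<in> V"
  shows "(\<lambda>x. \<Sum>i\<in>I. \<Phi> i x) \<in> V"
  using assms(2,3)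
proof (induction I rule: finite_induct)
  case empty
  then show ?case using assms(1) by (simp add: closed_ell2_subspace_def)
next
  case (insert i I)
  then show ?case using assms(1) by (auto simp: closed_ell2_subspace_def)
qed

text \<open>
  Finitely supported vectors are dense: truncating to finite sets that carry almost all of the
  squared norm gives a sequence in the subspace with the required limit.
\<close>

lemma closed_subspace_with_basis:
  assumes V: "closed_ell2_subspace S V" and basis: "\<And>a. a \<in> S \<Longrightarrow> basis_vector a \<in> V"
  shows "V = ell2 S"
proof
  show "V \<subseteq> ell2 S" using V by (simp add: closed_ell2_subspace_def)
  show "ell2 S \<subseteq> V"
  proof
    fix \<psi> assume \<psi>: "\<psi> \<in> ell2 S"
    have "\<exists>A. finite A \<and> A \<subseteq> S \<and> (\<forall>F. finite F \<longrightarrow> F \<subseteq> S - A \<longrightarrow>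
        (\<Sum>x\<in>F. (cmod (\<psi> x))\<^sup>2) \<le> inverse (real (Suc k)))" for k
      using ell2_tail[OF \<psi>, of "inverse (real (Suc k))"] by (metis inverse_positive_iff_positive of_nat_0_less_iff zero_less_Suc)
    then obtain A where A: "\<And>k. finite (A k)" "\<And>k. A k \<subseteq> S"
      "\<And>k F. finite F \<Longrightarrow> F \<subseteq> S - A k \<Longrightarrow> (\<Sum>x\<in>F. (cmod (\<psi> x))\<^sup>2) \<le> inverse (real (Suc k))"
      by metis
    define \<Phi> where "\<Phi> k = (\<lambda>x. \<Sum>a\<in>A k. \<psi> a * basis_vector a x)" for k
    have \<Phi>: "\<Phi> k \<in> V" for k
      unfolding \<Phi>_def
    proof (rule closed_ell2_subspace_sum[OF V A(1)])
      fix a assume "a \<in> A k"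
      then have "basis_vector a \<in> V" using basis A(2) by blast
      then show "(\<lambda>x. \<psi> a * basis_vector a x) \<in> V" using V by (simp add: closed_ell2_subspace_def)
    qed
    have \<Phi>x: "\<Phi> k x - \<psi> x = (if x \<in> A k then 0 else - \<psi> x)" for k x
    proof -
      have "\<Phi> k x = (\<Sum>a\<in>A k. if a = x then \<psi> a else 0)"
        unfolding \<Phi>_def basis_vector_def by (intro sum.cong) auto
      then show ?thesis using A(1) by (simp add: sum.delta)
    qed
    have le: "ell2_norm S (\<lambda>x. \<Phi> k x - \<psi> x) \<le> sqrt (inverse (real (Suc k)))" for k
    proof (rule ell2_norm_le)
      fix F assume F: "finite F" "F \<subseteq> S"
      have "(\<Sum>x\<in>F. (cmod (\<Phi> k x - \<psi> x))\<^sup>2) = (\<Sum>x\<in>F - A k. (cmod (\<psi> x))\<^sup>2)"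
        using F by (intro sum.mono_neutral_cong_right) (auto simp: \<Phi>x)
      also have "\<dots> \<le> inverse (real (Suc k))" using F by (intro A(3)) auto
      finally show "(\<Sum>x\<in>F. (cmod (\<Phi> k x - \<psi> x))\<^sup>2) \<le> inverse (real (Suc k))" .
    qed
    have "(\<lambda>k. sqrt (inverse (real (Suc k)))) \<longlonglongrightarrow> sqrt 0"
      by (intro tendsto_real_sqrt LIMSEQ_inverse_real_of_nat)
    then have "(\<lambda>k. sqrt (inverse (real (Suc k)))) \<longlonglongrightarrow> 0" by simp
    then have "(\<lambda>k. ell2_norm S (\<lambda>x. \<Phi> k x - \<psi> x)) \<longlonglongrightarrow> 0"
      by (rule tendsto_sandwich[rotated 3, where f = "\<lambda>_. 0"])
        (auto simp: le ell2_norm_nonneg simp del: of_nat_Suc)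
    then show "\<psi> \<in> V" using V \<Phi> \<psi> unfolding closed_ell2_subspace_def by blast
  qed
qed

section \<open>Subgroups with an element that moves every other coset freely\<close>

lemma (in group) lcoset_pow:
  assumes "x \<in> carrier G" "C \<subseteq> carrier G"
  shows "((\<lambda>C. x <# C) ^^ i) C = (x [^] (i::nat)) <# C"
proof (induction i)
  case 0
  then show ?case using assms lcos_mult_one by simp
next
  case (Suc i)
  have "((\<lambda>C. x <# C) ^^ Suc i) C = x <# ((x [^] i) <# C)" using Suc by simp
  also have "\<dots> = (x \<otimes> x [^] i) <# C" using assms by (intro lcos_m_assoc) auto
  also have "x \<otimes> x [^] i = x [^] Suc i"
    using assms(1) by (metis nat_pow_Suc2)
  finally show ?case .
qed

text \<open>
  If \<open>g\<close> commensurates \<open>H\<close>, two different powers of \<open>h\<close> lie in the same coset of the intersection, so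
  a power of \<open>h\<close> with positive exponent lies in the conjugate of \<open>H\<close> by \<open>g\<close>. This power then fixes
  the coset of \<open>g\<close>, which is impossible unless \<open>g \<in> H\<close>.
\<close>

lemma (in group) commensurator_eqI:
  assumes H: "subgroup H G" and h: "h \<in> H"
    and free: "\<And>g t. g \<in> carrier G \<Longrightarrow> g \<notin> H \<Longrightarrow> 1 \<le> t \<Longrightarrow> (h [^] (t::nat)) <# (g <# H) \<noteq> g <# H"
  shows "commensurator G H = H"
proof -
  interpret H: subgroup H G by fact
  have hG: "h \<in> carrier G" using h by simp
  have conj_self: "conjugate G g H = H" if "g \<in> H" for g
  proof -
    have "H #> inv g = H" using that by (intro coset_join2) (auto simp: H)
    moreover have "g <# H = H" using that by (intro coset_join3) (auto simp: H)
    ultimately show ?thesis by (simp add: conjugate_def)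
  qed
  show ?thesis
  proof
    show "H \<subseteq> commensurator G H"
    proof
      fix g assume g: "g \<in> H"
      interpret HG: group "G\<lparr>carrier := H\<rparr>" using H subgroup.subgroup_is_group is_group by blast
      have "rcosets\<^bsub>G\<lparr>carrier := H\<rparr>\<^esub> H \<subseteq> {H}"
        using HG.coset_join2[OF _ HG.subgroup_self]
        by (auto simp: RCOSETS_def)
      then have "finite (rcosets\<^bsub>G\<lparr>carrier := H\<rparr>\<^esub> H)" using finite_subset by blast
      then show "g \<in> commensurator G H"
        using g by (simp add: commensurator_def conj_self finite_index_def)
    qed
    show "commensurator G H \<subseteq> H"
    proof
      fix g assume g: "g \<in> commensurator G H"
      show "g \<in> H"
      proof (rule ccontr)
        assume gH: "g \<notin> H"
        have gG: "g \<in> carrier G" using g by (simp add: commensurator_def)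
        define L where "L = H \<inter> conjugate G g H"
        have fin: "finite (rcosets\<^bsub>G\<lparr>carrier := H\<rparr>\<^esub> L)"
          using g by (simp add: commensurator_def finite_index_def L_def)
        have hH: "h [^] (i::nat) \<in> H" for i by (induction i) (use h in auto)
        have "(\<lambda>i::nat. L #>\<^bsub>G\<lparr>carrier := H\<rparr>\<^esub> (h [^] i)) ` UNIV \<subseteq> rcosets\<^bsub>G\<lparr>carrier := H\<rparr>\<^esub> L"
          using hH by (auto simp: RCOSETS_def)
        then have "finite ((\<lambda>i::nat. L #> (h [^] i)) ` UNIV)"
          using fin by (auto simp: r_coset_def intro: finite_subset)
        then have "\<not> inj (\<lambda>i::nat. L #> (h [^] i))" using finite_imageD infinite_UNIV_nat by blast
        then obtain a b :: nat where ab: "a \<noteq> b" "L #> (h [^] a) = L #> (h [^] b)"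
          by (auto simp: inj_def)
        obtain i j :: nat where ij: "i < j" "L #> (h [^] i) = L #> (h [^] j)"
        proof (cases "a < b")
          case True
          then show ?thesis using that ab(2) by blast
        next
          case False
          then show ?thesis using that[of b a] ab by simp
        qed
        have "g \<otimes> (\<one> \<otimes> inv g) \<in> conjugate G g H"
          unfolding conjugate_def l_coset_def r_coset_def using H.one_closed by blast
        then have "\<one> \<in> conjugate G g H" using gG by simp
        then have "\<one> \<in> L" by (simp add: L_def)
        then have "\<one> \<otimes> h [^] j \<in> L #> (h [^] j)" by (auto simp: r_coset_def)
        then have "\<one> \<otimes> h [^] j \<in> L #> (h [^] i)" by (simp only: ij(2))
        then have "\<exists>l\<in>L. h [^] j = l \<otimes> h [^] i"
          using hG unfolding r_coset_def by simp
        then obtain l where l: "l \<in> L" "h [^] j = l \<otimes> h [^] i" by blast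
        have lG: "l \<in> carrier G" using l by (auto simp: L_def)
        have "h [^] j = h [^] (j - i) \<otimes> h [^] i" using hG ij(1) by (simp add: nat_pow_mult)
        then have "l = h [^] (j - i)" using l(2) lG hG by (metis nat_pow_closed right_cancel)
        then have "h [^] (j - i) \<in> conjugate G g H" using l by (simp add: L_def)
        then obtain k where k: "k \<in> H" "h [^] (j - i) = g \<otimes> (k \<otimes> inv g)"
          unfolding conjugate_def l_coset_def r_coset_def by blast
        have "h [^] (j - i) \<otimes> g = g \<otimes> k" using k gG by (simp add: m_assoc)
        then have "(h [^] (j - i)) <# (g <# H) = (g \<otimes> k) <# H"
          using lcos_m_assoc[OF H.subset, of "h [^] (j - i)" g] hG gG by simp
        also have "\<dots> = g <# (k <# H)"
          using lcos_m_assoc[OF H.subset, of g k] gG k(1) by simp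
        also have "k <# H = H" using k(1) by (simp add: H coset_join3)
        finally show False using free[OF gG gH, of "j - i"] ij(1) by simp
      qed
    qed
  qed
qed

text \<open>
  A nonzero vector of an invariant subspace can be translated so that its value at the base coset
  \<open>H\<close> is nonzero. Averaging the translate over the powers of \<open>h\<close> yields, in the limit, a nonzero
  multiple of the basis vector at \<open>H\<close>; its translates are all the basis vectors.
\<close>

theorem (in group) irreducible_linearizationI:
  assumes H: "subgroup H G" and h: "h \<in> H"
    and free: "\<And>g t. g \<in> carrier G \<Longrightarrow> g \<notin> H \<Longrightarrow> 1 \<le> t \<Longrightarrow> (h [^] (t::nat)) <# (g <# H) \<noteq> g <# H"
  shows "irreducible_rep G (lcosets H) (linearization G H)"
  unfolding irreducible_rep_def
proof (intro allI impI, elim conjE)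
  interpret H: subgroup H G by fact
  let ?S = "lcosets H"
  fix V assume V: "closed_ell2_subspace ?S V"
    and inv: "\<forall>g\<in>carrier G. \<forall>\<phi>\<in>V. linearization G H g \<phi> \<in> V"
  have hG: "h \<in> carrier G" using h by simp
  have Vsub: "\<And>\<phi>. \<phi> \<in> V \<Longrightarrow> \<phi> \<in> ell2 ?S" and V0: "(\<lambda>x. 0) \<in> V"
    using V by (auto simp: closed_ell2_subspace_def)
  have Vmult: "(\<lambda>x. c * \<phi> x) \<in> V" if "\<phi> \<in> V" for c \<phi>
    using V that by (simp add: closed_ell2_subspace_def)
  have Vlim: "\<psi> \<in> V"
    if "\<And>k. \<Phi> k \<in> V" "\<psi> \<in> ell2 ?S" "(\<lambda>k. ell2_norm ?S (\<lambda>x. \<Phi> k x - \<psi> x)) \<longlonglongrightarrow> 0" for \<Phi> \<psi>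
  proof -
    from V have "\<forall>\<Phi> \<psi>. (\<forall>k::nat. \<Phi> k \<in> V) \<and> \<psi> \<in> ell2 ?S \<and>
        (\<lambda>k. ell2_norm ?S (\<lambda>x. \<Phi> k x - \<psi> x)) \<longlonglongrightarrow> 0 \<longrightarrow> \<psi> \<in> V"
      unfolding closed_ell2_subspace_def by (elim conjE)
    then show ?thesis using that by (elim allE[of _ \<Phi>] allE[of _ \<psi>] impE) auto
  qed
  have sub: "C \<subseteq> carrier G" if "C \<in> ?S" for C
    using that H.lcosets_carrier is_group by blast
  have one: "\<one> <# H = H" using lcos_mult_one H.subset by simp
  have HS: "H \<in> ?S" using one by (auto simp: LCOSETS_def)
  have act: "x <# C \<in> ?S" if "x \<in> carrier G" "C \<in> ?S" for x C
    using that lcos_m_assoc[OF H.subset] by (auto simp: LCOSETS_def)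
  have cancel: "inv x <# (x <# C) = C" "x <# (inv x <# C) = C" if "x \<in> carrier G" "C \<in> ?S" for x C
    using that lcos_m_assoc[OF sub[OF that(2)], of "inv x" x] lcos_m_assoc[OF sub[OF that(2)], of x "inv x"]
      lcos_mult_one[OF sub[OF that(2)]] by auto
  show "V = {\<lambda>x. 0} \<or> V = ell2 ?S"
  proof (cases "V = {\<lambda>x. 0}")
    case False
    then obtain \<phi> C where \<phi>: "\<phi> \<in> V" "\<phi> C \<noteq> 0" using V0 by fastforce
    then have "C \<in> ?S" using Vsub[OF \<phi>(1)] by (auto simp: ell2_def)
    then obtain g where g: "g \<in> carrier G" "C = g <# H" by (auto simp: LCOSETS_def)
    define \<psi> where "\<psi> = linearization G H (inv g) \<phi>"
    have \<psi>: "\<psi> \<in> V" using inv \<phi> g by (simp add: \<psi>_def)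
    have \<psi>H: "\<psi> H \<noteq> 0" using \<phi> g HS by (simp add: \<psi>_def linearization_def)
    \<comment> \<open>The operator of \<open>h\<close> acts on functions by precomposition with the inverse of \<open>h\<close>.\<close>
    define \<sigma> where "\<sigma> C = inv h <# C" for C
    have \<sigma>pow: "(\<sigma> ^^ i) C = inv (h [^] i) <# C" if "C \<in> ?S" for i C
      using lcoset_pow[of "inv h" C i] hG sub[OF that] unfolding \<sigma>_def by (simp add: nat_pow_inv)
    have avg: "average ?S \<sigma> N \<psi> \<in> V" for N
    proof -
      have "(\<lambda>x. \<Sum>i<N. linearization G H (h [^] i) \<psi> x) \<in> V"
        using inv \<psi> hG by (intro closed_ell2_subspace_sum[OF V]) auto
      then have "(\<lambda>x. inverse (of_nat N) * (\<Sum>i<N. linearization G H (h [^] i) \<psi> x)) \<in> V" by (rule Vmult)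
      also have "(\<lambda>x. inverse (of_nat N) * (\<Sum>i<N. linearization G H (h [^] i) \<psi> x)) = average ?S \<sigma> N \<psi>"
        by (auto simp: average_def linearization_def \<sigma>pow fun_eq_iff divide_inverse mult.commute)
      finally show ?thesis .
    qed
    have lim: "(\<lambda>N. ell2_norm ?S (\<lambda>x. average ?S \<sigma> N \<psi> x - \<psi> H * basis_vector H x)) \<longlonglongrightarrow> 0"
    proof (rule average_tendsto)
      show "inj_on \<sigma> ?S" using cancel(2)[OF hG] unfolding \<sigma>_def by (metis inj_onI)
      show "\<sigma> ` ?S \<subseteq> ?S" using act hG by (auto simp: \<sigma>_def)
      show "H \<in> ?S" by (fact HS)
      show "\<sigma> H = H" unfolding \<sigma>_def using h by (simp add: H coset_join3)
      show "\<psi> \<in> ell2 ?S" using Vsub \<psi> by blast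
      fix D and t :: nat assume D: "D \<in> ?S" "D \<noteq> H" "1 \<le> t"
      then obtain d where d: "d \<in> carrier G" "D = d <# H" by (auto simp: LCOSETS_def)
      have dH: "d \<notin> H" using D d by (auto simp: H coset_join3)
      have "h [^] t <# D \<noteq> D" using free[OF d(1) dH D(3)] d by simp
      then show "(\<sigma> ^^ t) D \<noteq> D"
        using \<sigma>pow[OF D(1), of t] cancel(2)[OF nat_pow_closed[OF hG, of t] D(1)] by metis
    qed
    have "finite {x \<in> ?S. (cmod (\<psi> H * basis_vector H x))\<^sup>2 \<noteq> 0}"
    proof (rule finite_subset)
      show "{x \<in> ?S. (cmod (\<psi> H * basis_vector H x))\<^sup>2 \<noteq> 0} \<subseteq> {H}"
        by (rule subsetI, rule ccontr) (simp add: basis_vector_def)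
    qed simp
    then have "(\<lambda>x. (cmod (\<psi> H * basis_vector H x))\<^sup>2) summable_on ?S"
      by (rule finite_nonzero_values_imp_summable_on)
    then have "(\<lambda>x. \<psi> H * basis_vector H x) \<in> ell2 ?S"
      using HS by (simp add: ell2_def basis_vector_def)
    then have "(\<lambda>x. \<psi> H * basis_vector H x) \<in> V"
      using Vlim[OF avg _ lim] by simp
    from Vmult[OF this, of "inverse (\<psi> H)"]
    have bH: "basis_vector H \<in> V" using \<psi>H by (simp add: mult.assoc[symmetric])
    have "basis_vector D \<in> V" if D: "D \<in> ?S" for D
    proof -
      obtain d where d: "d \<in> carrier G" "D = d <# H" using D by (auto simp: LCOSETS_def)
      have "linearization G H d (basis_vector H) = basis_vector D"
      proof
        fix C
        have "inv d <# C = H \<longleftrightarrow> C = D" if "C \<in> ?S"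
          using cancel[OF d(1) that] cancel[OF d(1) HS] d by metis
        then show "linearization G H d (basis_vector H) C = basis_vector D C"
          using D by (auto simp: linearization_def basis_vector_def)
      qed
      then show ?thesis using inv bH d(1) by metis
    qed
    then show ?thesis using closed_subspace_with_basis[OF V] by blast
  qed simp
qed

section \<open>Binary digit sums\<close>

fun bitsum :: "nat \<Rightarrow> nat" where
  "bitsum m = (if m = 0 then 0 else m mod 2 + bitsum (m div 2))"

declare bitsum.simps [simp del]

lemma bitsum_0 [simp]: "bitsum 0 = 0"
  by (simp add: bitsum.simps)

lemma bitsum_double [simp]: "bitsum (2 * m) = bitsum m"
  by (cases "m = 0") (simp_all add: bitsum.simps[of "2 * m"])

lemma bitsum_Suc_double [simp]: "bitsum (Suc (2 * m)) = Suc (bitsum m)"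
  by (simp add: bitsum.simps[of "Suc (2 * m)"])

text \<open>
  The binary expansion of \<open>m * 2 ^ i + j\<close> is that of \<open>m\<close> followed by the \<open>i\<close> digits of \<open>j\<close>.
\<close>

lemma bitsum_append: "j < 2 ^ i \<Longrightarrow> bitsum (m * 2 ^ i + j) = bitsum m + bitsum j"
proof (induction i arbitrary: j)
  case (Suc i)
  have "j div 2 < 2 ^ i" using Suc.prems by auto
  note IH = Suc.IH[OF this]
  show ?case
  proof (cases "even j")
    case True
    then obtain q where q: "j = 2 * q" by (elim evenE)
    have "m * 2 ^ Suc i + j = 2 * (m * 2 ^ i + q)" by (simp add: q)
    then show ?thesis using IH q by (simp only: bitsum_double) simp
  next
    case False
    then obtain q where q: "j = Suc (2 * q)" by (metis oddE Suc_eq_plus1)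
    have "m * 2 ^ Suc i + j = Suc (2 * (m * 2 ^ i + q))" by (simp add: q)
    then show ?thesis using IH q by (simp only: bitsum_Suc_double) simp
  qed
qed simp

lemma bitsum_shift [simp]: "bitsum (m * 2 ^ i) = bitsum m"
  using bitsum_append[of 0 i m] by simp

lemma bitsum_ones [simp]: "bitsum (2 ^ i - Suc 0) = i"
proof (induction i)
  case (Suc i)
  have "(2::nat) ^ Suc i - Suc 0 = Suc (2 * (2 ^ i - Suc 0))"
    by (cases "(2::nat) ^ i") auto
  then show ?case using Suc by (simp only: bitsum_Suc_double)
qed simp

text \<open>
  The digit sum of the binary expansion of a nonnegative dyadic number; by \<open>bitsum_shift\<close> it is the
  same for every way of writing the number as a fraction.
\<close>

definition dyadic_sum :: "real \<Rightarrow> nat" where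
  "dyadic_sum x = (THE s. \<exists>m k. x = real m / 2 ^ k \<and> s = bitsum m)"

lemma standard_fraction_eq_iff:
  "real m / 2 ^ k = real m' / 2 ^ k' \<longleftrightarrow> m * 2 ^ k' = m' * 2 ^ k"
proof -
  have "real m / 2 ^ k = real m' / 2 ^ k' \<longleftrightarrow> real (m * 2 ^ k') = real (m' * 2 ^ k)"
    by (simp add: field_simps)
  then show ?thesis by (simp only: of_nat_eq_iff)
qed

lemma dyadic_sum_eq [simp]: "dyadic_sum (real m / 2 ^ k) = bitsum m"
  unfolding dyadic_sum_def
proof (rule the_equality)
  fix s assume "\<exists>m' k'. real m / 2 ^ k = real m' / 2 ^ k' \<and> s = bitsum m'"
  then obtain m' k' where m': "m * 2 ^ k' = m' * 2 ^ k" "s = bitsum m'"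
    by (auto simp: standard_fraction_eq_iff)
  then have "bitsum m = bitsum m'" using bitsum_shift by metis
  then show "s = bitsum m" using m' by simp
qed auto

lemma dyadic_sum_0 [simp]: "dyadic_sum 0 = 0"
  using dyadic_sum_eq[of 0 0] by simp

text \<open>
  The point \<open>1\<close>, which all elements of the group fix, is left out: the numbers below \<open>1\<close> are those
  whose binary expansion starts after the point.
\<close>

definition unit_dyadics :: "real set" where
  "unit_dyadics = {real m / 2 ^ k | m k. m < 2 ^ k}"

lemma unit_dyadics_bounds: "x \<in> unit_dyadics \<Longrightarrow> 0 \<le> x \<and> x < 1"
proof -
  assume "x \<in> unit_dyadics"
  then obtain m k where x: "x = real m / 2 ^ k" "m < 2 ^ k" by (auto simp: unit_dyadics_def)
  have "real m < 2 ^ k" using x(2) by (metis of_nat_less_iff of_nat_numeral of_nat_power)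
  then show ?thesis using x by simp
qed

section \<open>Maps between standard dyadic intervals\<close>

text \<open>
  The function maps the standard dyadic interval from \<open>m / 2 ^ k\<close> to \<open>(m + 1) / 2 ^ k\<close> affinely onto the
  one from \<open>m' / 2 ^ k'\<close> to \<open>(m' + 1) / 2 ^ k'\<close>. On binary expansions such a map replaces the prefix
  that names the first interval by the prefix that names the second.
\<close>

definition maps_standard :: "(real \<Rightarrow> real) \<Rightarrow> nat \<Rightarrow> nat \<Rightarrow> nat \<Rightarrow> nat \<Rightarrow> bool" where
  "maps_standard f k m k' m' \<longleftrightarrow> (\<forall>y\<in>{0..1}. f ((real m + y) / 2 ^ k) = (real m' + y) / 2 ^ k')"

lemma maps_standardD:
  "maps_standard f k m k' m' \<Longrightarrow> 0 \<le> y \<Longrightarrow> y \<le> 1 \<Longrightarrow> f ((real m + y) / 2 ^ k) = (real m' + y) / 2 ^ k'"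
  by (simp add: maps_standard_def)

lemma maps_standard_left: "maps_standard f k m k' m' \<Longrightarrow> f (real m / 2 ^ k) = real m' / 2 ^ k'"
  using maps_standardD[of f k m k' m' 0] by simp

lemma maps_standard_right: "maps_standard f k m k' m' \<Longrightarrow> f ((real m + 1) / 2 ^ k) = (real m' + 1) / 2 ^ k'"
  using maps_standardD[of f k m k' m' 1] by simp

lemma maps_standard_refine:
  assumes "maps_standard f k m k' m'" "r < 2 ^ j"
  shows "maps_standard f (k + j) (m * 2 ^ j + r) (k' + j) (m' * 2 ^ j + r)"
  unfolding maps_standard_def
proof
  fix y :: real assume y: "y \<in> {0..1}"
  have "real r + 1 \<le> 2 ^ j" using assms(2)
    by (metis Suc_leI add.commute of_nat_Suc of_nat_le_iff of_nat_numeral of_nat_power)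
  then have b: "0 \<le> (real r + y) / 2 ^ j" "(real r + y) / 2 ^ j \<le> 1" using y by auto
  have eq: "(real (a * 2 ^ j + r) + y) / 2 ^ (b + j) = (real a + (real r + y) / 2 ^ j) / 2 ^ b" for a b
    by (simp add: field_simps power_add)
  show "f ((real (m * 2 ^ j + r) + y) / 2 ^ (k + j)) = (real (m' * 2 ^ j + r) + y) / 2 ^ (k' + j)"
    unfolding eq by (rule maps_standardD[OF assms(1) b])
qed

text \<open>
  An affine map is determined by its values at the two ends of the interval.
\<close>

lemma maps_standard_from_endpoints:
  assumes "maps_standard f k m a b"
    and "f (real m / 2 ^ k) = real m' / 2 ^ k'" "f ((real m + 1) / 2 ^ k) = (real m' + 1) / 2 ^ k'"
  shows "maps_standard f k m k' m'"
  unfolding maps_standard_def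
proof
  fix y :: real assume y: "y \<in> {0..1}"
  have l: "real b / 2 ^ a = real m' / 2 ^ k'" and r: "(real b + 1) / 2 ^ a = (real m' + 1) / 2 ^ k'"
    using assms maps_standard_left maps_standard_right by metis+
  have conv: "(real c + y) / 2 ^ d = (1 - y) * (real c / 2 ^ d) + y * ((real c + 1) / 2 ^ d)" for c d :: nat
    by (simp add: field_simps)
  show "f ((real m + y) / 2 ^ k) = (real m' + y) / 2 ^ k'"
    using maps_standardD[OF assms(1)] y conv[of b a] conv[of m' k'] l r by simp
qed

text \<open>
  This is what makes a dipole reducible: if two sibling intervals are mapped onto two sibling
  intervals, the parent is mapped onto the parent.
\<close>

lemma maps_standard_glue:
  assumes "maps_standard f (Suc k) (2 * m) (Suc k') (2 * m')"
    and "maps_standard f (Suc k) (Suc (2 * m)) (Suc k') (Suc (2 * m'))"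
  shows "maps_standard f k m k' m'"
  unfolding maps_standard_def
proof
  fix y :: real assume y: "y \<in> {0..1}"
  show "f ((real m + y) / 2 ^ k) = (real m' + y) / 2 ^ k'"
  proof (cases "y \<le> 1 / 2")
    case True
    have "(real (2 * a) + 2 * y) / 2 ^ Suc b = (real a + y) / 2 ^ b" for a b by (simp add: field_simps)
    then show ?thesis using maps_standardD[OF assms(1), of "2 * y"] y True by simp
  next
    case False
    have "(real (Suc (2 * a)) + (2 * y - 1)) / 2 ^ Suc b = (real a + y) / 2 ^ b" for a b
      by (simp add: field_simps)
    then show ?thesis using maps_standardD[OF assms(2), of "2 * y - 1"] y False by simp
  qed
qed

definition standard_on :: "(real \<Rightarrow> real) \<Rightarrow> nat \<Rightarrow> nat \<Rightarrow> bool" where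
  "standard_on f k m \<longleftrightarrow> (\<exists>k' m'. maps_standard f k m k' m')"

definition standard_at_level :: "(real \<Rightarrow> real) \<Rightarrow> nat \<Rightarrow> bool" where
  "standard_at_level f M \<longleftrightarrow> (\<forall>m<2 ^ M. standard_on f M m)"

lemma standard_on_halves:
  assumes "standard_on f k m"
  shows "standard_on f (Suc k) (2 * m)" "standard_on f (Suc k) (Suc (2 * m))"
proof -
  obtain k' m' where "maps_standard f k m k' m'" using assms by (auto simp: standard_on_def)
  from maps_standard_refine[OF this, of 0 1] maps_standard_refine[OF this, of 1 1]
  show "standard_on f (Suc k) (2 * m)" "standard_on f (Suc k) (Suc (2 * m))"
    by (auto simp: standard_on_def mult.commute)
qed

lemma standard_at_level_add:
  assumes "standard_at_level f M"
  shows "standard_at_level f (M + j)"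
  unfolding standard_at_level_def
proof (intro allI impI)
  fix m :: nat assume m: "m < 2 ^ (M + j)"
  have "m div 2 ^ j < 2 ^ M" using m by (simp add: less_mult_imp_div_less power_add)
  then obtain k' m' where "maps_standard f M (m div 2 ^ j) k' m'"
    using assms by (auto simp: standard_at_level_def standard_on_def)
  moreover have "m mod 2 ^ j < 2 ^ j" by simp
  ultimately have "maps_standard f (M + j) (m div 2 ^ j * 2 ^ j + m mod 2 ^ j) (k' + j) (m' * 2 ^ j + m mod 2 ^ j)"
    by (rule maps_standard_refine)
  then show "standard_on f (M + j) m" unfolding div_mult_mod_eq by (auto simp: standard_on_def)
qed

lemma standard_at_level_mono: "standard_at_level f M \<Longrightarrow> M \<le> M' \<Longrightarrow> standard_at_level f M'"
  using standard_at_level_add[of f M "M' - M"] by simp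

section \<open>Thompson's group in terms of standard dyadic intervals\<close>

definition increasing_bij :: "(real \<Rightarrow> real) \<Rightarrow> bool" where
  "increasing_bij f \<longleftrightarrow> bij_betw f {0..1} {0..1} \<and> strict_mono_on {0..1} f"

lemma increasing_bij_facts:
  assumes "increasing_bij f"
  shows "f 0 = 0" "f 1 = 1"
    and "\<And>x. 0 \<le> x \<Longrightarrow> x \<le> 1 \<Longrightarrow> 0 \<le> f x \<and> f x \<le> 1"
    and "\<And>x y. 0 \<le> x \<Longrightarrow> x \<le> 1 \<Longrightarrow> 0 \<le> y \<Longrightarrow> y \<le> 1 \<Longrightarrow> f x < f y \<longleftrightarrow> x < y"
    and "\<And>x y. 0 \<le> x \<Longrightarrow> x \<le> 1 \<Longrightarrow> 0 \<le> y \<Longrightarrow> y \<le> 1 \<Longrightarrow> f x = f y \<longleftrightarrow> x = y"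
proof -
  have bij: "bij_betw f {0..1} {0..1}" and mono: "strict_mono_on {0..1} f"
    using assms by (auto simp: increasing_bij_def)
  show range: "0 \<le> f x \<and> f x \<le> 1" if "0 \<le> x" "x \<le> 1" for x
    using bij_betwE[OF bij] that by auto
  show less: "f x < f y \<longleftrightarrow> x < y" if "0 \<le> x" "x \<le> 1" "0 \<le> y" "y \<le> 1" for x y
    using strict_mono_on_less[OF mono] that by auto
  show eq: "f x = f y \<longleftrightarrow> x = y" if "0 \<le> x" "x \<le> 1" "0 \<le> y" "y \<le> 1" for x y
    using strict_mono_on_eq[OF mono] that by auto
  have onto: "\<exists>x\<in>{0..1}. f x = y" if "0 \<le> y" "y \<le> 1" for y
    using bij that by (metis atLeastAtMost_iff bij_betw_imp_surj_on imageE)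
  obtain x where x: "x \<in> {0..1}" "f x = 0" using onto[of 0] by auto
  show "f 0 = 0" using x less[of 0 x] range[of 0] by (cases "x = 0") auto
  obtain z where z: "z \<in> {0..1}" "f z = 1" using onto[of 1] by auto
  show "f 1 = 1" using z less[of z 1] range[of 1] by (cases "z = 1") auto
qed

lemma unit_cell:
  fixes x :: real
  assumes "0 \<le> x" "x < 1"
  obtains m where "m < 2 ^ M" "real m / 2 ^ M \<le> x" "x < (real m + 1) / 2 ^ M"
proof -
  define m where "m = nat \<lfloor>x * 2 ^ M\<rfloor>"
  have m: "real m \<le> x * 2 ^ M" "x * 2 ^ M < real m + 1"
    using assms by (auto simp: m_def)
  have "x * 2 ^ M < 2 ^ M" using assms by simp
  then have "real m < 2 ^ M" using m by linarith
  then have "m < 2 ^ M" by (metis of_nat_less_iff of_nat_numeral of_nat_power)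
  then show ?thesis using m by (intro that[of m]) (auto simp: field_simps)
qed

lemma unit_cell_closed:
  fixes x :: real
  assumes "0 \<le> x" "x \<le> 1"
  obtains m y where "m < 2 ^ M" "0 \<le> y" "y \<le> 1" "x = (real m + y) / 2 ^ M"
proof (cases "x < 1")
  case True
  then obtain m where "m < 2 ^ M" "real m / 2 ^ M \<le> x" "x < (real m + 1) / 2 ^ M"
    using unit_cell[OF assms(1)] by blast
  then show ?thesis using that[of m "x * 2 ^ M - real m"] by (simp add: field_simps)
next
  case False
  have "real (2 ^ M - 1) + 1 = 2 ^ M" by (simp add: of_nat_diff)
  then show ?thesis using that[of "2 ^ M - 1" 1] False assms by simp
qed

lemma cell_in_unit: "m < 2 ^ k \<Longrightarrow> 0 \<le> y \<Longrightarrow> y \<le> 1 \<Longrightarrow> 0 \<le> (real m + y) / 2 ^ k \<and> (real m + y) / 2 ^ k \<le> 1"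
proof -
  assume a: "m < 2 ^ k" "0 \<le> y" "y \<le> 1"
  have "real (Suc m) \<le> real (2 ^ k)" using a(1) by (simp only: of_nat_le_iff Suc_le_eq)
  then show ?thesis using a by simp
qed

lemma maps_standard_image_bound:
  assumes "increasing_bij f" "maps_standard f k m k' m'" "m < 2 ^ k"
  shows "m' < 2 ^ k'"
proof -
  have "f ((real m + 1) / 2 ^ k) \<le> 1"
    using increasing_bij_facts(3)[OF assms(1)] cell_in_unit[OF assms(3), of 1] by simp
  then have "(real m' + 1) / 2 ^ k' \<le> 1" using maps_standard_right[OF assms(2)] by simp
  then have "real (Suc m') \<le> real (2 ^ k')" by simp
  then show ?thesis by (simp only: of_nat_le_iff Suc_le_eq)
qed

lemma maps_standard_unique:
  assumes "maps_standard f k m a b" "maps_standard f k m c d"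
  shows "a = c \<and> b = d"
proof -
  have l: "real b / 2 ^ a = real d / 2 ^ c" and r: "(real b + 1) / 2 ^ a = (real d + 1) / 2 ^ c"
    using assms maps_standard_left maps_standard_right by metis+
  then have "1 / 2 ^ a = (1::real) / 2 ^ c" by (simp add: add_divide_distrib)
  then have "(2::real) ^ a = 2 ^ c" by simp
  then have "a = c" by simp
  then show ?thesis using l by simp
qed

lemma maps_standard_inverse:
  assumes "maps_standard f k m k' m'" "m < 2 ^ k"
    and "\<And>x. 0 \<le> x \<Longrightarrow> x \<le> 1 \<Longrightarrow> g (f x) = x"
  shows "maps_standard g k' m' k m"
  unfolding maps_standard_def
proof
  fix y :: real assume y: "y \<in> {0..1}"
  have "g (f ((real m + y) / 2 ^ k)) = (real m + y) / 2 ^ k"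
    using assms(3) cell_in_unit[OF assms(2)] y by simp
  then show "g ((real m' + y) / 2 ^ k') = (real m + y) / 2 ^ k"
    using maps_standardD[OF assms(1)] y by simp
qed

text \<open>
  If \<open>R\<close> exceeds the levels of all image intervals, every standard interval of level \<open>R\<close> lies inside
  one of them, because standard dyadic intervals are nested or have disjoint interiors. Its midpoint
  tells which one.
\<close>

lemma standard_at_level_inverse:
  assumes f: "increasing_bij f" and std: "standard_at_level f M"
    and g: "\<And>x. 0 \<le> x \<Longrightarrow> x \<le> 1 \<Longrightarrow> g (f x) = x"
  obtains R where "standard_at_level g R"
proof -
  obtain K E where KE: "\<And>q. q < 2 ^ M \<Longrightarrow> maps_standard f M q (K q) (E q)"
    using std unfolding standard_at_level_def standard_on_def by metis
  define R where "R = Max (K ` {..<2 ^ M})"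
  have KR: "K q \<le> R" if "q < 2 ^ M" for q
    unfolding R_def using that by (intro Max_ge) auto
  have "standard_on g R m" if m: "m < 2 ^ R" for m
  proof -
    define y0 where "y0 = (real m + 1 / 2) / 2 ^ R"
    have "0 \<le> y0 \<and> y0 \<le> 1" unfolding y0_def using cell_in_unit[OF m, of "1 / 2"] by simp
    then obtain x0 where x0: "x0 \<in> {0..1}" "f x0 = y0"
      using f unfolding increasing_bij_def by (metis atLeastAtMost_iff bij_betw_imp_surj_on imageE)
    obtain q t where q: "q < 2 ^ M" "0 \<le> t" "t \<le> 1" "x0 = (real q + t) / 2 ^ M"
      using unit_cell_closed[of x0 M] x0 by auto
    define d where "d = R - K q"
    have R: "R = K q + d" using KR[OF q(1)] by (simp add: d_def)
    have "y0 = (real (E q) + t) / 2 ^ K q" using x0 q maps_standardD[OF KE[OF q(1)]] by simp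
    moreover have "real m + 1 / 2 = y0 * 2 ^ R" by (simp add: y0_def)
    ultimately have "real m + 1 / 2 = (real (E q) + t) / 2 ^ K q * 2 ^ K q * 2 ^ d"
      by (simp only: R power_add mult.assoc)
    moreover have "(real (E q) + t) / 2 ^ K q * 2 ^ K q = real (E q) + t" by simp
    ultimately have eq: "real m + 1 / 2 = real (E q) * 2 ^ d + t * 2 ^ d"
      by (simp only: distrib_right)
    have "t * 2 ^ d \<le> 1 * 2 ^ d" "0 \<le> t * 2 ^ d" using q by (auto intro!: mult_right_mono)
    then have "real (E q) * 2 ^ d \<le> real m + 1 / 2" "real m + 1 / 2 \<le> real (E q) * 2 ^ d + 2 ^ d"
      unfolding eq by auto
    then have "real (E q * 2 ^ d) \<le> real m + 1 / 2" "real m + 1 / 2 \<le> real (E q * 2 ^ d + 2 ^ d)"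
      by auto
    then have "E q * 2 ^ d \<le> m" "m < E q * 2 ^ d + 2 ^ d" by linarith+
    then obtain r where r: "m = E q * 2 ^ d + r" "r < 2 ^ d" by (metis le_Suc_ex nat_add_left_cancel_less)
    from maps_standard_refine[OF maps_standard_inverse[OF KE[OF q(1)] q(1) g] r(2)]
    show ?thesis by (auto simp: standard_on_def R r(1))
  qed
  then show ?thesis using that by (auto simp: standard_at_level_def)
qed

text \<open>
  The image of an interval of level \<open>M + N\<close> has level at least \<open>N\<close>, since the image of an interval of
  level \<open>M\<close> has level at least \<open>0\<close>; so the second function maps it to a standard interval again.
\<close>

lemma standard_at_level_compose:
  assumes f: "increasing_bij f" and "standard_at_level f M" "standard_at_level g N"
  shows "standard_at_level (\<lambda>x. g (f x)) (M + N)"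
  unfolding standard_at_level_def
proof (intro allI impI)
  fix m :: nat assume m: "m < 2 ^ (M + N)"
  have q: "m div 2 ^ N < 2 ^ M" using m by (simp add: less_mult_imp_div_less power_add)
  then obtain k' m' where "maps_standard f M (m div 2 ^ N) k' m'"
    using assms by (auto simp: standard_at_level_def standard_on_def)
  moreover have "m mod 2 ^ N < 2 ^ N" by simp
  ultimately have "maps_standard f (M + N) (m div 2 ^ N * 2 ^ N + m mod 2 ^ N) (k' + N) (m' * 2 ^ N + m mod 2 ^ N)"
    by (rule maps_standard_refine)
  then have 1: "maps_standard f (M + N) m (k' + N) (m' * 2 ^ N + m mod 2 ^ N)" (is "maps_standard _ _ _ _ ?m")
    unfolding div_mult_mod_eq .
  have "standard_at_level g (k' + N)" using standard_at_level_mono[OF assms(3)] by simp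
  then obtain k'' m'' where "maps_standard g (k' + N) ?m k'' m''"
    using maps_standard_image_bound[OF f 1 m] by (auto simp: standard_at_level_def standard_on_def)
  then have "maps_standard (\<lambda>x. g (f x)) (M + N) m k'' m''"
    using 1 by (simp add: maps_standard_def)
  then show "standard_on (\<lambda>x. g (f x)) (M + N) m" by (auto simp: standard_on_def)
qed

lemma standard_at_level_cong:
  assumes "standard_at_level f M" "\<And>x. 0 \<le> x \<Longrightarrow> x \<le> 1 \<Longrightarrow> f x = g x"
  shows "standard_at_level g M"
  unfolding standard_at_level_def
proof (intro allI impI)
  fix m :: nat assume m: "m < 2 ^ M"
  then obtain k' m' where "maps_standard f M m k' m'"
    using assms(1) by (auto simp: standard_at_level_def standard_on_def)
  then have "maps_standard g M m k' m'"
    using assms(2) cell_in_unit[OF m] by (simp add: maps_standard_def)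
  then show "standard_on g M m" by (auto simp: standard_on_def)
qed

lemma continuous_on_standard:
  assumes "standard_at_level f M"
  shows "continuous_on {0..1} f"
proof -
  define U :: "nat \<Rightarrow> real set" where "U m = {real m / 2 ^ M..(real m + 1) / 2 ^ M}" for m
  have "continuous_on (U m) f" if m: "m < 2 ^ M" for m
  proof -
    obtain k' m' where km: "maps_standard f M m k' m'"
      using assms m by (auto simp: standard_at_level_def standard_on_def)
    have "f x = (real m' + (x * 2 ^ M - real m)) / 2 ^ k'" if "x \<in> U m" for x
      using maps_standardD[OF km, of "x * 2 ^ M - real m"] that by (simp add: U_def field_simps)
    moreover have "continuous_on (U m) (\<lambda>x. (real m' + (x * 2 ^ M - real m)) / 2 ^ k')"
      by (intro continuous_intros) auto
    ultimately show ?thesis using continuous_on_cong by force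
  qed
  then have "continuous_on (\<Union>m\<in>{..<2 ^ M}. U m) f"
    by (intro continuous_on_closed_Union) (auto simp: U_def)
  moreover have "{0..1} \<subseteq> (\<Union>m\<in>{..<2 ^ M}. U m)"
  proof
    fix x :: real assume "x \<in> {0..1}"
    then obtain m y where "m < 2 ^ M" "0 \<le> y" "y \<le> 1" "x = (real m + y) / 2 ^ M"
      using unit_cell_closed[of x M] by auto
    then show "x \<in> (\<Union>m\<in>{..<2 ^ M}. U m)" 
      by (auto simp: U_def intro!: bexI[of _ m] divide_right_mono)
  qed
  ultimately show ?thesis using continuous_on_subset by blast
qed

text \<open>
  The multiples of \<open>1 / 2 ^ M\<close> serve as break points.
\<close>

lemma thompson_homeosI:
  assumes ext: "f \<in> extensional {0..1}" and f: "increasing_bij f" and std: "standard_at_level f M"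
  shows "f \<in> thompson_homeos"
proof -
  have cont: "continuous_on {0..1} f" by (rule continuous_on_standard[OF std])
  have bij: "bij_betw f {0..1} {0..1}" and mono: "strict_mono_on {0..1} f"
    using f by (auto simp: increasing_bij_def)
  have homeo: "\<exists>g. homeomorphism {0..1} {0..1} f g"
    using bij by (intro homeomorphism_compact cont) (auto simp: bij_betw_def)
  define B :: "real set" where "B = (\<lambda>m. real m / 2 ^ M) ` {..2 ^ M}"
  have B: "finite B" "B \<subseteq> dyadic_fractions"
    by (auto simp: B_def dyadic_fractions_def) (metis of_int_of_nat_eq)
  have lin: "\<exists>(k::int) c. \<forall>x\<in>{a..b}. f x = 2 powi k * x + c"
    if ab: "0 \<le> a" "a < b" "b \<le> 1" and avoid: "{a<..<b} \<inter> B = {}" for a b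
  proof -
    obtain m where m: "m < 2 ^ M" "real m / 2 ^ M \<le> a" "a < (real m + 1) / 2 ^ M"
      using unit_cell[of a M] ab by auto
    have "(real m + 1) / 2 ^ M \<in> B"
      unfolding B_def using m(1) by (intro image_eqI[of _ _ "Suc m"]) auto
    then have bm: "b \<le> (real m + 1) / 2 ^ M" using avoid m(3) by force
    obtain k' m' where km: "maps_standard f M m k' m'"
      using std m(1) by (auto simp: standard_at_level_def standard_on_def)
    have "f x = 2 powi (int M - int k') * x + (real m' - real m) / 2 ^ k'" if "x \<in> {a..b}" for x
    proof -
      have b: "real m / 2 ^ M \<le> x" "x \<le> (real m + 1) / 2 ^ M" using that m bm by auto
      then have "f x = (real m' + (x * 2 ^ M - real m)) / 2 ^ k'"
        using maps_standardD[OF km, of "x * 2 ^ M - real m"] by (simp add: field_simps)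
      then show ?thesis by (simp add: power_int_diff add_divide_distrib diff_divide_distrib)
    qed
    then show ?thesis by blast
  qed
  show ?thesis
    unfolding thompson_homeos_def mem_Collect_eq
  proof (intro conjI exI[of _ B] allI impI)
    show "f \<in> Bij {0..1}" using ext bij by (simp add: Bij_def)
    show "\<exists>g. homeomorphism {0..1} {0..1} f g" by (fact homeo)
  qed (use mono B lin in auto)
qed

lemma dyadic_fractions_add: "x \<in> dyadic_fractions \<Longrightarrow> y \<in> dyadic_fractions \<Longrightarrow> x + y \<in> dyadic_fractions"
proof -
  assume "x \<in> dyadic_fractions" "y \<in> dyadic_fractions"
  then obtain m k m' k' where "x = of_int m / 2 ^ k" "y = of_int m' / 2 ^ k'"
    by (auto simp: dyadic_fractions_def)
  then have "x + y = of_int (m * 2 ^ k' + m' * 2 ^ k) / 2 ^ (k + k')"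
    by (simp add: add_divide_distrib power_add)
  then show ?thesis unfolding dyadic_fractions_def by blast
qed

lemma powi_dyadic: "(2::real) powi k \<in> dyadic_fractions"
proof (cases "k \<ge> 0")
  case True
  then have "(2::real) powi k = of_int (2 ^ nat k) / 2 ^ 0" by (simp add: power_int_def)
  then show ?thesis unfolding dyadic_fractions_def by blast
next
  case False
  then have "(2::real) powi k = of_int 1 / 2 ^ nat (- k)"
    by (simp add: power_int_def field_simps power_inverse)
  then show ?thesis unfolding dyadic_fractions_def by blast
qed

lemma dyadic_common_level:
  assumes "finite B" "B \<subseteq> dyadic_fractions"
  obtains N where "\<And>b. b \<in> B \<Longrightarrow> \<exists>m::int. b = of_int m / 2 ^ N"
proof -
  have "\<exists>k. \<exists>m::int. b = of_int m / 2 ^ k" if "b \<in> B" for b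
    using assms(2) that unfolding dyadic_fractions_def by blast
  then obtain K where K: "\<And>b. b \<in> B \<Longrightarrow> \<exists>m::int. b = of_int m / 2 ^ K b" by metis
  define N where "N = Max (insert 0 (K ` B))"
  have "\<exists>m::int. b = of_int m / 2 ^ N" if b: "b \<in> B" for b
  proof -
    have "K b \<le> N" unfolding N_def using assms(1) b by (intro Max_ge) auto
    then obtain d where d: "N = K b + d" using le_Suc_ex by blast
    obtain m :: int where "b = of_int m / 2 ^ K b" using K b by blast
    then have "b = of_int (m * 2 ^ d) / 2 ^ N" by (simp add: d power_add)
    then show ?thesis by blast
  qed
  then show ?thesis using that by blast
qed

lemma thompson_homeos_increasing_bij: "f \<in> thompson_homeos \<Longrightarrow> increasing_bij f"
  by (simp add: thompson_homeos_def Bij_def increasing_bij_def)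

text \<open>
  Between consecutive multiples of \<open>1 / 2 ^ N\<close> the function has slope \<open>2 ^ k\<close>, and by induction its
  values at these points are dyadic. A subinterval of length \<open>1 / 2 ^ (N + J)\<close> is thus mapped onto an
  interval of length \<open>1 / 2 ^ K\<close> with \<open>K = N + J - k\<close>; once \<open>J\<close> is large, \<open>K\<close> exceeds the level of
  the image of the left end point and the image is a standard interval.
\<close>

lemma thompson_homeos_standard:
  assumes "f \<in> thompson_homeos"
  obtains M where "standard_at_level f M"
proof -
  have inc: "increasing_bij f" using assms by (rule thompson_homeos_increasing_bij)
  note facts = increasing_bij_facts[OF inc]
  obtain B where B: "finite B" "B \<subseteq> dyadic_fractions"
    and lin: "\<And>a b. 0 \<le> a \<Longrightarrow> a < b \<Longrightarrow> b \<le> 1 \<Longrightarrow> {a<..<b} \<inter> B = {} \<Longrightarrow>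
           \<exists>(k::int) c. \<forall>x\<in>{a..b}. f x = 2 powi k * x + c"
    using assms by (auto simp: thompson_homeos_def)
  obtain N where N: "\<And>b. b \<in> B \<Longrightarrow> \<exists>m::int. b = of_int m / 2 ^ N"
    using dyadic_common_level[OF B] by blast
  define p where "p i = real i / 2 ^ N" for i
  have p01: "0 \<le> p i" "p i < p (Suc i)" "p (Suc i) \<le> 1" if "i < 2 ^ N" for i
    using that cell_in_unit[OF that, of 1] by (auto simp: p_def divide_strict_right_mono add.commute)
  have "\<exists>(k::int) c. \<forall>x\<in>{p i..p (Suc i)}. f x = 2 powi k * x + c" if i: "i < 2 ^ N" for i
  proof (rule lin[OF p01[OF i]])
    have False if b: "b \<in> B" "p i < b" "b < p (Suc i)" for b
    proof -
      obtain m :: int where "b = of_int m / 2 ^ N" using N b(1) by blast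
      then have "real_of_int (int i) < of_int m" "of_int m < real_of_int (int (Suc i))"
        using b(2,3) by (auto simp: p_def divide_less_cancel)
      then have "int i < m" "m < int (Suc i)" by (simp_all only: of_int_less_iff)
      then show False by linarith
    qed
    then show "{p i<..<p (Suc i)} \<inter> B = {}" by auto
  qed
  then obtain k :: "nat \<Rightarrow> int" and c where
    kc: "\<And>i x. i < 2 ^ N \<Longrightarrow> x \<in> {p i..p (Suc i)} \<Longrightarrow> f x = 2 powi k i * x + c i" by metis
  have step: "f (p i + z) = f (p i) + 2 powi k i * z" if "i < 2 ^ N" "0 \<le> z" "z \<le> 1 / 2 ^ N" for i z
  proof -
    have "p (Suc i) = p i + 1 / 2 ^ N" by (simp add: p_def add_divide_distrib)
    then have "f (p i + z) = 2 powi k i * (p i + z) + c i" "f (p i) = 2 powi k i * p i + c i"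
      using that kc p01[OF that(1)] by auto
    then show ?thesis by (simp add: algebra_simps)
  qed
  have dy: "f (p i) \<in> dyadic_fractions" if "i \<le> 2 ^ N" for i
    using that
  proof (induction i)
    case 0
    have "f (p 0) = of_int 0 / 2 ^ 0" using facts by (simp add: p_def)
    then show ?case unfolding dyadic_fractions_def by blast
  next
    case (Suc i)
    have "p (Suc i) = p i + 1 / 2 ^ N" by (simp add: p_def add_divide_distrib)
    then have "f (p (Suc i)) = f (p i) + 2 powi (k i - int N)"
      using step[of i "1 / 2 ^ N"] Suc.prems by (simp add: power_int_diff)
    then show ?case using Suc powi_dyadic dyadic_fractions_add by simp
  qed
  have ev: "\<forall>\<^sub>F J in sequentially. \<forall>r<2 ^ J. standard_on f (N + J) (i * 2 ^ J + r)" if i: "i < 2 ^ N" for i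
  proof -
    obtain a :: int and b :: nat where ab: "f (p i) = of_int a / 2 ^ b"
      using dy[of i] i by (auto simp: dyadic_fractions_def)
    have "0 \<le> f (p i)" using facts(3) p01[OF i] by simp
    then have "0 \<le> f (p i) * 2 ^ b" by simp
    then have "0 \<le> a" unfolding ab by simp
    then obtain a' where a': "a = int a'" using nonneg_int_cases by blast
    \<comment> \<open>\<open>J \<ge> \<bar>k i\<bar> + b\<close> makes the level \<open>K = N + J - k i\<close> of the image at least \<open>b\<close>.\<close>
    have "\<forall>r<2 ^ J. standard_on f (N + J) (i * 2 ^ J + r)" if J: "J \<ge> nat \<bar>k i\<bar> + b" for J
    proof (intro allI impI)
      fix r :: nat assume r: "r < 2 ^ J"
      define K where "K = nat (int N + int J - k i)"
      have K: "int K = int N + int J - k i" using J by (simp add: K_def)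
      have "b \<le> K" using J K by linarith
      then obtain d where d: "K = b + d" using le_Suc_ex by blast
      have "maps_standard f (N + J) (i * 2 ^ J + r) K (a' * 2 ^ d + r)"
        unfolding maps_standard_def
      proof
        fix y :: real assume y: "y \<in> {0..1}"
        define z where "z = (real r + y) / 2 ^ J"
        have "0 \<le> z \<and> z \<le> 1"
          using cell_in_unit[OF r] y by (simp add: z_def)
        then have "0 \<le> z / 2 ^ N" "z / 2 ^ N \<le> 1 / 2 ^ N"
          by (auto simp: divide_right_mono)
        from step[OF i this]
        have f: "f (p i + z / 2 ^ N) = real a' / 2 ^ b + 2 powi k i * (z / 2 ^ N)"
          by (simp only: ab a' of_int_of_nat_eq)
        have arg: "(real (i * 2 ^ J + r) + y) / 2 ^ (N + J) = p i + z / 2 ^ N"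
          by (simp add: p_def z_def add_divide_distrib power_add mult.commute)
        have "k i = int N + int J - int K" using K by simp
        moreover have "(2::real) powi (int N + int J - int K) = 2 ^ N * 2 ^ J / 2 ^ K"
          by (simp add: power_int_diff power_int_add)
        ultimately have "(2::real) powi k i = 2 ^ N * 2 ^ J / 2 ^ K" by (simp only:)
        then have slope: "2 powi k i * (z / 2 ^ N) = (real r + y) / 2 ^ K"
          by (simp add: z_def)
        have "real a' / 2 ^ b + (real r + y) / 2 ^ K = (real (a' * 2 ^ d + r) + y) / 2 ^ K"
          by (simp add: d add_divide_distrib power_add)
        then show "f ((real (i * 2 ^ J + r) + y) / 2 ^ (N + J)) = (real (a' * 2 ^ d + r) + y) / 2 ^ K"
          by (simp only: arg f slope)
      qed
      then show "standard_on f (N + J) (i * 2 ^ J + r)" by (auto simp: standard_on_def)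
    qed
    then show ?thesis unfolding eventually_sequentially by blast
  qed
  have "\<forall>\<^sub>F J in sequentially. \<forall>i\<in>{..<2 ^ N}. \<forall>r<2 ^ J. standard_on f (N + J) (i * 2 ^ J + r)"
    by (rule eventually_ball_finite) (use ev in auto)
  from eventually_happens'[OF sequentially_bot this]
  obtain J where J: "\<forall>i\<in>{..<2 ^ N}. \<forall>r<2 ^ J. standard_on f (N + J) (i * 2 ^ J + r)" by (rule exE)
  have "standard_at_level f (N + J)"
    unfolding standard_at_level_def
  proof (intro allI impI)
    fix m :: nat assume "m < 2 ^ (N + J)"
    then have "m div 2 ^ J \<in> {..<2 ^ N}" by (simp add: less_mult_imp_div_less power_add)
    moreover have "m mod 2 ^ J < 2 ^ J" by simp
    ultimately have "standard_on f (N + J) (m div 2 ^ J * 2 ^ J + m mod 2 ^ J)" using J by blast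
    then show "standard_on f (N + J) m" unfolding div_mult_mod_eq .
  qed
  then show ?thesis using that by blast
qed

section \<open>The group structure\<close>

text \<open>
  In this form the closure of the group under products and inverses is a statement about refining
  subdivisions, with no break points to follow.
\<close>

lemma thompson_homeos_iff:
  "f \<in> thompson_homeos \<longleftrightarrow>
    f \<in> extensional {0..1} \<and> increasing_bij f \<and> (\<exists>M. standard_at_level f M)"
proof
  assume f: "f \<in> thompson_homeos"
  then have "f \<in> extensional {0..1}" by (simp add: thompson_homeos_def Bij_def)
  then show "f \<in> extensional {0..1} \<and> increasing_bij f \<and> (\<exists>M. standard_at_level f M)"
    using f thompson_homeos_increasing_bij by (blast elim: thompson_homeos_standard)
qed (blast intro: thompson_homeosI)

lemma increasing_bij_compose:
  assumes f: "increasing_bij f" and g: "increasing_bij g"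
  shows "increasing_bij (compose {0..1} g f)"
proof -
  have "bij_betw (compose {0..1} g f) {0..1} {0..1}"
    using f g by (auto simp: increasing_bij_def intro: bij_betw_compose)
  moreover have "strict_mono_on {0..1} (compose {0..1} g f)"
    using increasing_bij_facts(3,4)[OF f] increasing_bij_facts(4)[OF g]
    by (auto simp: compose_def intro!: strict_mono_onI)
  ultimately show ?thesis by (simp add: increasing_bij_def)
qed

lemma increasing_bij_inverse:
  assumes f: "increasing_bij f"
  shows "increasing_bij (restrict (inv_into {0..1} f) {0..1})" (is "increasing_bij ?g")
    and "\<And>x. 0 \<le> x \<Longrightarrow> x \<le> 1 \<Longrightarrow> restrict (inv_into {0..1} f) {0..1} (f x) = x"
    and "\<And>x. 0 \<le> x \<Longrightarrow> x \<le> 1 \<Longrightarrow> f (restrict (inv_into {0..1} f) {0..1} x) = x"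
proof -
  have bij: "bij_betw f {0..1} {0..1}" using f by (simp add: increasing_bij_def)
  show l: "?g (f x) = x" if "0 \<le> x" "x \<le> 1" for x
    using that bij increasing_bij_facts(3)[OF f that] by (simp add: bij_betw_inv_into_left)
  show r: "f (?g x) = x" if "0 \<le> x" "x \<le> 1" for x
    using that bij by (simp add: bij_betw_inv_into_right)
  have "bij_betw (inv_into {0..1} f) {0..1} {0..1}" by (rule bij_betw_inv_into[OF bij])
  moreover have "bij_betw ?g {0..1} {0..1} \<longleftrightarrow> bij_betw (inv_into {0..1} f) {0..1} {0..1}"
    by (rule bij_betw_cong) simp
  ultimately have b: "bij_betw ?g {0..1} {0..1}" by blast
  have rng: "0 \<le> ?g x \<and> ?g x \<le> 1" if "0 \<le> x" "x \<le> 1" for x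
    using bij_betwE[OF b] that by (metis atLeastAtMost_iff)
  have "?g x < ?g y" if "0 \<le> x" "x \<le> 1" "0 \<le> y" "y \<le> 1" "x < y" for x y
  proof -
    have "f (?g x) < f (?g y)" using that r by simp
    then show ?thesis using increasing_bij_facts(4)[OF f] rng that by blast
  qed
  then have "strict_mono_on {0..1} ?g" by (intro strict_mono_onI) auto
  then show "increasing_bij ?g" using b by (simp add: increasing_bij_def)
qed

lemma compose_thompson_homeos:
  assumes "f \<in> thompson_homeos" "g \<in> thompson_homeos"
  shows "compose {0..1} g f \<in> thompson_homeos"
proof -
  obtain M N where "standard_at_level f M" "standard_at_level g N"
    using assms by (auto simp: thompson_homeos_iff)
  then have "standard_at_level (\<lambda>x. g (f x)) (M + N)"
    using assms standard_at_level_compose by (auto simp: thompson_homeos_iff)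
  then have "standard_at_level (compose {0..1} g f) (M + N)"
    by (rule standard_at_level_cong) (simp add: compose_def)
  then show ?thesis
    using assms increasing_bij_compose by (auto simp: thompson_homeos_iff)
qed

lemma inverse_thompson_homeos:
  assumes "f \<in> thompson_homeos"
  shows "restrict (inv_into {0..1} f) {0..1} \<in> thompson_homeos"
proof -
  have f: "increasing_bij f" and "\<exists>M. standard_at_level f M"
    using assms by (auto simp: thompson_homeos_iff)
  then obtain M where M: "standard_at_level f M" by blast
  obtain R where "standard_at_level (restrict (inv_into {0..1} f) {0..1}) R"
    using standard_at_level_inverse[OF f M increasing_bij_inverse(2)[OF f]] by blast
  then show ?thesis using increasing_bij_inverse(1)[OF f] by (auto simp: thompson_homeos_iff)
qed

lemma one_thompson_homeos: "(\<lambda>x\<in>{0..1}. x) \<in> thompson_homeos"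
proof -
  have "maps_standard (\<lambda>x\<in>{0..1}. x) 0 0 0 0" by (simp add: maps_standard_def)
  then have "standard_at_level (\<lambda>x\<in>{0..1}. x) 0" by (auto simp: standard_at_level_def standard_on_def)
  moreover have "increasing_bij (\<lambda>x\<in>{0..1}. x)"
    by (auto simp: increasing_bij_def bij_betw_def inj_on_def intro!: strict_mono_onI)
  ultimately show ?thesis by (auto simp: thompson_homeos_iff)
qed

lemma thompson_F_simps [simp]:
  "carrier thompson_F = thompson_homeos"
  "f \<otimes>\<^bsub>thompson_F\<^esub> g = compose {0..1} g f"
  "\<one>\<^bsub>thompson_F\<^esub> = (\<lambda>x\<in>{0..1}. x)"
  by (simp_all add: thompson_F_def)

lemma thompson_homeos_funcset: "f \<in> thompson_homeos \<Longrightarrow> f \<in> {0..1} \<rightarrow> {0..1}"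
  by (auto simp: thompson_homeos_iff increasing_bij_facts(3))

lemma group_thompson_F: "group thompson_F"
proof (rule groupI)
  fix f assume f: "f \<in> carrier thompson_F"
  then have inc: "increasing_bij f" by (simp add: thompson_homeos_iff)
  define g where "g = restrict (inv_into {0..1} f) {0..1}"
  have "g \<in> thompson_homeos" unfolding g_def using f by (intro inverse_thompson_homeos) simp
  then have "g \<in> carrier thompson_F" unfolding thompson_F_simps .
  moreover have fg: "f (g x) = x" if "0 \<le> x" "x \<le> 1" for x
    unfolding g_def by (rule increasing_bij_inverse(3)[OF inc that])
  have "g \<otimes>\<^bsub>thompson_F\<^esub> f = \<one>\<^bsub>thompson_F\<^esub>"
    unfolding thompson_F_simps compose_def by (rule restrict_ext) (simp add: fg)
  ultimately show "\<exists>g\<in>carrier thompson_F. g \<otimes>\<^bsub>thompson_F\<^esub> f = \<one>\<^bsub>thompson_F\<^esub>"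
    by (rule rev_bexI[where x = g])
  show "\<one>\<^bsub>thompson_F\<^esub> \<otimes>\<^bsub>thompson_F\<^esub> f = f"
  proof -
    have "f \<in> extensional {0..1}" using f by (simp add: thompson_homeos_iff)
    then have "f x = undefined" if "x \<notin> {0..1}" for x using that by (rule extensional_arb)
    then show ?thesis unfolding thompson_F_simps compose_def by (intro ext) simp
  qed
next
  fix f g h
  assume "f \<in> carrier thompson_F" "g \<in> carrier thompson_F" "h \<in> carrier thompson_F"
  then show "f \<otimes>\<^bsub>thompson_F\<^esub> g \<otimes>\<^bsub>thompson_F\<^esub> h = f \<otimes>\<^bsub>thompson_F\<^esub> (g \<otimes>\<^bsub>thompson_F\<^esub> h)"
    unfolding thompson_F_simps by (intro compose_assoc thompson_homeos_funcset)
qed (simp_all add: compose_thompson_homeos one_thompson_homeos)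

interpretation F: group thompson_F by (rule group_thompson_F)

lemma inv_thompson_F:
  assumes f: "f \<in> thompson_homeos"
  shows "inv\<^bsub>thompson_F\<^esub> f = restrict (inv_into {0..1} f) {0..1}"
proof (rule F.inv_equality)
  define g where "g = restrict (inv_into {0..1} f) {0..1}"
  have "increasing_bij f" using f by (simp add: thompson_homeos_iff)
  then have fg: "f (g x) = x" if "0 \<le> x" "x \<le> 1" for x
    unfolding g_def using that by (rule increasing_bij_inverse(3))
  show "restrict (inv_into {0..1} f) {0..1} \<otimes>\<^bsub>thompson_F\<^esub> f = \<one>\<^bsub>thompson_F\<^esub>"
    unfolding g_def[symmetric] thompson_F_simps compose_def by (rule restrict_ext) (simp add: fg)
  show "f \<in> carrier thompson_F" using f by simp
  show "restrict (inv_into {0..1} f) {0..1} \<in> carrier thompson_F"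
    unfolding thompson_F_simps by (rule inverse_thompson_homeos[OF f])
qed

lemma thompson_homeos_unit_dyadics:
  assumes f: "f \<in> thompson_homeos" and x: "x \<in> unit_dyadics"
  shows "f x \<in> unit_dyadics"
proof -
  obtain m k where m: "x = real m / 2 ^ k" "m < 2 ^ k" using x by (auto simp: unit_dyadics_def)
  obtain M where "standard_at_level f M" using f by (auto simp: thompson_homeos_iff)
  then have "standard_at_level f (M + k)" by (rule standard_at_level_add)
  moreover have mk: "m * 2 ^ M < 2 ^ (M + k)" using m(2) by (simp add: power_add)
  ultimately obtain k' m' where km: "maps_standard f (M + k) (m * 2 ^ M) k' m'"
    by (auto simp: standard_at_level_def standard_on_def)
  have "x = real (m * 2 ^ M) / 2 ^ (M + k)" by (simp add: m power_add)
  then have "f x = real m' / 2 ^ k'" using maps_standard_left[OF km] by simp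
  moreover have "m' < 2 ^ k'"
    using maps_standard_image_bound[OF _ km mk] f by (simp add: thompson_homeos_iff)
  ultimately show ?thesis by (auto simp: unit_dyadics_def)
qed

lemma unit_dyadics_preimage:
  assumes f: "f \<in> thompson_homeos" and y: "y \<in> unit_dyadics"
  obtains x where "x \<in> unit_dyadics" "f x = y"
proof -
  let ?g = "restrict (inv_into {0..1} f) {0..1}"
  have "?g y \<in> unit_dyadics"
    by (rule thompson_homeos_unit_dyadics[OF inverse_thompson_homeos[OF f] y])
  moreover have "f (?g y) = y"
    using increasing_bij_inverse(3) f unit_dyadics_bounds[OF y] by (simp add: thompson_homeos_iff)
  ultimately show ?thesis using that by blast
qed

section \<open>The stabilizer of the digit sums\<close>

definition digit_preserving :: "nat \<Rightarrow> (real \<Rightarrow> real) set" where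
  "digit_preserving n = {f \<in> thompson_homeos.
     \<forall>x\<in>unit_dyadics. [dyadic_sum (f x) = dyadic_sum x] (mod n)}"

lemma subgroup_digit_preserving: "subgroup (digit_preserving n) thompson_F"
proof (rule F.subgroupI)
  show "digit_preserving n \<noteq> {}"
    using one_thompson_homeos unit_dyadics_bounds
    by (force simp: digit_preserving_def)
  fix f assume f: "f \<in> digit_preserving n"
  then have fF: "f \<in> thompson_homeos" by (simp add: digit_preserving_def)
  have "[dyadic_sum ((inv\<^bsub>thompson_F\<^esub> f) y) = dyadic_sum y] (mod n)" if y: "y \<in> unit_dyadics" for y
  proof -
    obtain x where x: "x \<in> unit_dyadics" "f x = y" using unit_dyadics_preimage[OF fF y] by blast
    have "(inv\<^bsub>thompson_F\<^esub> f) y = x"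
      using x unit_dyadics_bounds[OF x(1)] fF increasing_bij_inverse(2)[of f x]
      by (simp add: inv_thompson_F thompson_homeos_iff)
    then show ?thesis using f x by (auto simp: digit_preserving_def cong_sym_eq)
  qed
  then show "inv\<^bsub>thompson_F\<^esub> f \<in> digit_preserving n"
    using F.inv_closed fF by (simp add: digit_preserving_def)
  fix g assume g: "g \<in> digit_preserving n"
  have "[dyadic_sum (compose {0..1} g f x) = dyadic_sum x] (mod n)" if x: "x \<in> unit_dyadics" for x
  proof -
    have "[dyadic_sum (g (f x)) = dyadic_sum (f x)] (mod n)"
      using g thompson_homeos_unit_dyadics[OF fF x] by (simp add: digit_preserving_def)
    also have "[dyadic_sum (f x) = dyadic_sum x] (mod n)" using f x by (simp add: digit_preserving_def)
    finally show ?thesis using unit_dyadics_bounds[OF x] by (simp add: compose_def)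
  qed
  then show "f \<otimes>\<^bsub>thompson_F\<^esub> g \<in> digit_preserving n"
    using f g compose_thompson_homeos by (auto simp: digit_preserving_def)
qed (auto simp: digit_preserving_def)

text \<open>
  A map between standard intervals keeps all digits after the prefix that names the interval, so the
  digit sum changes by the same amount at all dyadic points of the interval.
\<close>

lemma dyadic_sum_cong_on_cell:
  assumes km: "maps_standard f k m k' m'" and c: "[bitsum m' = bitsum m] (mod n)"
    and x: "x \<in> unit_dyadics" "real m / 2 ^ k \<le> x" "x < (real m + 1) / 2 ^ k"
  shows "[dyadic_sum (f x) = dyadic_sum x] (mod n)"
proof -
  obtain p j where p: "x = real p / 2 ^ j" using x by (auto simp: unit_dyadics_def)
  have 1: "real (m * 2 ^ j) \<le> real (p * 2 ^ k)" "real (p * 2 ^ k) < real (m * 2 ^ j + 2 ^ j)"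
    using x(2,3) by (simp_all add: p field_simps)
  then have "m * 2 ^ j \<le> p * 2 ^ k" "p * 2 ^ k < m * 2 ^ j + 2 ^ j"
    by (simp_all only: of_nat_le_iff of_nat_less_iff)
  then obtain r where r: "p * 2 ^ k = m * 2 ^ j + r" "r < 2 ^ j"
    by (metis le_Suc_ex nat_add_left_cancel_less)
  have "x = real (p * 2 ^ k) / 2 ^ (k + j)" by (simp add: p power_add)
  then have x': "x = real (m * 2 ^ j + r) / 2 ^ (k + j)" by (simp only: r)
  have fx: "f x = real (m' * 2 ^ j + r) / 2 ^ (k' + j)"
    unfolding x' by (rule maps_standard_left[OF maps_standard_refine[OF km r(2)]])
  have "[bitsum m' + bitsum r = bitsum m + bitsum r] (mod n)" using c by (simp add: cong_add)
  then show ?thesis unfolding fx unfolding x' dyadic_sum_eq bitsum_append[OF r(2)] .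
qed

lemma digit_preservingI:
  assumes ext: "f \<in> extensional {0..1}" and f: "increasing_bij f"
    and std: "\<And>m. m < 2 ^ M \<Longrightarrow> \<exists>k' m'. maps_standard f M m k' m' \<and> [bitsum m' = bitsum m] (mod n)"
  shows "f \<in> digit_preserving n"
proof -
  have "standard_at_level f M" using std unfolding standard_at_level_def standard_on_def by blast
  then have "f \<in> thompson_homeos" using ext f by (auto simp: thompson_homeos_iff)
  moreover have "[dyadic_sum (f x) = dyadic_sum x] (mod n)" if x: "x \<in> unit_dyadics" for x
  proof -
    obtain m where m: "m < 2 ^ M" "real m / 2 ^ M \<le> x" "x < (real m + 1) / 2 ^ M"
      using unit_cell unit_dyadics_bounds[OF x] by metis
    then show ?thesis using std[OF m(1)] dyadic_sum_cong_on_cell x by blast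
  qed
  ultimately show ?thesis by (simp add: digit_preserving_def)
qed

section \<open>An element without fixed points inside the interval\<close>

text \<open>
  With break points at \<open>1/2 - 1/2 ^ (n+1)\<close> and \<open>1/2\<close> and slopes \<open>2\<close>, \<open>1\<close>, \<open>1/2 ^ n\<close>. In terms of
  trees, take the comb with \<open>n + 1\<close> leaves, which are reached by \<open>0, 1, \<dots>, n\<close> right turns; the function
  takes the tree obtained by hanging a second comb at the first leaf to the tree obtained by hanging
  it at the last leaf. Modulo \<open>n\<close> both trees have the same sequence of numbers of right turns. As the
  slopes decrease, the function is the minimum of its three affine pieces.
\<close>

definition push :: "nat \<Rightarrow> real \<Rightarrow> real" where
  "push n = (\<lambda>x\<in>{0..1}. min (2 * x) (min (x + 1 / 2 - 1 / 2 ^ Suc n) (1 - (1 - x) / 2 ^ n)))"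

lemma half_power_bounds: "1 \<le> n \<Longrightarrow> 0 < (1::real) / 2 ^ n \<and> 1 / 2 ^ n \<le> (1::real) / 2"
  using power_increasing[of 1 n "2::real"] by (simp add: field_simps)

lemma push_cases:
  assumes n: "1 \<le> n" and x: "0 \<le> x" "x \<le> 1"
  shows "x \<le> 1 / 2 - 1 / 2 ^ Suc n \<Longrightarrow> push n x = 2 * x"
    and "1 / 2 - 1 / 2 ^ Suc n \<le> x \<Longrightarrow> x \<le> 1 / 2 \<Longrightarrow> push n x = x + 1 / 2 - 1 / 2 ^ Suc n"
    and "1 / 2 \<le> x \<Longrightarrow> push n x = 1 - (1 - x) / 2 ^ n"
proof -
  define e :: real where "e = 1 / 2 ^ n"
  have e: "0 < e" "e \<le> 1 / 2" using half_power_bounds[OF n] by (auto simp: e_def)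
  have p: "push n x = min (2 * x) (min (x + 1 / 2 - e / 2) (1 - (1 - x) * e))"
    using x by (simp add: push_def e_def)
  have e2: "1 / 2 ^ Suc n = e / 2" and en: "(1 - x) / 2 ^ n = (1 - x) * e" by (simp_all add: e_def)
  have d1: "(1 - (1 - x) * e) - (x + 1 / 2 - e / 2) = (1 - e) * (1 / 2 - x)" by (simp add: field_simps)
  have s: "0 \<le> (1 - x) * e" using e x by simp
  show "push n x = 2 * x" if "x \<le> 1 / 2 - 1 / 2 ^ Suc n"
  proof -
    have h: "x \<le> 1 / 2 - e / 2" using that e2 by simp
    have "0 \<le> (1 - e) * (1 / 2 - x)" using h e by simp
    then show ?thesis unfolding p using d1 h by simp
  qed
  show "push n x = x + 1 / 2 - 1 / 2 ^ Suc n" if "1 / 2 - 1 / 2 ^ Suc n \<le> x" "x \<le> 1 / 2"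
  proof -
    have "0 \<le> (1 - e) * (1 / 2 - x)" using that e by simp
    then show ?thesis unfolding p e2 using d1 that e2 by simp
  qed
  show "push n x = 1 - (1 - x) / 2 ^ n" if "1 / 2 \<le> x"
  proof -
    have "(1 - e) * (1 / 2 - x) \<le> 0" using that e by (simp add: mult_nonneg_nonpos)
    then show ?thesis unfolding p en using d1 that s by simp
  qed
qed

lemma increasing_bij_push:
  assumes n: "1 \<le> n"
  shows "increasing_bij (push n)"
proof -
  have p0: "push n 0 = 0" using push_cases(1)[OF n, of 0] half_power_bounds[of "Suc n"] by simp
  have p1: "push n 1 = 1" using push_cases(3)[OF n, of 1] by simp
  have lt: "push n x < push n y" if "0 \<le> x" "y \<le> 1" "x < y" for x y
  proof -
    have "(1 - y) / 2 ^ n < (1 - x) / 2 ^ n" using that by (simp add: divide_strict_right_mono)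
    then show ?thesis using that by (simp add: push_def min_def)
  qed
  then have mono: "strict_mono_on {0..1} (push n)" by (intro strict_mono_onI) auto
  have cont: "continuous_on {0..1} (push n)"
  proof -
    have "continuous_on {0..1}
        (\<lambda>x::real. min (2 * x) (min (x + 1 / 2 - 1 / 2 ^ Suc n) (1 - (1 - x) / 2 ^ n)))"
      by (intro continuous_intros) auto
    then show ?thesis by (rule continuous_on_eq) (simp add: push_def)
  qed
  have bounds: "0 \<le> push n x \<and> push n x \<le> 1" if "0 \<le> x" "x \<le> 1" for x
    using lt[of 0 x] lt[of x 1] that p0 p1 by (cases "x = 0"; cases "x = 1") auto
  have "push n ` {0..1} = {0..1}"
  proof
    show "push n ` {0..1} \<subseteq> {0..1}" using bounds by auto
    show "{0..1} \<subseteq> push n ` {0..1}"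
    proof
      fix y :: real assume "y \<in> {0..1}"
      then obtain x where "0 \<le> x" "x \<le> 1" "push n x = y"
        using IVT'[of "push n" 0 y 1] p0 p1 cont by auto
      then show "y \<in> push n ` {0..1}" by auto
    qed
  qed
  then have "bij_betw (push n) {0..1} {0..1}"
    using strict_mono_on_imp_inj_on[OF mono] by (simp add: bij_betw_def)
  then show ?thesis using mono by (simp add: increasing_bij_def)
qed

lemma push_greater:
  assumes n: "1 \<le> n" and x: "0 < x" "x < 1"
  shows "x < push n x"
proof -
  have "1 / 2 ^ Suc n < (1::real) / 2" using half_power_bounds[OF n] by simp
  moreover have "(1 - x) / 2 ^ n < 1 - x"
    using x n power_strict_increasing[of 0 n "2::real"] by (simp add: divide_less_eq)
  ultimately show ?thesis using x by (simp add: push_def)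
qed

text \<open>
  On binary expansions: a number that starts with \<open>0\<close> and is below \<open>1/2 - 1/2 ^ (n+1)\<close> loses this \<open>0\<close>;
  the prefix \<open>0\<close> followed by \<open>n\<close> ones becomes \<open>n\<close> ones followed by \<open>0\<close>; and the prefix \<open>1\<close> becomes
  \<open>n + 1\<close> ones, which adds \<open>n\<close> to the digit sum.
\<close>

lemma push_digit_preserving:
  assumes n: "1 \<le> n"
  shows "push n \<in> digit_preserving n"
proof (rule digit_preservingI)
  show "push n \<in> extensional {0..1}" by (simp add: push_def)
  show "increasing_bij (push n)" by (rule increasing_bij_push[OF n])
  fix m :: nat assume m: "m < 2 ^ Suc n"
  have in01: "0 \<le> (real m + y) / 2 ^ Suc n" "(real m + y) / 2 ^ Suc n \<le> 1" if "0 \<le> y" "y \<le> 1" for y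
    using cell_in_unit[OF m that] by auto
  have one_le: "1 \<le> (2::nat) ^ n" by simp
  define w where "w = (2::nat) ^ n - Suc 0"
  have w1: "(2::nat) ^ n = Suc w" using one_le unfolding w_def by linarith
  have "(2::real) ^ n = real (2 ^ n)" by simp
  also have "\<dots> = real w + 1" unfolding w1 by simp
  finally have w: "(2::nat) ^ n = Suc w" "(2::real) ^ n = real w + 1" using w1 by simp_all
  have bo: "bitsum w = n" unfolding w_def by (rule bitsum_ones)
  consider "m < w" | "m = w" | "Suc w \<le> m" by linarith
  then show "\<exists>k' m'. maps_standard (push n) (Suc n) m k' m' \<and> [bitsum m' = bitsum m] (mod n)"
  proof cases
    case 1
    have "maps_standard (push n) (Suc n) m n m"
      unfolding maps_standard_def
    proof
      fix y :: real assume y: "y \<in> {0..1}"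
      have "real m + y \<le> real w" using 1 y by auto
      then have "(real m + y) / 2 ^ Suc n \<le> real w / 2 ^ Suc n" by (rule divide_right_mono) simp
      also have "\<dots> = 1 / 2 - 1 / 2 ^ Suc n" by (simp add: w(2) field_simps)
      finally have "(real m + y) / 2 ^ Suc n \<le> 1 / 2 - 1 / 2 ^ Suc n" .
      from push_cases(1)[OF n in01 this]
      have "push n ((real m + y) / 2 ^ Suc n) = 2 * ((real m + y) / 2 ^ Suc n)" using y by simp
      also have "\<dots> = (real m + y) / 2 ^ n" by (simp add: field_simps)
      finally show "push n ((real m + y) / 2 ^ Suc n) = (real m + y) / 2 ^ n" .
    qed
    then show ?thesis using cong_refl by blast
  next
    case 2
    have "maps_standard (push n) (Suc n) m (Suc n) (2 * w)"
      unfolding maps_standard_def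
    proof
      fix y :: real assume y: "y \<in> {0..1}"
      have "1 / 2 - 1 / 2 ^ Suc n \<le> (real m + y) / 2 ^ Suc n" "(real m + y) / 2 ^ Suc n \<le> 1 / 2"
        using y by (simp_all add: 2 w(2) field_simps)
      from push_cases(2)[OF n in01 this]
      have "push n ((real m + y) / 2 ^ Suc n) = (real m + y) / 2 ^ Suc n + (1 / 2 - 1 / 2 ^ Suc n)"
        using y by simp
      also have "1 / 2 - 1 / 2 ^ Suc n = real w / 2 ^ Suc n" by (simp add: w(2) field_simps)
      finally show "push n ((real m + y) / 2 ^ Suc n) = (real (2 * w) + y) / 2 ^ Suc n"
        by (simp add: 2 add_divide_distrib)
    qed
    moreover have "[bitsum (2 * w) = bitsum m] (mod n)" by (simp add: 2)
    ultimately show ?thesis by blast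
  next
    case 3
    have "maps_standard (push n) (Suc n) m (n + Suc n) (w * 2 ^ Suc n + m)"
      unfolding maps_standard_def
    proof
      fix y :: real assume y: "y \<in> {0..1}"
      have "real (Suc w) \<le> real m" using 3 by (simp only: of_nat_le_iff)
      then have "1 / 2 \<le> (real m + y) / 2 ^ Suc n" using y by (simp add: w(2) field_simps)
      from push_cases(3)[OF n in01 this]
      have "push n ((real m + y) / 2 ^ Suc n) = 1 - (1 - (real m + y) / 2 ^ Suc n) / 2 ^ n"
        using y by simp
      also have "\<dots> = (2 ^ n - 1 + (real m + y) / 2 ^ Suc n) / 2 ^ n"
        by (simp add: diff_divide_distrib add_divide_distrib)
      also have "\<dots> = (real w + (real m + y) / 2 ^ Suc n) / 2 ^ n" by (simp add: w(2))
      also have "\<dots> = (real w * 2 ^ Suc n + (real m + y)) / 2 ^ Suc n / 2 ^ n"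
        by (simp add: add_divide_distrib)
      also have "\<dots> = (real (w * 2 ^ Suc n + m) + y) / 2 ^ (n + Suc n)"
        by (simp add: power_add mult.assoc mult.commute mult.left_commute add.assoc)
      finally show "push n ((real m + y) / 2 ^ Suc n) = (real (w * 2 ^ Suc n + m) + y) / 2 ^ (n + Suc n)" .
    qed
    moreover have "bitsum (w * 2 ^ Suc n + m) = n + bitsum m" using bitsum_append[OF m] bo by simp
    moreover have "[n + bitsum m = bitsum m] (mod n)" by (simp add: cong_def)
    ultimately show ?thesis by metis
  qed
qed

lemma push_power:
  assumes n: "1 \<le> n" and x: "0 < x" "x < 1" and t: "1 \<le> (t::nat)"
  shows "x < (push n [^]\<^bsub>thompson_F\<^esub> t) x"
proof -
  let ?p = "\<lambda>t::nat. push n [^]\<^bsub>thompson_F\<^esub> t"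
  have pF: "push n \<in> carrier thompson_F"
    using push_digit_preserving[OF n] by (simp add: digit_preserving_def)
  have step: "?p (Suc s) x = push n (?p s x)" for s
    using x by (simp add: compose_def)
  have lt1: "push n y < 1" if "0 \<le> y" "y < 1" for y
    using increasing_bij_facts(2,4)[OF increasing_bij_push[OF n]] that by (metis less_imp_le order_refl zero_le_one)
  have *: "x \<le> ?p s x \<and> ?p s x < 1" for s
  proof (induction s)
    case 0
    then show ?case using x by simp
  next
    case (Suc s)
    then show ?case using step[of s] push_greater[OF n, of "?p s x"] lt1[of "?p s x"] x by auto
  qed
  obtain s where s: "t = Suc s" using t by (cases t) auto
  have "?p s x < push n (?p s x)" using *[of s] x by (intro push_greater[OF n]) auto
  then have "?p s x < ?p (Suc s) x" using step[of s] by simp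
  then show ?thesis using *[of s] unfolding s by linarith
qed

text \<open>
  The coset of \<open>g\<close> determines the set \<open>Z\<close> of dyadic points at which \<open>g\<close> changes the digit sum modulo
  \<open>n\<close>. If a power \<open>p\<close> of the element \<open>push n\<close> fixed the coset, \<open>Z\<close> would be invariant under \<open>p\<close>, which
  moves every point of the open interval to the right. But \<open>Z\<close> stays away from \<open>0\<close>, because near \<open>0\<close> the function
  \<open>g\<close> multiplies by a power of \<open>2\<close>; so the infimum of \<open>Z\<close> is positive, and \<open>p\<close> would take it to a
  larger infimum of the same set.
\<close>

theorem push_moves_cosets:
  assumes n: "1 \<le> n" and g: "g \<in> carrier thompson_F" "g \<notin> digit_preserving n" and t: "1 \<le> (t::nat)"
  shows "(push n [^]\<^bsub>thompson_F\<^esub> t) <#\<^bsub>thompson_F\<^esub> (g <#\<^bsub>thompson_F\<^esub> digit_preserving n)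
    \<noteq> g <#\<^bsub>thompson_F\<^esub> digit_preserving n"
proof
  let ?K = "digit_preserving n"
  define p where "p = push n [^]\<^bsub>thompson_F\<^esub> t"
  interpret K: subgroup ?K thompson_F by (rule subgroup_digit_preserving)
  have gF: "g \<in> thompson_homeos" using g by simp
  note gf = increasing_bij_facts[OF thompson_homeos_increasing_bij[OF gF]]
  have pK: "p \<in> ?K"
    unfolding p_def by (induction t) (use push_digit_preserving[OF n] in \<open>auto simp del: thompson_F_simps\<close>)
  then have pF: "p \<in> thompson_homeos" by (simp add: digit_preserving_def)
  note pf = increasing_bij_facts[OF thompson_homeos_increasing_bij[OF pF]]
  have plt: "x < p x" if "0 < x" "x < 1" for x
    unfolding p_def using push_power[OF n that t] .
  assume "(push n [^]\<^bsub>thompson_F\<^esub> t) <#\<^bsub>thompson_F\<^esub> (g <#\<^bsub>thompson_F\<^esub> ?K) = g <#\<^bsub>thompson_F\<^esub> ?K"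
  then have eq: "p <#\<^bsub>thompson_F\<^esub> (g <#\<^bsub>thompson_F\<^esub> ?K) = g <#\<^bsub>thompson_F\<^esub> ?K" by (simp add: p_def)
  have "g \<in> g <#\<^bsub>thompson_F\<^esub> ?K" using g F.lcos_self K.subgroup_axioms by blast
  then have "p \<otimes>\<^bsub>thompson_F\<^esub> g \<in> p <#\<^bsub>thompson_F\<^esub> (g <#\<^bsub>thompson_F\<^esub> ?K)"
    unfolding l_coset_def[of _ p] by blast
  then have "\<exists>k\<in>?K. p \<otimes>\<^bsub>thompson_F\<^esub> g = g \<otimes>\<^bsub>thompson_F\<^esub> k"
    unfolding eq by (auto simp: l_coset_def)
  then obtain k where k: "k \<in> ?K" "compose {0..1} g p = compose {0..1} k g" by auto
  have gp: "g (p x) = k (g x)" if "0 \<le> x" "x \<le> 1" for x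
    using fun_cong[OF k(2), of x] that by (simp add: compose_def)
  define Z where "Z = {x \<in> unit_dyadics. \<not> [dyadic_sum (g x) = dyadic_sum x] (mod n)}"
  have inv: "p x \<in> Z \<longleftrightarrow> x \<in> Z" if x: "x \<in> unit_dyadics" for x
  proof -
    have "[dyadic_sum (g (p x)) = dyadic_sum (g x)] (mod n)"
      using gp[of x] unit_dyadics_bounds[OF x] k(1) thompson_homeos_unit_dyadics[OF gF x]
      by (simp add: digit_preserving_def)
    moreover have "[dyadic_sum (p x) = dyadic_sum x] (mod n)" using pK x by (simp add: digit_preserving_def)
    ultimately show ?thesis using x thompson_homeos_unit_dyadics[OF pF x] by (auto simp: Z_def cong_def)
  qed
  obtain z where z: "z \<in> Z" using g by (auto simp: digit_preserving_def Z_def)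
  obtain M where M: "standard_at_level g M" using gF by (auto simp: thompson_homeos_iff)
  then have "standard_on g M 0" by (simp add: standard_at_level_def)
  then obtain k' m' where km: "maps_standard g M 0 k' m'" unfolding standard_on_def by blast
  have "m' = 0" using maps_standard_left[OF km] gf(1) by simp
  then have far: "1 / 2 ^ M \<le> x" if "x \<in> Z" for x
    using dyadic_sum_cong_on_cell[OF km, of n x] that unit_dyadics_bounds[of x]
    by (fastforce simp: Z_def not_less)
  define \<alpha> where "\<alpha> = Inf Z"
  have bdd: "bdd_below Z" using far by (rule bdd_belowI)
  have "1 / 2 ^ M \<le> \<alpha>" unfolding \<alpha>_def using z far by (intro cInf_greatest) auto
  then have \<alpha>0: "0 < \<alpha>" by (smt (verit) divide_pos_pos zero_less_power)
  have "\<alpha> \<le> z" unfolding \<alpha>_def using z bdd by (rule cInf_lower)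
  then have \<alpha>1: "\<alpha> < 1" using z unit_dyadics_bounds[of z] by (simp add: Z_def)
  have "Inf Z < p \<alpha>" using plt[OF \<alpha>0 \<alpha>1] by (simp add: \<alpha>_def)
  then obtain x where x: "x \<in> Z" "x < p \<alpha>" using z cInf_lessD[of Z "p \<alpha>"] by blast
  obtain u where u: "u \<in> unit_dyadics" "p u = x"
    using unit_dyadics_preimage[OF pF] x by (auto simp: Z_def)
  then have "u \<in> Z" using inv x by blast
  then have "\<alpha> \<le> u" unfolding \<alpha>_def using bdd by (intro cInf_lower)
  then have "\<not> p u < p \<alpha>" using pf(4)[of u \<alpha>] unit_dyadics_bounds[OF u(1)] \<alpha>0 \<alpha>1 by simp
  then show False using x u by simp
qed

section \<open>Diagrams without contracting cells\<close>

text \<open>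
  Walks in the bare sense of consecutive edges, without reference to a graph, so that top and bottom
  paths of different diagrams can be compared.
\<close>

fun epath :: "nat \<Rightarrow> edge list \<Rightarrow> nat \<Rightarrow> bool" where
  "epath u [] v \<longleftrightarrow> u = v"
| "epath u (e # p) v \<longleftrightarrow> e_tail e = u \<and> epath (e_head e) p v"

lemma epath_append [simp]: "epath u (p @ q) v \<longleftrightarrow> (\<exists>w. epath u p w \<and> epath w q v)"
  by (induction p arbitrary: u) auto

lemma epath_ends: "epath u p v \<Longrightarrow> p \<noteq> [] \<Longrightarrow> e_tail (hd p) = u \<and> e_head (last p) = v"
  by (induction p arbitrary: u) auto

lemma epath_tail_exists: "epath u p v \<Longrightarrow> x \<in> set (u # map e_head p) \<Longrightarrow> x \<noteq> v \<Longrightarrow> \<exists>e\<in>set p. e_tail e = x"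
  by (induction p arbitrary: u) auto

lemma epath_tails: "epath u p v \<Longrightarrow> e_tail ` set p \<subseteq> set (u # map e_head p)"
  by (induction p arbitrary: u) auto

lemma epath_last_vertex: "epath u p v \<Longrightarrow> v \<in> set (u # map e_head p)"
  by (induction p arbitrary: u) auto

lemma epath_distinct_tail: "epath u p v \<Longrightarrow> distinct (u # map e_head p) \<Longrightarrow> e \<in> set p \<Longrightarrow> e_tail e \<noteq> v"
proof (induction p arbitrary: u)
  case (Cons a p)
  show ?case
  proof (cases "e = a")
    case True
    then show ?thesis using Cons.prems epath_last_vertex[of "e_head a" p v] by auto
  next
    case False
    then show ?thesis using Cons by auto
  qed
qed simp

lemma edge_simps [simp]: "e_tail (u, v, k) = u" "e_head (u, v, k) = v"
  by (simp_all add: e_tail_def e_head_def)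

text \<open>
  The new cell hangs from the edge \<open>(u, v, k)\<close> of the bottom path of \<open>D\<close>; \<open>xs\<close> and \<open>ys\<close> are the parts of
  this path before and after the edge.
\<close>

abbreviation split_edge ::
    "diagram \<Rightarrow> edge list \<Rightarrow> nat \<Rightarrow> nat \<Rightarrow> nat \<Rightarrow> edge list \<Rightarrow> nat \<Rightarrow> nat \<Rightarrow> nat \<Rightarrow> diagram" where
  "split_edge D xs u v k ys w l m \<equiv>
    \<lparr>d_edges = insert (u, w, l) (insert (w, v, m) (d_edges D)),
      d_cells = insert ([(u, v, k)], [(u, w, l), (w, v, m)]) (d_cells D),
      d_top = d_top D, d_bot = xs @ (u, w, l) # (w, v, m) # ys\<rparr>"

text \<open>
  Diagrams all of whose cells split one edge into two, built cell by cell from a path. Read upside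
  down the same description covers diagrams all of whose cells merge two edges. The two halves of a
  diagram cut along its longest positive path are of these two kinds, and a rule that adds a single
  cell at the bottom makes them accessible to induction.
\<close>

inductive forest :: "diagram \<Rightarrow> bool" where
  path: "p \<noteq> [] \<Longrightarrow> epath u p v \<Longrightarrow> distinct (u # map e_head p) \<Longrightarrow>
    forest \<lparr>d_edges = set p, d_cells = {}, d_top = p, d_bot = p\<rparr>"
| split: "forest D \<Longrightarrow> d_bot D = xs @ (u, v, k) # ys \<Longrightarrow> w \<notin> d_verts D \<Longrightarrow>
    forest (split_edge D xs u v k ys w l m)"

lemma d_init_simp [simp]: "d_init \<lparr>d_edges = E, d_cells = C, d_top = p, d_bot = q\<rparr> = e_tail (hd p)"
  by (simp add: d_init_def)

lemma d_term_simp [simp]: "d_term \<lparr>d_edges = E, d_cells = C, d_top = p, d_bot = q\<rparr> = e_head (last p)"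
  by (simp add: d_term_def)

lemma d_verts_simp [simp]:
  "d_verts \<lparr>d_edges = E, d_cells = C, d_top = p, d_bot = q\<rparr> = e_tail ` E \<union> e_head ` E"
  by (simp add: d_verts_def)

lemma edge_verts: "e \<in> d_edges D \<Longrightarrow> e_tail e \<in> d_verts D" "e \<in> d_edges D \<Longrightarrow> e_head e \<in> d_verts D"
  by (auto simp: d_verts_def)

lemma forest_basic:
  assumes "forest D"
  shows "d_top D \<noteq> []" "epath (d_init D) (d_top D) (d_term D)"
    "d_bot D \<noteq> []" "epath (d_init D) (d_bot D) (d_term D)"
    "distinct (d_init D # map e_head (d_bot D))"
    "set (d_top D) \<subseteq> d_edges D" "set (d_bot D) \<subseteq> d_edges D"
    "d_verts D = set (d_init D # map e_head (d_bot D))"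
proof -
  have "d_top D \<noteq> [] \<and> epath (d_init D) (d_top D) (d_term D) \<and>
    d_bot D \<noteq> [] \<and> epath (d_init D) (d_bot D) (d_term D) \<and>
    distinct (d_init D # map e_head (d_bot D)) \<and>
    set (d_top D) \<subseteq> d_edges D \<and> set (d_bot D) \<subseteq> d_edges D \<and>
    d_verts D = set (d_init D # map e_head (d_bot D))"
    using assms
  proof induction
    case (path p u v)
    then show ?case using epath_ends[OF path(2,1)] epath_tails[OF path(2)]
      by (auto simp: image_iff)
  next
    case (split D xs u v k ys w l m)
    let ?D = "split_edge D xs u v k ys w l m"
    from split have IH: "d_top D \<noteq> []" "epath (d_init D) (d_top D) (d_term D)"
      "epath (d_init D) (d_bot D) (d_term D)" "distinct (d_init D # map e_head (d_bot D))"
      "set (d_top D) \<subseteq> d_edges D" "set (d_bot D) \<subseteq> d_edges D"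
      "d_verts D = set (d_init D # map e_head (d_bot D))" by blast+
    have uv: "(u, v, k) \<in> d_edges D" using IH(6) split(2) by auto
    have V: "d_verts ?D = insert w (d_verts D)" using edge_verts[OF uv] by (auto simp: d_verts_def)
    have i: "d_init ?D = d_init D" "d_term ?D = d_term D" by (simp_all only: d_init_def d_term_def diagram.simps)
    have "w \<notin> set (d_init D # map e_head (d_bot D))" using split(3) IH(7) by simp
    then show ?case using IH unfolding i V split(2) diagram.simps by auto
  qed
  then show "d_top D \<noteq> []" "epath (d_init D) (d_top D) (d_term D)"
    "d_bot D \<noteq> []" "epath (d_init D) (d_bot D) (d_term D)"
    "distinct (d_init D # map e_head (d_bot D))"
    "set (d_top D) \<subseteq> d_edges D" "set (d_bot D) \<subseteq> d_edges D"
    "d_verts D = set (d_init D # map e_head (d_bot D))"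
    by blast+
qed

lemma d_verts_mult: "d_verts (d_mult D1 D2) = d_verts D1 \<union> d_verts D2"
  by (auto simp: d_mult_def d_verts_def)

lemma d_verts_add: "d_verts (d_add D1 D2) = d_verts D1 \<union> d_verts D2"
  by (auto simp: d_add_def d_verts_def)

lemma d_verts_inv [simp]: "d_verts (d_inv D) = d_verts D"
  by (simp add: d_inv_def d_verts_def)

lemma d_inv_inv [simp]: "d_inv (d_inv D) = D"
  by (simp add: d_inv_def)

lemma d_inv_simps [simp]:
  "d_edges (d_inv D) = d_edges D" "d_cells (d_inv D) = (d_cells D)\<inverse>"
  "d_top (d_inv D) = d_bot D" "d_bot (d_inv D) = d_top D"
  by (simp_all add: d_inv_def)

lemma d_mult_simps [simp]:
  "d_edges (d_mult D1 D2) = d_edges D1 \<union> d_edges D2" "d_cells (d_mult D1 D2) = d_cells D1 \<union> d_cells D2"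
  "d_top (d_mult D1 D2) = d_top D1" "d_bot (d_mult D1 D2) = d_bot D2"
  by (simp_all add: d_mult_def)

lemma d_add_simps [simp]:
  "d_edges (d_add D1 D2) = d_edges D1 \<union> d_edges D2" "d_cells (d_add D1 D2) = d_cells D1 \<union> d_cells D2"
  "d_top (d_add D1 D2) = d_top D1 @ d_top D2" "d_bot (d_add D1 D2) = d_bot D1 @ d_bot D2"
  by (simp_all add: d_add_def)

text \<open>
  The cells of the second factor are added to the first factor one by one; a vertex that is new in
  the second factor is new in the product because the factors share only the vertices of the common
  path.
\<close>

lemma forest_mult: "forest D2 \<Longrightarrow> forest D1 \<Longrightarrow> multipliable D1 D2 \<Longrightarrow> forest (d_mult D1 D2)"
proof (induction rule: forest.induct)
  case (path p u v)
  then have "d_mult D1 \<lparr>d_edges = set p, d_cells = {}, d_top = p, d_bot = p\<rparr> = D1"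
    using forest_basic(7)[OF path(4)] by (cases D1) (auto simp: d_mult_def multipliable_def)
  then show ?case using path by simp
next
  case (split D2 xs u v k ys w l m)
  note b2 = forest_basic[OF split.hyps(1)]
  let ?D2 = "split_edge D2 xs u v k ys w l m"
  have m: "d_bot D1 = d_top D2" "d_edges D1 \<inter> d_edges ?D2 = set (d_bot D1)"
    "d_verts D1 \<inter> d_verts ?D2 = e_tail ` set (d_bot D1) \<union> e_head ` set (d_bot D1)"
    using split.prems(2) unfolding multipliable_def by auto
  have uv: "(u, v, k) \<in> d_edges D2" using b2 split by auto
  have V: "d_verts ?D2 = insert w (d_verts D2)"
    using edge_verts[OF uv] by (auto simp: d_verts_def)
  have bv: "e_tail ` set (d_bot D1) \<union> e_head ` set (d_bot D1) \<subseteq> d_verts D2"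
    using b2(6) m(1) by (auto simp: d_verts_def)
  have "w \<in> d_verts ?D2" using V by simp
  then have w: "w \<notin> d_verts D1" using m(3) bv split.hyps(3) by blast
  have e: "d_edges D1 \<inter> d_edges D2 = set (d_bot D1)" using m(2) b2(6) m(1) by auto
  have v: "d_verts D1 \<inter> d_verts D2 = e_tail ` set (d_bot D1) \<union> e_head ` set (d_bot D1)"
    using m(3) bv unfolding V using w by auto
  have "multipliable D1 D2" unfolding multipliable_def using e v m(1) by blast
  then have f: "forest (d_mult D1 D2)" using split by blast
  have "d_mult D1 ?D2 = split_edge (d_mult D1 D2) xs u v k ys w l m"
    by (simp add: d_mult_def)
  also have "forest \<dots>"
    using w split.hyps by (intro forest.split[OF f]) (auto simp: d_verts_mult)
  finally show ?case .
qed

lemma forest_add_path: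
  assumes "forest D2" "p \<noteq> []" "epath u p v" "distinct (u # map e_head p)"
    and "addable \<lparr>d_edges = set p, d_cells = {}, d_top = p, d_bot = p\<rparr> D2"
  shows "forest (d_add \<lparr>d_edges = set p, d_cells = {}, d_top = p, d_bot = p\<rparr> D2)"
  using assms
proof induction
  case (path q u' v')
  have "v = u'"
    using epath_ends[OF path(5,4)] epath_ends[OF path(2,1)] path(7) by (simp add: addable_def)
  have V: "d_verts \<lparr>d_edges = set r, d_cells = {}, d_top = r, d_bot = r\<rparr> = set (a # map e_head r)"
    if "r \<noteq> []" "epath a r b" "distinct (a # map e_head r)" for r a b
    using forest_basic(8)[OF forest.path[OF that]] epath_ends[OF that(2,1)] by simp
  have "set (u # map e_head p) \<inter> set (u' # map e_head q) = {v}"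
    using path(7) epath_ends[OF path(5,4)] unfolding addable_def V[OF path(4-6)] V[OF path(1-3)] by simp
  moreover have "v \<notin> set (map e_head q)" using path(3) \<open>v = u'\<close> by auto
  ultimately have "distinct (u # map e_head (p @ q))" using path(3,6) \<open>v = u'\<close> by auto
  moreover have "epath u (p @ q) v'" using path \<open>v = u'\<close> by auto
  ultimately have "forest \<lparr>d_edges = set (p @ q), d_cells = {}, d_top = p @ q, d_bot = p @ q\<rparr>"
    using path by (intro forest.path) auto
  then show ?case by (simp add: d_add_def)
next
  case (split D2 xs u' v' k ys w l m)
  let ?P = "\<lparr>d_edges = set p, d_cells = {}, d_top = p, d_bot = p\<rparr>"
  let ?D2 = "split_edge D2 xs u' v' k ys w l m"
  note b2 = forest_basic[OF split.hyps(1)]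
  have uv: "(u', v', k) \<in> d_edges D2" using b2 split by auto
  have V: "d_verts ?D2 = insert w (d_verts D2)"
    using edge_verts[OF uv] by (auto simp: d_verts_def)
  have i: "d_init ?D2 = d_init D2" by (simp add: d_init_def)
  have iv: "d_init D2 \<in> d_verts D2" using b2(8) by simp
  have a: "d_term ?P = d_init D2" "d_verts ?P \<inter> insert w (d_verts D2) = {d_init D2}"
    using split.prems(4) unfolding addable_def V i by simp_all
  have w: "w \<notin> d_verts ?P" using a(2) iv split.hyps(3) by (metis IntI insertI1 singletonD)
  have "addable ?P D2" unfolding addable_def using a iv w by auto
  then have f: "forest (d_add ?P D2)" using split by blast
  have "d_add ?P ?D2 = split_edge (d_add ?P D2) (p @ xs) u' v' k ys w l m"
    by (simp add: d_add_def)
  also have "forest \<dots>"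
    using w split.hyps by (intro forest.split[OF f]) (auto simp: d_verts_add)
  finally show ?case .
qed

lemma forest_add: "forest D1 \<Longrightarrow> forest D2 \<Longrightarrow> addable D1 D2 \<Longrightarrow> forest (d_add D1 D2)"
proof (induction rule: forest.induct)
  case (path p u v)
  then show ?case using forest_add_path by blast
next
  case (split D1 xs u v k ys w l m)
  let ?D1 = "split_edge D1 xs u v k ys w l m"
  note b1 = forest_basic[OF split.hyps(1)]
  have uv: "(u, v, k) \<in> d_edges D1" using b1 split by auto
  have V: "d_verts ?D1 = insert w (d_verts D1)"
    using edge_verts[OF uv] by (auto simp: d_verts_def)
  have t: "d_term ?D1 = d_term D1" by (simp add: d_term_def)
  have tv: "d_term D1 \<in> d_verts D1" using epath_last_vertex[OF b1(4)] b1(8) by simp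
  have a: "d_term D1 = d_init D2" "insert w (d_verts D1) \<inter> d_verts D2 = {d_term D1}"
    using split.prems(2) unfolding addable_def V t by simp_all
  have w: "w \<notin> d_verts D2" using a(2) tv split.hyps(3) by (metis IntI insertI1 singletonD)
  have "addable D1 D2" unfolding addable_def using a w tv by auto
  then have f: "forest (d_add D1 D2)" using split by blast
  have "d_add ?D1 D2 = split_edge (d_add D1 D2) xs u v k (ys @ d_bot D2) w l m"
    by (simp add: d_add_def)
  also have "forest \<dots>"
    using w split.hyps by (intro forest.split[OF f]) (auto simp: d_verts_add)
  finally show ?case .
qed

lemma forest_init_term:
  assumes "forest D"
  shows "d_init (d_inv D) = d_init D" "d_term (d_inv D) = d_term D"
  using epath_ends[OF forest_basic(4,3)[OF assms]] by (simp_all add: d_init_def[of "d_inv D"] d_term_def[of "d_inv D"])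

text \<open>
  Both halves of the conclusion are needed at once, because inversion of diagrams interchanges them.
\<close>

theorem is_diagram_forest:
  "is_diagram D \<Longrightarrow>
    ((\<forall>(p, q)\<in>d_cells D. length p = 1 \<and> length q = 2) \<longrightarrow> forest D) \<and>
    ((\<forall>(p, q)\<in>d_cells D. length p = 2 \<and> length q = 1) \<longrightarrow> forest (d_inv D))"
proof (induction rule: is_diagram.induct)
  case (edge u v k)
  have "forest \<lparr>d_edges = set [(u, v, k)], d_cells = {}, d_top = [(u, v, k)], d_bot = [(u, v, k)]\<rparr>"
    using edge by (intro forest.path) auto
  then show ?case by (simp add: d_inv_def)
next
  case (cell u w v k l m)
  let ?E = "\<lparr>d_edges = set [(u, v, k)], d_cells = {}, d_top = [(u, v, k)], d_bot = [(u, v, k)]\<rparr>"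
  have "forest ?E" using cell by (intro forest.path) auto
  from forest.split[OF this, of "[]" u v k "[]" w l m]
  have "forest \<lparr>d_edges = {(u, w, l), (w, v, m), (u, v, k)},
      d_cells = {([(u, v, k)], [(u, w, l), (w, v, m)])},
      d_top = [(u, v, k)], d_bot = [(u, w, l), (w, v, m)]\<rparr>"
    using cell by simp
  moreover have "{(u, w, l), (w, v, m), (u, v, k)} = {(u, v, k), (u, w, l), (w, v, m)}" by auto
  ultimately show ?case by simp
next
  case (add D1 D2)
  have inv: "d_inv (d_add D1 D2) = d_add (d_inv D1) (d_inv D2)" by (auto simp: d_inv_def d_add_def)
  have "addable (d_inv D1) (d_inv D2)" if "forest (d_inv D1)" "forest (d_inv D2)"
    using add.hyps(3) forest_init_term[OF that(1)] forest_init_term[OF that(2)] by (simp add: addable_def)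
  then show ?case
    using add.IH add.hyps(3) forest_add[of D1 D2] forest_add[of "d_inv D1" "d_inv D2"]
    unfolding inv d_add_simps ball_Un by argo
next
  case (mult D1 D2)
  have inv: "d_inv (d_mult D1 D2) = d_mult (d_inv D2) (d_inv D1)" by (auto simp: d_inv_def d_mult_def)
  have "multipliable (d_inv D2) (d_inv D1)"
    using mult.hyps(3) by (simp add: multipliable_def Int_commute)
  then show ?case
    using mult.IH mult.hyps(3) forest_mult[of D2 D1] forest_mult[of "d_inv D1" "d_inv D2"]
    unfolding inv d_mult_simps ball_Un by argo
next
  case (inv D)
  have "(\<forall>(p, q)\<in>R\<inverse>. P p q) \<longleftrightarrow> (\<forall>(p, q)\<in>R. P q p)" for R :: "(edge list \<times> edge list) set" and P
    by auto
  then show ?case using inv.IH by (simp add: conj_commute)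
qed

section \<open>Positions of vertices and vertical order of edges\<close>

lemma directly_above_image: "directly_above D = (\<lambda>(p, q). (last p, last q)) ` d_cells D"
  by (force simp: directly_above_def)

lemma directly_above_split:
  "directly_above \<lparr>d_edges = E, d_cells = insert ([(u, v, k)], [(u, w, l), (w, v, m)]) (d_cells D),
      d_top = t, d_bot = b\<rparr> = insert ((u, v, k), (w, v, m)) (directly_above D)"
  by (simp add: directly_above_image)

lemma edge_interval_mono:
  assumes "edge_interval D e a b" "d_top D' = d_top D" "d_cells D \<subseteq> d_cells D'"
  shows "edge_interval D' e a b"
  using assms(1)
proof induction
  case (top e)
  then show ?case using assms by (intro edge_interval.top) simp
next
  case (left e a b f g)
  then show ?case using assms by (intro edge_interval.left) auto
next
  case (right e a b f g)
  then show ?case using assms by (intro edge_interval.right) auto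
qed

lemma edge_interval_standard:
  "edge_interval D e a b \<Longrightarrow> \<exists>k m. m < 2 ^ k \<and> a = real m / 2 ^ k \<and> b = (real m + 1) / 2 ^ k"
proof (induction rule: edge_interval.induct)
  case (top e)
  show ?case by (intro exI[of _ 0]) auto
next
  case (left e a b f g)
  then obtain k m where "m < 2 ^ k" "a = real m / 2 ^ k" "b = (real m + 1) / 2 ^ k" by blast
  then show ?case by (intro exI[of _ "Suc k"] exI[of _ "2 * m"]) (auto simp: field_simps)
next
  case (right e a b f g)
  then obtain k m where "m < 2 ^ k" "a = real m / 2 ^ k" "b = (real m + 1) / 2 ^ k" by blast
  then show ?case by (intro exI[of _ "Suc k"] exI[of _ "Suc (2 * m)"]) (auto simp: field_simps)
qed

lemma forest_cellD:
  assumes "forest D" "(p, q) \<in> d_cells D"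
  shows "\<exists>u v k w l m. p = [(u, v, k)] \<and> q = [(u, w, l), (w, v, m)] \<and> set p \<subseteq> d_edges D \<and> set q \<subseteq> d_edges D"
  using assms
proof (induction arbitrary: p q)
  case (split D xs u v k ys w l m)
  have uv: "(u, v, k) \<in> d_edges D" using forest_basic(7)[OF split(1)] split(2) by auto
  from split.prems consider "p = [(u, v, k)]" "q = [(u, w, l), (w, v, m)]" | "(p, q) \<in> d_cells D"
    by auto
  then show ?case
  proof cases
    case 2
    from split.IH[OF this] show ?thesis by auto
  qed (use uv in auto)
qed simp

text \<open>
  An edge that has been split is covered by a cell and never returns to the bottom path.
\<close>

lemma forest_parent_not_bottom:
  assumes "forest D" "([e], q) \<in> d_cells D"
  shows "e \<notin> set (d_bot D)"
  using assms
proof (induction arbitrary: e q)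
  case (split D xs u v k ys w l m)
  note b = forest_basic[OF split(1)]
  have "distinct (map e_head (d_bot D))" using b(5) by simp
  then have old: "(u, v, k) \<notin> set xs \<union> set ys" unfolding split(2) by force
  have ne: "u \<noteq> w" "v \<noteq> w" using edge_verts[of "(u, v, k)" D] b(7) split(2,3) by auto
  have new: "e \<noteq> (u, w, l) \<and> e \<noteq> (w, v, m)" if "([e], q) \<in> d_cells D"
    using forest_cellD[OF split(1) that] edge_verts[of e D] split(3) by auto
  from split.prems consider "e = (u, v, k)" | "([e], q) \<in> d_cells D" by auto
  then show ?case
  proof cases
    case 1
    then show ?thesis using old ne by simp
  next
    case 2
    then show ?thesis using split.IH[OF 2] new[OF 2] unfolding split(2) by simp
  qed
qed simp

text \<open>
  Following the last edges of the cells below an edge, one reaches the bottom path without changing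
  the terminal vertex.
\<close>

lemma forest_bottom_below:
  assumes "forest D" "e \<in> d_edges D"
  shows "\<exists>b\<in>set (d_bot D). e_head b = e_head e \<and> (e, b) \<in> (directly_above D)\<^sup>*"
  using assms
proof (induction arbitrary: e)
  case (split D xs u v k ys w l m)
  let ?D = "split_edge D xs u v k ys w l m"
  have sub: "(directly_above D)\<^sup>* \<subseteq> (directly_above ?D)\<^sup>*"
    by (intro rtrancl_mono) (auto simp: directly_above_split)
  have step: "((u, v, k), (w, v, m)) \<in> directly_above ?D" by (simp add: directly_above_split)
  consider "e = (u, w, l)" | "e = (w, v, m)" | "e \<in> d_edges D" using split.prems by auto
  then show ?case
  proof cases
    case 3
    from split.IH[OF this] obtain b where b: "b \<in> set (d_bot D)" "e_head b = e_head e"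
      "(e, b) \<in> (directly_above D)\<^sup>*" by blast
    then have eb: "(e, b) \<in> (directly_above ?D)\<^sup>*" using sub by blast
    show ?thesis
    proof (cases "b = (u, v, k)")
      case True
      then have "(e, (w, v, m)) \<in> (directly_above ?D)\<^sup>*" using eb step by (simp add: rtrancl_into_rtrancl)
      then show ?thesis using b True by (intro bexI[of _ "(w, v, m)"]) auto
    next
      case False
      then show ?thesis using b eb split(2) by (intro bexI[of _ b]) auto
    qed
  qed auto
qed auto

text \<open>
  A vertex outside the top path is created by one cell; the left lower edge of this cell is the first
  edge to enter the vertex and lies above all others.
\<close>

lemma forest_creating_edge:
  assumes "forest D" "v \<in> d_verts D" "v \<notin> e_tail ` set (d_top D) \<union> e_head ` set (d_top D)"
  shows "\<exists>e f g. ([e], [f, g]) \<in> d_cells D \<and> e_head f = v \<and> (\<forall>x. (x, f) \<notin> directly_above D) \<and>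
    (\<forall>e'\<in>d_edges D. e_head e' = v \<longrightarrow> (f, e') \<in> (directly_above D)\<^sup>*)"
  using assms
proof (induction arbitrary: v)
  case (path p u v v')
  then show ?case by simp
next
  case (split D xs u v k ys w l m z)
  let ?D = "split_edge D xs u v k ys w l m"
  have da: "directly_above ?D = insert ((u, v, k), (w, v, m)) (directly_above D)"
    by (rule directly_above_split)
  have sub: "(directly_above D)\<^sup>* \<subseteq> (directly_above ?D)\<^sup>*"
    by (intro rtrancl_mono) (auto simp: da)
  have da_edges: "x \<in> d_edges D \<and> y \<in> d_edges D" if "(x, y) \<in> directly_above D" for x y
    using that forest_cellD[OF split(1)] unfolding directly_above_def by fastforce
  have uv: "(u, v, k) \<in> d_edges D" using forest_basic(7)[OF split(1)] split(2) by auto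
  have ne: "u \<noteq> w" "v \<noteq> w" using edge_verts[OF uv] split(3) by auto
  have fresh: "e_tail e \<noteq> w" "e_head e \<noteq> w" if "e \<in> d_edges D" for e
    using edge_verts[OF that] split(3) by auto
  show ?case
  proof (cases "z = w")
    case True
    have "(x, (u, w, l)) \<notin> directly_above ?D" for x
      using da_edges[of x "(u, w, l)"] fresh(2)[of "(u, w, l)"] ne unfolding da by auto
    moreover have "((u, w, l), e') \<in> (directly_above ?D)\<^sup>*" if "e' \<in> d_edges ?D" "e_head e' = w" for e'
    proof -
      consider "e' = (u, w, l)" | "e' = (w, v, m)" | "e' \<in> d_edges D" using \<open>e' \<in> d_edges ?D\<close> by auto
      then show ?thesis using fresh(2)[of e'] ne \<open>e_head e' = w\<close> by cases simp_all
    qed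
    ultimately show ?thesis
      unfolding True by (intro exI[of _ "(u, v, k)"] exI[of _ "(u, w, l)"] exI[of _ "(w, v, m)"]) auto
  next
    case False
    have "z \<in> d_verts D" using split.prems(1) False edge_verts[OF uv] by (auto simp: d_verts_def)
    with split.IH[of z] split.prems(2) obtain e f g where
      f: "([e], [f, g]) \<in> d_cells D" "e_head f = z" "\<And>x. (x, f) \<notin> directly_above D"
        "\<And>e'. e' \<in> d_edges D \<Longrightarrow> e_head e' = z \<Longrightarrow> (f, e') \<in> (directly_above D)\<^sup>*"
      by auto
    have fe: "f \<in> d_edges D" using forest_cellD[OF split(1) f(1)] by auto
    have "(x, f) \<notin> directly_above ?D" for x
      using f(3) fresh(1)[OF fe] unfolding da by auto
    moreover have "(f, e') \<in> (directly_above ?D)\<^sup>*" if e': "e' \<in> d_edges ?D" "e_head e' = z" for e'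
    proof -
      consider "e' = (u, w, l)" | "e' = (w, v, m)" | "e' \<in> d_edges D" using e' by auto
      then show ?thesis
      proof cases
        case 1
        then show ?thesis using e' False by simp
      next
        case 2
        then have "(f, (u, v, k)) \<in> (directly_above ?D)\<^sup>*" using f(4)[OF uv] e' sub by auto
        then show ?thesis using 2 da by (auto intro: rtrancl_into_rtrancl)
      next
        case 3
        then show ?thesis using f(4) e' sub by blast
      qed
    qed
    ultimately show ?thesis using f(1,2) by (intro exI[of _ e] exI[of _ f] exI[of _ g]) auto
  qed
qed

lemma forest_edge_has_interval:
  assumes "forest D" "d_top D = [e0]" "e \<in> d_edges D"
  shows "\<exists>a b. edge_interval D e a b"
  using assms
proof (induction arbitrary: e)
  case (path p u v)
  then show ?case using edge_interval.top by fastforce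
next
  case (split D xs u v k ys w l m)
  let ?D = "split_edge D xs u v k ys w l m"
  have mono: "edge_interval ?D e a b" if "edge_interval D e a b" for e a b
    using that by (rule edge_interval_mono) auto
  have IH: "\<exists>a b. edge_interval ?D e a b" if "e \<in> d_edges D" for e
  proof -
    have "d_top D = [e0]" using split.prems(1) by simp
    from split.IH[OF this that] show ?thesis using mono by blast
  qed
  have uv: "(u, v, k) \<in> d_edges D" using forest_basic(7)[OF split(1)] split(2) by auto
  obtain a b where ab: "edge_interval ?D (u, v, k) a b" using IH[OF uv] by blast
  have cell: "([(u, v, k)], [(u, w, l), (w, v, m)]) \<in> d_cells ?D" by simp
  consider "e = (u, w, l)" | "e = (w, v, m)" | "e \<in> d_edges D" using split.prems(2) by auto
  then show ?case
    using IH edge_interval.left[OF ab cell] edge_interval.right[OF ab cell] by cases blast+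
qed

lemma forest_positions_exist:
  assumes "forest D" "d_top D = [e0]"
  shows "\<exists>pos :: nat \<Rightarrow> real. pos (e_tail e0) = 0 \<and> pos (e_head e0) = 1 \<and>
    (\<forall>e f g. ([e], [f, g]) \<in> d_cells D \<longrightarrow> pos (e_head f) = (pos (e_tail e) + pos (e_head e)) / 2)"
  using assms
proof induction
  case (path p u v)
  then have "e_tail e0 \<noteq> e_head e0" by auto
  then show ?case by (intro exI[of _ "\<lambda>x. if x = e_tail e0 then 0 else 1"]) simp
next
  case (split D xs u v k ys w l m)
  have "d_top D = [e0]" using split.prems by simp
  from split.IH[OF this]
  obtain pos :: "nat \<Rightarrow> real" where pos: "pos (e_tail e0) = 0" "pos (e_head e0) = 1"
    "\<And>e f g. ([e], [f, g]) \<in> d_cells D \<Longrightarrow> pos (e_head f) = (pos (e_tail e) + pos (e_head e)) / 2"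
    by blast
  note b = forest_basic[OF split(1)]
  have fresh: "e_tail e \<noteq> w" "e_head e \<noteq> w" if "e \<in> d_edges D" for e
    using edge_verts[OF that] split(3) by auto
  have uv: "(u, v, k) \<in> d_edges D" using b(7) split(2) by auto
  have e0: "e0 \<in> d_edges D" using b(6) split.prems by simp
  show ?case
  proof (intro exI[of _ "pos(w := (pos u + pos v) / 2)"] conjI allI impI)
    fix e f g
    assume "([e], [f, g]) \<in> d_cells (split_edge D xs u v k ys w l m)"
    then consider "e = (u, v, k)" "f = (u, w, l)" | "([e], [f, g]) \<in> d_cells D" by auto
    then show "(pos(w := (pos u + pos v) / 2)) (e_head f) =
      ((pos(w := (pos u + pos v) / 2)) (e_tail e) + (pos(w := (pos u + pos v) / 2)) (e_head e)) / 2"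
    proof cases
      case 1
      then show ?thesis using fresh[OF uv] by simp
    next
      case 2
      have "e \<in> d_edges D" "f \<in> d_edges D" using forest_cellD[OF split(1) 2] by auto
      then show ?thesis using pos(3)[OF 2] fresh by simp
    qed
  qed (use pos fresh[OF e0] in auto)
qed

text \<open>
  Each vertex gets the end point that the intervals of its edges have in common. The cell that creates a
  vertex puts it at the midpoint of a standard interval: its binary expansion is that of the left end
  point with one digit \<open>1\<close> appended. This is the source of all digit sums below.
\<close>

lemma forest_positions:
  assumes D: "forest D" and top: "d_top D = [e0]"
  obtains pos :: "nat \<Rightarrow> real" where
    "pos (d_init D) = 0" "pos (d_term D) = 1"
    "\<And>e a b. e \<in> d_edges D \<Longrightarrow> edge_interval D e a b \<longleftrightarrow> a = pos (e_tail e) \<and> b = pos (e_head e)"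
    "\<And>e f g. ([e], [f, g]) \<in> d_cells D \<Longrightarrow> dyadic_sum (pos (e_head f)) = Suc (dyadic_sum (pos (e_tail f)))"
proof -
  obtain pos :: "nat \<Rightarrow> real" where pos: "pos (e_tail e0) = 0" "pos (e_head e0) = 1"
    "\<And>e f g. ([e], [f, g]) \<in> d_cells D \<Longrightarrow> pos (e_head f) = (pos (e_tail e) + pos (e_head e)) / 2"
    using forest_positions_exist[OF D top] by blast
  have incident: "e_tail f = e_tail e" "e_head f = e_tail g" "e_head g = e_head e"
    if "([e], [f, g]) \<in> d_cells D" for e f g
    using forest_cellD[OF D that] by auto
  have det: "a = pos (e_tail e) \<and> b = pos (e_head e)" if "edge_interval D e a b" for e a b
    using that
  proof induction
    case (top e)
    then show ?case using assms(2) pos by simp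
  next
    case (left e a b f g)
    then show ?case using incident pos(3) by simp
  next
    case (right e a b f g)
    then show ?case using incident[of e f g] pos(3)[of e f g] by simp
  qed
  have ex: "edge_interval D e (pos (e_tail e)) (pos (e_head e))" if "e \<in> d_edges D" for e
    using forest_edge_has_interval[OF D top that] det by blast
  have "dyadic_sum (pos (e_head f)) = Suc (dyadic_sum (pos (e_tail f)))"
    if c: "([e], [f, g]) \<in> d_cells D" for e f g
  proof -
    have "e \<in> d_edges D" using forest_cellD[OF D c] by auto
    from edge_interval_standard[OF ex[OF this]] obtain k m where
      km: "pos (e_tail e) = real m / 2 ^ k" "pos (e_head e) = (real m + 1) / 2 ^ k" by blast
    have "pos (e_head f) = real (Suc (2 * m)) / 2 ^ Suc k"
      using pos(3)[OF c] km by (simp add: field_simps)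
    moreover have "pos (e_tail f) = real m / 2 ^ k" using incident(1)[OF c] km by simp
    ultimately show ?thesis by (simp only: dyadic_sum_eq bitsum_Suc_double)
  qed
  moreover have "edge_interval D e a b \<longleftrightarrow> a = pos (e_tail e) \<and> b = pos (e_head e)"
    if "e \<in> d_edges D" for e a b
    using det ex[OF that] by blast
  moreover have "pos (d_init D) = 0" "pos (d_term D) = 1"
    using pos(1,2) by (simp_all add: d_init_def d_term_def top)
  ultimately show ?thesis using that[of pos] by blast
qed

section \<open>Lengths of paths in the Thompson graph\<close>

text \<open>
  The edge that creates the vertex in the upper half \<open>P\<close> is above every other incoming edge, also
  above those of the lower half, which hang below the common path. No edge lies directly above it:
  in \<open>P\<close> because it is a left lower edge of its cell, and in \<open>Q\<close> because an edge of the common path is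
  not split there. So it is the only top-most one.
\<close>

lemma topmost_incoming_product:
  assumes P: "forest P" and Q: "forest Q" and top: "d_top P = [e0]" and m: "multipliable P (d_inv Q)"
    and v: "v \<in> inner_verts (d_mult P (d_inv Q))"
  obtains e f g where "([e], [f, g]) \<in> d_cells P" "e_head f = v"
    "\<And>f'. topmost_incoming (d_mult P (d_inv Q)) v f' \<longleftrightarrow> f' = f"
proof -
  let ?D = "d_mult P (d_inv Q)"
  have bot: "d_bot P = d_bot Q" and edges: "d_edges P \<inter> d_edges Q = set (d_bot P)"
    using m by (simp_all add: multipliable_def)
  have init: "d_init P = e_tail e0" "d_term P = e_head e0" using top by (simp_all add: d_init_def d_term_def)
  have initD: "d_init ?D = d_init P" "d_term ?D = d_term P" by (simp_all add: d_init_def d_term_def)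
  have "d_verts Q = d_verts P"
  proof -
    have "d_init Q = d_init P"
      using forest_init_term(1)[OF P] forest_init_term(1)[OF Q] bot by (simp add: d_init_def)
    then show ?thesis using forest_basic(8)[OF P] forest_basic(8)[OF Q] bot by simp
  qed
  then have "v \<in> d_verts P" "v \<noteq> d_init P" "v \<noteq> d_term P"
    using v by (auto simp: inner_verts_def d_verts_mult initD)
  then obtain e f g where f: "([e], [f, g]) \<in> d_cells P" "e_head f = v"
      "\<And>x. (x, f) \<notin> directly_above P"
      "\<And>e'. e' \<in> d_edges P \<Longrightarrow> e_head e' = v \<Longrightarrow> (f, e') \<in> (directly_above P)\<^sup>*"
    using forest_creating_edge[OF P, of v] top init by auto
  have fP: "f \<in> d_edges P" using forest_cellD[OF P f(1)] by auto
  have da: "directly_above ?D = directly_above P \<union> (directly_above Q)\<inverse>"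
    unfolding directly_above_image by force
  have subP: "(directly_above P)\<^sup>* \<subseteq> (directly_above ?D)\<^sup>*" unfolding da by (intro rtrancl_mono) auto
  have subQ: "((directly_above Q)\<^sup>*)\<inverse> \<subseteq> (directly_above ?D)\<^sup>*"
    unfolding da rtrancl_converse[symmetric] by (intro rtrancl_mono) auto
  have nopred: "(x, f) \<notin> directly_above ?D" for x
  proof
    assume "(x, f) \<in> directly_above ?D"
    then have "(f, x) \<in> directly_above Q" using f(3) unfolding da by auto
    then obtain p q where pq: "(p, q) \<in> d_cells Q" "f = last p" by (auto simp: directly_above_def)
    then have "([f], q) \<in> d_cells Q" "f \<in> d_edges Q" using forest_cellD[OF Q pq(1)] by auto
    then have "f \<notin> set (d_bot Q)" "f \<in> set (d_bot P)"
      using forest_parent_not_bottom[OF Q] edges fP by auto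
    then show False using bot by simp
  qed
  have below: "(f, e') \<in> (directly_above ?D)\<^sup>*" if e': "e' \<in> d_edges ?D" "e_head e' = v" for e'
  proof (cases "e' \<in> d_edges P")
    case True
    then show ?thesis using f(4) e' subP by blast
  next
    case False
    then have "e' \<in> d_edges Q" using e' by simp
    then obtain b where b: "b \<in> set (d_bot Q)" "e_head b = v" "(e', b) \<in> (directly_above Q)\<^sup>*"
      using forest_bottom_below[OF Q] e'(2) by blast
    have "b \<in> d_edges P" using b(1) bot forest_basic(7)[OF P] by auto
    then have "(f, b) \<in> (directly_above ?D)\<^sup>*" using f(4) b(2) subP by blast
    moreover have "(b, e') \<in> (directly_above ?D)\<^sup>*" using b(3) subQ by blast
    ultimately show ?thesis by (rule rtrancl_trans)
  qed
  have "topmost_incoming ?D v f' \<longleftrightarrow> f' = f" for f'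
  proof
    assume "topmost_incoming ?D v f'"
    then have "(f', f) \<in> (directly_above ?D)\<^sup>*" using f(2) fP by (simp add: topmost_incoming_def)
    then show "f' = f" using nopred by (metis rtranclE)
  next
    assume "f' = f"
    then show "topmost_incoming ?D v f'" using f(2) fP below by (simp add: topmost_incoming_def)
  qed
  then show ?thesis using that f by blast
qed

lemma cas_snoc: "pre_digraph.cas G u (p @ [a]) v \<longleftrightarrow> pre_digraph.cas G u p (tail G a) \<and> head G a = v"
  by (induction p arbitrary: u) (auto simp: pre_digraph.cas.simps)

lemma upper_arc_iff: "Upper e \<in> arcs (thompson_graph D) \<longleftrightarrow> (\<exists>v\<in>inner_verts D. topmost_incoming D v e)"
  by (simp add: thompson_graph_def del: split_paired_Ex) blast

lemma lower_arc_iff: "Lower e \<in> arcs (thompson_graph D) \<longleftrightarrow> (\<exists>v\<in>inner_verts D. bottommost_incoming D v e)"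
  by (simp add: thompson_graph_def del: split_paired_Ex) blast

text \<open>
  If every inner vertex is entered by exactly one arc of a given kind and the rank \<open>r\<close> drops by one
  along this arc, then the walk of this kind to a vertex is found by going backwards; it is unique and its
  length is the rank. The constructor \<open>c\<close> stands for either kind of arc.
\<close>

lemma walk_length_from_init:
  fixes c :: "edge \<Rightarrow> thompson_arc" and r :: "nat \<Rightarrow> nat"
  assumes c: "\<And>e. arc_edge (c e) = e"
    and init: "d_init D \<in> d_verts D" "d_init D \<noteq> d_term D" "r (d_init D) = 0"
    and heads: "\<And>e. c e \<in> arcs (thompson_graph D) \<Longrightarrow> e_head e \<in> inner_verts D"
    and arcs: "\<And>v. v \<in> inner_verts D \<Longrightarrow> \<exists>f. (\<forall>f'. c f' \<in> arcs (thompson_graph D) \<and> e_head f' = v \<longleftrightarrow> f' = f) \<and>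
        e_tail f \<in> insert (d_init D) (inner_verts D) \<and> r v = Suc (r (e_tail f))"
    and v: "v \<in> insert (d_init D) (inner_verts D)"
  shows "length (THE p. pre_digraph.awalk (thompson_graph D) (d_init D) p v \<and> set p \<subseteq> range c) = r v"
proof -
  let ?G = "thompson_graph D"
  define W where "W p v \<longleftrightarrow> pre_digraph.awalk ?G (d_init D) p v \<and> set p \<subseteq> range c" for p v
  have tails: "tail ?G (c e) = e_tail e" "head ?G (c e) = e_head e" for e
    using c by (simp_all add: thompson_graph_def)
  have iv: "d_init D \<in> verts ?G" using init by (simp add: thompson_graph_def)
  have not_inner: "d_init D \<notin> inner_verts D" by (simp add: inner_verts_def)
  have nil: "W [] v \<longleftrightarrow> v = d_init D" for v
    using iv by (auto simp: W_def pre_digraph.awalk_def pre_digraph.cas.simps)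
  have snoc: "W (p @ [c e]) v \<longleftrightarrow> W p (e_tail e) \<and> c e \<in> arcs ?G \<and> e_head e = v" for p e v
    using iv by (auto simp: W_def pre_digraph.awalk_def cas_snoc tails)
  have snocE: "\<exists>q e. p = q @ [c e]" if "W p v" "p \<noteq> []" for p v
  proof -
    have "last p \<in> range c" using that last_in_set unfolding W_def by blast
    then show ?thesis using that(2) by (metis append_butlast_last_id rangeE)
  qed
  have "\<exists>p. length p = N \<and> (\<forall>q. W q v \<longleftrightarrow> q = p)"
    if "v \<in> insert (d_init D) (inner_verts D)" "r v = N" for N v
    using that
  proof (induction N arbitrary: v)
    case 0
    then have v: "v = d_init D" using arcs by force
    have "q = []" if q: "W q v" for q
    proof (rule ccontr)
      assume "q \<noteq> []"
      then obtain q' e where "q = q' @ [c e]" using snocE[OF q] by blast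
      then have "c e \<in> arcs ?G" "e_head e = v" using q snoc by simp_all
      then show False using heads[of e] v not_inner by simp
    qed
    then have "W q v \<longleftrightarrow> q = []" for q using nil v by blast
    then show ?case by (intro exI[of _ "[]"]) simp
  next
    case (Suc N)
    have vi: "v \<in> inner_verts D" using Suc.prems init(3) by auto
    from arcs[OF vi] obtain f where
      f: "\<And>f'. c f' \<in> arcs ?G \<and> e_head f' = v \<longleftrightarrow> f' = f"
        "e_tail f \<in> insert (d_init D) (inner_verts D)" "r v = Suc (r (e_tail f))" by blast
    have "r (e_tail f) = N" using f(3) Suc.prems(2) by simp
    from Suc.IH[OF f(2) this] obtain p where p: "length p = N" "\<And>q. W q (e_tail f) \<longleftrightarrow> q = p" by blast
    have "W q v \<longleftrightarrow> q = p @ [c f]" for q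
    proof
      assume q: "W q v"
      have "q \<noteq> []" using q nil[of v] vi not_inner by metis
      then obtain q' e where qe: "q = q' @ [c e]" using snocE[OF q] by blast
      then have s: "W q' (e_tail e)" "c e \<in> arcs ?G" "e_head e = v" using q snoc by simp_all
      then have "e = f" using f(1) by blast
      then show "q = p @ [c f]" using s(1) p(2) qe by blast
    next
      assume "q = p @ [c f]"
      moreover have "W p (e_tail f)" using p(2) by blast
      ultimately show "W q v" using snoc[of p f v] f(1)[of f] by blast
    qed
    then show ?case using p(1) by (intro exI[of _ "p @ [c f]"]) simp
  qed
  from this[OF v refl] obtain p where p: "length p = r v" "\<And>q. W q v \<longleftrightarrow> q = p" by blast
  then have "(THE p. W p v) = p" by (intro the_equality) blast+
  then show ?thesis using p(1) by (simp add: W_def)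
qed

text \<open>
  Reflection in a horizontal line reduces statements on lower edges to statements on upper edges.
\<close>

lemma bottommost_incoming_inverse: "bottommost_incoming D v e \<longleftrightarrow> topmost_incoming (d_inv D) v e"
proof -
  have "directly_above (d_inv D) = (directly_above D)\<inverse>" by (force simp: directly_above_image)
  then show ?thesis by (simp add: bottommost_incoming_def topmost_incoming_def rtrancl_converse)
qed

lemma forest_ends:
  assumes "forest D"
  shows "d_init D \<in> d_verts D" "d_term D \<in> d_verts D" "d_init D \<noteq> d_term D"
proof -
  note b = forest_basic[OF assms]
  show "d_init D \<in> d_verts D" using b(8) by simp
  show "d_term D \<in> d_verts D" using epath_last_vertex[OF b(4)] b(8) by simp
  have "d_term D = e_head (last (d_bot D))" using epath_ends[OF b(4,3)] by simp
  then show "d_init D \<noteq> d_term D" using b(3,5) by (metis distinct.simps(2) last_in_set list.set_map imageI)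
qed

lemma creating_edge_facts:
  assumes P: "forest P" and top: "d_top P = [e0]" and c: "([e], [f, g]) \<in> d_cells P"
    and p: "pos (d_term P) = 1"
    and int: "\<And>e a b. e \<in> d_edges P \<Longrightarrow> edge_interval P e a b \<longleftrightarrow> a = pos (e_tail e) \<and> b = pos (e_head e)"
  shows "f \<in> d_edges P" "e_tail f \<in> d_verts P - {d_term P}"
proof -
  show f: "f \<in> d_edges P" using forest_cellD[OF P c] by auto
  then have "edge_interval P f (pos (e_tail f)) (pos (e_head f))" using int by blast
  then obtain k m where "m < 2 ^ k" "pos (e_tail f) = real m / 2 ^ k"
    using edge_interval_standard by blast
  then have "pos (e_tail f) \<in> unit_dyadics" by (auto simp: unit_dyadics_def)
  then have "pos (e_tail f) < 1" using unit_dyadics_bounds by blast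
  then show "e_tail f \<in> d_verts P - {d_term P}" using p edge_verts[OF f] by auto
qed

lemma product_verts:
  assumes P: "forest P" and Q: "forest Q" and m: "multipliable P (d_inv Q)"
  shows "d_verts (d_mult P (d_inv Q)) = d_verts P" "d_init (d_mult P (d_inv Q)) = d_init P"
    "d_term (d_mult P (d_inv Q)) = d_term P" "d_verts Q = d_verts P" "d_init Q = d_init P" "d_term Q = d_term P"
proof -
  have bot: "d_bot P = d_bot Q" using m by (simp add: multipliable_def)
  show i: "d_init Q = d_init P" "d_term Q = d_term P"
    using forest_init_term[OF P] forest_init_term[OF Q] bot by (simp_all add: d_init_def d_term_def)
  show "d_verts Q = d_verts P" using forest_basic(8)[OF P] forest_basic(8)[OF Q] bot i by simp
  then show "d_verts (d_mult P (d_inv Q)) = d_verts P" by (simp add: d_verts_mult)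
  show "d_init (d_mult P (d_inv Q)) = d_init P" "d_term (d_mult P (d_inv Q)) = d_term P"
    by (simp_all add: d_init_def d_term_def)
qed

lemma multipliable_swap: "multipliable P (d_inv Q) \<Longrightarrow> multipliable Q (d_inv P)"
  by (simp add: multipliable_def Int_commute)

text \<open>
  The tail of the top-most incoming edge is the vertex with the last digit \<open>1\<close> of its position erased,
  so the path to \<open>v\<close> spells out the digits \<open>1\<close> of the position of \<open>v\<close>.
\<close>

lemma length_top_path:
  assumes P: "forest P" and Q: "forest Q" and top: "d_top P = [e0]" and m: "multipliable P (d_inv Q)"
    and v: "v \<in> inner_verts (d_mult P (d_inv Q))"
    and pos: "pos (d_init P) = 0" "pos (d_term P) = 1"
      "\<And>e a b. e \<in> d_edges P \<Longrightarrow> edge_interval P e a b \<longleftrightarrow> a = pos (e_tail e) \<and> b = pos (e_head e)"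
      "\<And>e f g. ([e], [f, g]) \<in> d_cells P \<Longrightarrow> dyadic_sum (pos (e_head f)) = Suc (dyadic_sum (pos (e_tail f)))"
  shows "length (top_path (d_mult P (d_inv Q)) v) = dyadic_sum (pos v)"
  unfolding top_path_def
proof (rule walk_length_from_init)
  let ?D = "d_mult P (d_inv Q)"
  note pv = product_verts[OF P Q m]
  show "d_init ?D \<in> d_verts ?D" "d_init ?D \<noteq> d_term ?D" using forest_ends[OF P] pv by simp_all
  show "dyadic_sum (pos (d_init ?D)) = 0" using pos(1) pv by simp
  have upper: "Upper e \<in> arcs (thompson_graph ?D) \<longleftrightarrow> (\<exists>v\<in>inner_verts ?D. topmost_incoming ?D v e)" for e
    by (rule upper_arc_iff)
  show "e_head e \<in> inner_verts ?D" if "Upper e \<in> arcs (thompson_graph ?D)" for e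
    using that by (auto simp: upper topmost_incoming_def)
  fix u assume u: "u \<in> inner_verts ?D"
  from topmost_incoming_product[OF P Q top m u] obtain e f g where
    f: "([e], [f, g]) \<in> d_cells P" "e_head f = u" "\<And>f'. topmost_incoming ?D u f' \<longleftrightarrow> f' = f" by blast
  have "Upper f' \<in> arcs (thompson_graph ?D) \<and> e_head f' = u \<longleftrightarrow> f' = f" for f'
    using u f(2) f(3)[of f'] unfolding upper topmost_incoming_def by blast
  moreover have "e_tail f \<in> insert (d_init ?D) (inner_verts ?D)"
    using creating_edge_facts(2)[OF P top f(1) pos(2,3)] pv by (simp add: inner_verts_def)
  moreover have "dyadic_sum (pos u) = Suc (dyadic_sum (pos (e_tail f)))" using pos(4)[OF f(1)] f(2) by simp
  ultimately show "\<exists>f. (\<forall>f'. Upper f' \<in> arcs (thompson_graph ?D) \<and> e_head f' = u \<longleftrightarrow> f' = f) \<and>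
        e_tail f \<in> insert (d_init ?D) (inner_verts ?D) \<and> dyadic_sum (pos u) = Suc (dyadic_sum (pos (e_tail f)))"
    by blast
qed (use v in simp_all)

lemma length_bottom_path:
  assumes P: "forest P" and Q: "forest Q" and top: "d_top Q = [e0]" and m: "multipliable P (d_inv Q)"
    and v: "v \<in> inner_verts (d_mult P (d_inv Q))"
    and pos: "pos (d_init Q) = 0" "pos (d_term Q) = 1"
      "\<And>e a b. e \<in> d_edges Q \<Longrightarrow> edge_interval Q e a b \<longleftrightarrow> a = pos (e_tail e) \<and> b = pos (e_head e)"
      "\<And>e f g. ([e], [f, g]) \<in> d_cells Q \<Longrightarrow> dyadic_sum (pos (e_head f)) = Suc (dyadic_sum (pos (e_tail f)))"
  shows "length (bottom_path (d_mult P (d_inv Q)) v) = dyadic_sum (pos v)"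
  unfolding bottom_path_def
proof (rule walk_length_from_init)
  let ?D = "d_mult P (d_inv Q)"
  let ?E = "d_mult Q (d_inv P)"
  note pv = product_verts[OF P Q m]
  have mE: "multipliable Q (d_inv P)" by (rule multipliable_swap[OF m])
  note pE = product_verts[OF Q P mE]
  have E: "d_inv ?D = ?E" by (simp add: d_inv_def d_mult_def Un_commute converse_Un)
  have inner: "inner_verts ?E = inner_verts ?D" using pv pE(1-3) by (simp add: inner_verts_def)
  show "d_init ?D \<in> d_verts ?D" "d_init ?D \<noteq> d_term ?D" using forest_ends[OF P] pv by simp_all
  show "dyadic_sum (pos (d_init ?D)) = 0" using pos(1) pv by simp
  have lower: "Lower e \<in> arcs (thompson_graph ?D) \<longleftrightarrow> (\<exists>v\<in>inner_verts ?D. topmost_incoming ?E v e)" for e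
    by (simp only: lower_arc_iff bottommost_incoming_inverse E)
  have edges: "d_edges ?E = d_edges ?D" by auto
  show "e_head e \<in> inner_verts ?D" if "Lower e \<in> arcs (thompson_graph ?D)" for e
    using that by (auto simp: lower topmost_incoming_def)
  fix u assume u: "u \<in> inner_verts ?D"
  then have uE: "u \<in> inner_verts ?E" using inner by simp
  from topmost_incoming_product[OF Q P top mE uE] obtain e f g where
    f: "([e], [f, g]) \<in> d_cells Q" "e_head f = u" "\<And>f'. topmost_incoming ?E u f' \<longleftrightarrow> f' = f" by blast
  have "Lower f' \<in> arcs (thompson_graph ?D) \<and> e_head f' = u \<longleftrightarrow> f' = f" for f'
    using u f(2) f(3)[of f'] unfolding lower topmost_incoming_def by blast
  moreover have "e_tail f \<in> insert (d_init ?D) (inner_verts ?D)"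
    using creating_edge_facts(2)[OF Q top f(1) pos(2,3)] pv by (simp add: inner_verts_def)
  moreover have "dyadic_sum (pos u) = Suc (dyadic_sum (pos (e_tail f)))" using pos(4)[OF f(1)] f(2) by simp
  ultimately show "\<exists>f. (\<forall>f'. Lower f' \<in> arcs (thompson_graph ?D) \<and> e_head f' = u \<longleftrightarrow> f' = f) \<and>
        e_tail f \<in> insert (d_init ?D) (inner_verts ?D) \<and> dyadic_sum (pos u) = Suc (dyadic_sum (pos (e_tail f)))"
    by blast
qed (use v in simp_all)

text \<open>
  The top and the bottom path of a vertex measure the digit sums of its positions in the two
  subdivisions. Each vertex other than the last one is the tail of an edge of the common path, and
  the initial vertex has position \<open>0\<close> in both.
\<close>

theorem n_good_iff:
  assumes P: "forest P" and Q: "forest Q" and topP: "d_top P = [e1]" and topQ: "d_top Q = [e2]"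
    and m: "multipliable P (d_inv Q)"
  shows "n_good n (d_mult P (d_inv Q)) \<longleftrightarrow>
    (\<forall>e\<in>set (d_bot P). \<forall>a b c d. edge_interval P e a b \<longrightarrow> edge_interval Q e c d \<longrightarrow>
      [dyadic_sum a = dyadic_sum c] (mod n))"
proof -
  let ?D = "d_mult P (d_inv Q)"
  obtain p where p: "p (d_init P) = 0" "p (d_term P) = 1"
      "\<And>e a b. e \<in> d_edges P \<Longrightarrow> edge_interval P e a b \<longleftrightarrow> a = p (e_tail e) \<and> b = p (e_head e)"
      "\<And>e f g. ([e], [f, g]) \<in> d_cells P \<Longrightarrow> dyadic_sum (p (e_head f)) = Suc (dyadic_sum (p (e_tail f)))"
    by (rule forest_positions[OF P topP]) (rule that)
  obtain q where q: "q (d_init Q) = 0" "q (d_term Q) = 1"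
      "\<And>e a b. e \<in> d_edges Q \<Longrightarrow> edge_interval Q e a b \<longleftrightarrow> a = q (e_tail e) \<and> b = q (e_head e)"
      "\<And>e f g. ([e], [f, g]) \<in> d_cells Q \<Longrightarrow> dyadic_sum (q (e_head f)) = Suc (dyadic_sum (q (e_tail f)))"
    by (rule forest_positions[OF Q topQ]) (rule that)
  note pv = product_verts[OF P Q m]
  note bP = forest_basic[OF P]
  have bot: "d_bot P = d_bot Q" using m by (simp add: multipliable_def)
  have edges: "e \<in> d_edges P" "e \<in> d_edges Q" if "e \<in> set (d_bot P)" for e
    using that bP(7) forest_basic(7)[OF Q] bot by auto
  have good: "n_good n ?D \<longleftrightarrow> (\<forall>v\<in>inner_verts ?D. [dyadic_sum (p v) = dyadic_sum (q v)] (mod n))"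
    unfolding n_good_def
    using length_top_path[OF P Q topP m _ p] length_bottom_path[OF P Q topQ m _ q] by simp
  have "(\<forall>v\<in>inner_verts ?D. [dyadic_sum (p v) = dyadic_sum (q v)] (mod n)) \<longleftrightarrow>
    (\<forall>e\<in>set (d_bot P). [dyadic_sum (p (e_tail e)) = dyadic_sum (q (e_tail e))] (mod n))"
  proof (intro iffI ballI)
    fix e assume h: "\<forall>v\<in>inner_verts ?D. [dyadic_sum (p v) = dyadic_sum (q v)] (mod n)" and e: "e \<in> set (d_bot P)"
    show "[dyadic_sum (p (e_tail e)) = dyadic_sum (q (e_tail e))] (mod n)"
    proof (cases "e_tail e = d_init P")
      case True
      then show ?thesis using p(1) q(1) pv(5) by simp
    next
      case False
      have "e_tail e \<noteq> d_term P" using epath_distinct_tail[OF bP(4,5) e] .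
      then have "e_tail e \<in> inner_verts ?D"
        using False edge_verts(1)[OF edges(1)[OF e]] pv by (simp add: inner_verts_def)
      then show ?thesis using h by blast
    qed
  next
    fix v assume h: "\<forall>e\<in>set (d_bot P). [dyadic_sum (p (e_tail e)) = dyadic_sum (q (e_tail e))] (mod n)"
      and v: "v \<in> inner_verts ?D"
    then have "v \<in> set (d_init P # map e_head (d_bot P))" "v \<noteq> d_term P"
      using pv bP(8) by (simp_all add: inner_verts_def)
    from epath_tail_exists[OF bP(4) this] show "[dyadic_sum (p v) = dyadic_sum (q v)] (mod n)" using h by blast
  qed
  also have "\<dots> \<longleftrightarrow> (\<forall>e\<in>set (d_bot P). \<forall>a b c d. edge_interval P e a b \<longrightarrow> edge_interval Q e c d \<longrightarrow>
      [dyadic_sum a = dyadic_sum c] (mod n))"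
    using edges p(3) q(3) by (intro ball_cong refl) simp
  finally show ?thesis using good by simp
qed

section \<open>The homeomorphism of a good diagram preserves digit sums\<close>

lemma epath_covers:
  fixes pos :: "nat \<Rightarrow> real"
  shows "epath u p v \<Longrightarrow> pos u \<le> x \<Longrightarrow> x < pos v \<Longrightarrow> \<exists>e\<in>set p. pos (e_tail e) \<le> x \<and> x < pos (e_head e)"
proof (induction p arbitrary: u)
  case (Cons e p)
  then show ?case by (cases "x < pos (e_head e)") auto
qed simp

lemma linear_imp_maps_standard:
  assumes "\<forall>x\<in>{real m / 2 ^ k..(real m + 1) / 2 ^ k}.
      f x = c + (d - c) / ((real m + 1) / 2 ^ k - real m / 2 ^ k) * (x - real m / 2 ^ k)"
    and "c = real m' / 2 ^ k'" "d = (real m' + 1) / 2 ^ k'"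
  shows "maps_standard f k m k' m'"
  unfolding maps_standard_def
proof
  fix y :: real assume y: "y \<in> {0..1}"
  have "(real m + y) / 2 ^ k \<in> {real m / 2 ^ k..(real m + 1) / 2 ^ k}" using y by (auto simp: divide_right_mono)
  then have "f ((real m + y) / 2 ^ k) = c + (d - c) / ((real m + 1) / 2 ^ k - real m / 2 ^ k) * ((real m + y) / 2 ^ k - real m / 2 ^ k)"
    using assms(1) by blast
  also have "(real m + 1) / 2 ^ k - real m / 2 ^ k = 1 / 2 ^ k" by (simp add: add_divide_distrib)
  also have "(real m + y) / 2 ^ k - real m / 2 ^ k = y / 2 ^ k" by (simp add: add_divide_distrib)
  also have "d - c = 1 / 2 ^ k'" by (simp add: assms add_divide_distrib)
  finally show "f ((real m + y) / 2 ^ k) = (real m' + y) / 2 ^ k'"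
    by (simp add: assms(2) add_divide_distrib)
qed

text \<open>
  The congruence at the break points given by \<open>n_good_iff\<close> spreads over the segments of the
  subdivision by \<open>dyadic_sum_cong_on_cell\<close>.
\<close>

lemma Jones_subgroup_subset: "Jones_subgroup n \<subseteq> digit_preserving n"
proof
  fix f assume "f \<in> Jones_subgroup n"
  then obtain D P N where f: "f \<in> thompson_homeos" and red: "reduced_diagram_in_F D" and good: "n_good n D"
    and split: "splits_as D P N"
    and homeo: "\<And>e. e \<in> set (d_bot P) \<Longrightarrow> \<exists>a b c d. edge_interval P e a b \<and> edge_interval (d_inv N) e c d \<and>
        (\<forall>x\<in>{a..b}. f x = c + (d - c) / (b - a) * (x - a))"
    unfolding Jones_subgroup_def diagram_homeo_def by auto
  define Q where "Q = d_inv N"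
  have N: "N = d_inv Q" by (simp add: Q_def)
  have P: "forest P" and Q: "forest Q"
    using split is_diagram_forest unfolding splits_as_def Q_def by blast+
  have D: "D = d_mult P (d_inv Q)" and m: "multipliable P (d_inv Q)"
    using split by (simp_all add: splits_as_def N)
  have "length (d_top P) = 1" "length (d_top Q) = 1"
    using red by (simp_all add: reduced_diagram_in_F_def D)
  then obtain e1 e2 where top: "d_top P = [e1]" "d_top Q = [e2]"
    by (metis One_nat_def length_0_conv length_Suc_conv)
  obtain p :: "nat \<Rightarrow> real" where p: "p (d_init P) = 0" "p (d_term P) = 1"
      "\<And>e a b. e \<in> d_edges P \<Longrightarrow> edge_interval P e a b \<longleftrightarrow> a = p (e_tail e) \<and> b = p (e_head e)"
    by (rule forest_positions[OF P top(1)]) (rule that)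
  note bP = forest_basic[OF P]
  have "[dyadic_sum (f x) = dyadic_sum x] (mod n)" if x: "x \<in> unit_dyadics" for x
  proof -
    have "p (d_init P) \<le> x" "x < p (d_term P)" using unit_dyadics_bounds[OF x] p by simp_all
    from epath_covers[where pos = p, OF bP(4) this] obtain e where
      e: "e \<in> set (d_bot P)" "p (e_tail e) \<le> x" "x < p (e_head e)" by blast
    from homeo[OF e(1)] obtain a b c d where I: "edge_interval P e a b" "edge_interval Q e c d"
      and lin: "\<forall>x\<in>{a..b}. f x = c + (d - c) / (b - a) * (x - a)" unfolding Q_def by blast
    have ab: "a = p (e_tail e)" "b = p (e_head e)" using p(3) I(1) bP(7) e(1) by blast+
    obtain k m where km: "a = real m / 2 ^ k" "b = (real m + 1) / 2 ^ k"
      using edge_interval_standard[OF I(1)] by blast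
    obtain k' m' where km': "c = real m' / 2 ^ k'" "d = (real m' + 1) / 2 ^ k'"
      using edge_interval_standard[OF I(2)] by blast
    have std: "maps_standard f k m k' m'"
      by (rule linear_imp_maps_standard[OF lin[unfolded km] km'])
    have "[dyadic_sum a = dyadic_sum c] (mod n)"
      using good e(1) I unfolding D n_good_iff[OF P Q top \<open>multipliable P (d_inv Q)\<close>] by blast
    then have "[bitsum m' = bitsum m] (mod n)" by (simp add: km km' cong_sym_eq)
    then show ?thesis using dyadic_sum_cong_on_cell[OF std _ x] e(2,3) ab km by simp
  qed
  then show "f \<in> digit_preserving n" using f by (simp add: digit_preserving_def)
qed

section \<open>The diagram of a dyadic subdivision\<close>

lemma d_verts_bounds:
  assumes "\<And>e. e \<in> d_edges D \<Longrightarrow> a \<le> e_tail e \<and> e_tail e < e_head e \<and> e_head e \<le> b"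
  shows "d_verts D \<subseteq> {a..b}"
proof
  fix x assume "x \<in> d_verts D"
  then obtain e where e: "e \<in> d_edges D" "x = e_tail e \<or> x = e_head e" unfolding d_verts_def by blast
  then show "x \<in> {a..b}" using assms[OF e(1)] by (elim disjE) simp_all
qed

text \<open>
  A dyadic subdivision is given by the standard intervals that need no further halving. They form a
  set closed under halving which contains all intervals of level \<open>M\<close>. The map \<open>\<nu>\<close> names
  vertices by positions; as names are shared between the two halves of a diagram, it is a parameter.
  Edges of intervals that are not halved get the tag \<open>0\<close> and all others the tag \<open>tag\<close>, so that two
  subdivisions with different tags can share only the former.
\<close>

locale dyadic_tree =
  fixes \<nu> :: "real \<Rightarrow> nat" and leaf :: "nat \<Rightarrow> nat \<Rightarrow> bool" and tag :: nat and M :: nat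
  assumes \<nu>_less: "\<And>i j. i < j \<Longrightarrow> j \<le> 2 ^ M \<Longrightarrow> \<nu> (real i / 2 ^ M) < \<nu> (real j / 2 ^ M)"
    and leaf_level: "\<And>m. m < 2 ^ M \<Longrightarrow> leaf M m"
    and leaf_left: "\<And>k m. leaf k m \<Longrightarrow> leaf (Suc k) (2 * m)"
    and leaf_right: "\<And>k m. leaf k m \<Longrightarrow> leaf (Suc k) (Suc (2 * m))"
    and tag: "tag \<noteq> 0"
begin

definition vertex :: "nat \<Rightarrow> nat \<Rightarrow> nat" where
  "vertex k m = \<nu> (real m / 2 ^ k)"

definition node_edge :: "nat \<Rightarrow> nat \<Rightarrow> edge" where
  "node_edge k m = (vertex k m, vertex k (Suc m), if leaf k m then 0 else tag)"

fun tree_diagram :: "nat \<Rightarrow> nat \<Rightarrow> nat \<Rightarrow> diagram" where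
  "tree_diagram 0 k m = \<lparr>d_edges = {node_edge k m}, d_cells = {}, d_top = [node_edge k m], d_bot = [node_edge k m]\<rparr>"
| "tree_diagram (Suc d) k m =
    (if leaf k m
     then \<lparr>d_edges = {node_edge k m}, d_cells = {}, d_top = [node_edge k m], d_bot = [node_edge k m]\<rparr>
     else d_mult
       \<lparr>d_edges = {node_edge k m, node_edge (Suc k) (2 * m), node_edge (Suc k) (Suc (2 * m))},
        d_cells = {([node_edge k m], [node_edge (Suc k) (2 * m), node_edge (Suc k) (Suc (2 * m))])},
        d_top = [node_edge k m], d_bot = [node_edge (Suc k) (2 * m), node_edge (Suc k) (Suc (2 * m))]\<rparr>
       (d_add (tree_diagram d (Suc k) (2 * m)) (tree_diagram d (Suc k) (Suc (2 * m)))))"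

lemma vertex_double: "vertex (Suc k) (2 * m) = vertex k m"
  by (simp add: vertex_def)

lemma vertex_shift: "vertex (k + j) (m * 2 ^ j) = vertex k m"
  by (simp add: vertex_def power_add)

lemma vertex_less:
  assumes "i < j" "j \<le> 2 ^ k" "k \<le> M"
  shows "vertex k i < vertex k j"
proof -
  obtain d where d: "M = k + d" using assms(3) le_Suc_ex by blast
  have "i * 2 ^ d < j * 2 ^ d" "j * 2 ^ d \<le> 2 ^ M" using assms(1,2) by (simp_all add: d power_add)
  from \<nu>_less[OF this] have "vertex (k + d) (i * 2 ^ d) < vertex (k + d) (j * 2 ^ d)"
    unfolding vertex_def d .
  then show ?thesis unfolding vertex_shift .
qed

lemma node_edge_simps [simp]:
  "e_tail (node_edge k m) = vertex k m" "e_head (node_edge k m) = vertex k (Suc m)"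
  by (simp_all add: node_edge_def)

definition tree_cells :: "(edge list \<times> edge list) set" where
  "tree_cells = {([node_edge k m], [node_edge (Suc k) (2 * m), node_edge (Suc k) (Suc (2 * m))]) | k m.
     k < M \<and> m < 2 ^ k \<and> \<not> leaf k m}"

text \<open>
  The interval number \<open>m'\<close> of level \<open>k'\<close> is contained in the interval number \<open>m\<close> of level \<open>k\<close>.
\<close>

definition descendant :: "nat \<Rightarrow> nat \<Rightarrow> nat \<Rightarrow> nat \<Rightarrow> bool" where
  "descendant k m k' m' \<longleftrightarrow> k \<le> k' \<and> m' div 2 ^ (k' - k) = m"

lemma descendant_self: "descendant k m k' m' \<Longrightarrow> k' \<le> k \<Longrightarrow> k' = k \<and> m' = m"
  by (simp add: descendant_def)

lemma descendant_child:
  assumes "descendant k m k' m'" "k \<noteq> k'"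
  shows "descendant (Suc k) (2 * m) k' m' \<or> descendant (Suc k) (Suc (2 * m)) k' m'"
proof -
  have k: "Suc k \<le> k'" using assms by (simp add: descendant_def)
  then have "(2::nat) ^ (k' - k) = 2 ^ (k' - Suc k) * 2" by (metis Suc_diff_le diff_Suc_Suc power_Suc2)
  then have "m' div 2 ^ (k' - Suc k) div 2 = m" using assms by (simp add: descendant_def div_mult2_eq)
  then show ?thesis using k unfolding descendant_def by linarith
qed

lemma descendant_leaf:
  assumes "descendant k m k' m'" "leaf k m"
  shows "leaf k' m'"
  using assms
proof (induction "k' - k" arbitrary: k m)
  case 0
  then show ?case using descendant_self by fastforce
next
  case (Suc d)
  then have "k \<noteq> k'" "d = k' - Suc k" by auto
  then show ?case
    using descendant_child[OF Suc.prems(1)] Suc.hyps(1) leaf_left[OF Suc.prems(2)] leaf_right[OF Suc.prems(2)]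
    by metis
qed

lemma descendant_parent:
  assumes "descendant k m k' m'" "k \<noteq> k'"
  shows "descendant k m (k' - 1) (m' div 2)"
proof -
  have lt: "k < k'" using assms by (simp add: descendant_def)
  then have "Suc (k' - 1 - k) = k' - k" by simp
  then have "m' div 2 ^ (k' - k) = m' div 2 div 2 ^ (k' - 1 - k)" by (metis div_mult2_eq power_Suc)
  then show ?thesis using assms lt by (simp add: descendant_def)
qed

lemma descendant_of_child:
  assumes "descendant (Suc k) c k' m'" "c div 2 = m"
  shows "descendant k m k' m'"
proof -
  have "Suc k \<le> k'" using assms by (simp add: descendant_def)
  then have "Suc (k' - Suc k) = k' - k" by simp
  then have "m' div 2 ^ (k' - k) = m' div 2 ^ (k' - Suc k) div 2" by (metis div_mult2_eq power_Suc2)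
  then show ?thesis using assms by (simp add: descendant_def)
qed

text \<open>
  The intervals of the subdivision inside the given one: maximal among those that are not halved.
\<close>

definition tree_leaf :: "nat \<Rightarrow> nat \<Rightarrow> nat \<Rightarrow> nat \<Rightarrow> bool" where
  "tree_leaf k m k' m' \<longleftrightarrow> descendant k m k' m' \<and> leaf k' m' \<and> (k' = k \<or> \<not> leaf (k' - 1) (m' div 2))"

lemma leaf_node_bottom:
  assumes "leaf k m"
  shows "tree_leaf k m k' m' \<longleftrightarrow> k' = k \<and> m' = m"
proof
  assume l: "tree_leaf k m k' m'"
  have "k' = k"
  proof (rule ccontr)
    assume "k' \<noteq> k"
    then have "descendant k m (k' - 1) (m' div 2)" "\<not> leaf (k' - 1) (m' div 2)"
      using l descendant_parent by (auto simp: tree_leaf_def)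
    then show False using descendant_leaf assms by blast
  qed
  then show "k' = k \<and> m' = m" using l by (simp add: tree_leaf_def descendant_def)
qed (use assms in \<open>simp add: tree_leaf_def descendant_def\<close>)

lemma inner_node_bottom:
  assumes "\<not> leaf k m"
  shows "tree_leaf k m k' m' \<longleftrightarrow> tree_leaf (Suc k) (2 * m) k' m' \<or> tree_leaf (Suc k) (Suc (2 * m)) k' m'"
proof
  assume l: "tree_leaf k m k' m'"
  then have ne: "k \<noteq> k'" using assms by (auto simp: tree_leaf_def descendant_def)
  have "k' = Suc k \<or> \<not> leaf (k' - 1) (m' div 2)" using l ne by (simp add: tree_leaf_def)
  then show "tree_leaf (Suc k) (2 * m) k' m' \<or> tree_leaf (Suc k) (Suc (2 * m)) k' m'"
    using l descendant_child[of k m k' m'] ne by (auto simp: tree_leaf_def)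
next
  assume l: "tree_leaf (Suc k) (2 * m) k' m' \<or> tree_leaf (Suc k) (Suc (2 * m)) k' m'"
  then have d: "descendant k m k' m'" using descendant_of_child by (auto simp: tree_leaf_def)
  have "\<not> leaf (k' - 1) (m' div 2)"
  proof (cases "k' = Suc k")
    case True
    then have "m' div 2 = m" using l by (auto simp: tree_leaf_def descendant_def)
    then show ?thesis using assms True by simp
  next
    case False
    then show ?thesis using l by (auto simp: tree_leaf_def)
  qed
  then show "tree_leaf k m k' m'" using l d by (auto simp: tree_leaf_def)
qed

text \<open>
  The bounds on the edges keep the diagrams of the two halves of an interval apart, which is what sums and
  products of diagrams require; they also make every edge increase vertex names.
\<close>

lemma tree_diagram_structure:
  assumes "k + d = M" "m < 2 ^ k"
  shows "is_diagram (tree_diagram d k m) \<and>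
    d_top (tree_diagram d k m) = [node_edge k m] \<and>
    node_edge k m \<in> d_edges (tree_diagram d k m) \<and>
    set (d_bot (tree_diagram d k m)) \<subseteq> d_edges (tree_diagram d k m) \<and>
    (\<forall>e\<in>d_edges (tree_diagram d k m). vertex k m \<le> e_tail e \<and> e_tail e < e_head e \<and>
        e_head e \<le> vertex k (Suc m) \<and> snd (snd e) \<in> {0, tag} \<and>
        (snd (snd e) = 0 \<longrightarrow> e \<in> set (d_bot (tree_diagram d k m)))) \<and>
    d_cells (tree_diagram d k m) \<subseteq> tree_cells \<and>
    sorted_wrt (<) (map e_tail (d_bot (tree_diagram d k m))) \<and>
    set (d_bot (tree_diagram d k m)) = {node_edge k' m' | k' m'. tree_leaf k m k' m'}"
  (is "?S d k m")
  using assms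
proof (induction d arbitrary: k m)
  case 0
  have "vertex k m < vertex k (Suc m)" using 0 by (intro vertex_less) auto
  moreover have "leaf k m" using leaf_level 0 by simp
  ultimately show ?case
    using leaf_node_bottom[OF \<open>leaf k m\<close>] is_diagram.edge[of "vertex k m" "vertex k (Suc m)" 0]
    by (auto simp: node_edge_def)
next
  case (Suc d)
  let ?l = "2 * m" and ?r = "Suc (2 * m)"
  have lt: "vertex k m < vertex k (Suc m)" using Suc.prems by (intro vertex_less) auto
  show ?case
  proof (cases "leaf k m")
    case True
    then show ?thesis
      using lt leaf_node_bottom[OF True] is_diagram.edge[of "vertex k m" "vertex k (Suc m)" 0]
      by (auto simp: node_edge_def)
  next
    case False
    have lr: "?l < 2 ^ Suc k" "?r < 2 ^ Suc k" using Suc.prems(2) by simp_all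
    have kd: "Suc k + d = M" using Suc.prems(1) by simp
    define L where "L = tree_diagram d (Suc k) ?l"
    define R where "R = tree_diagram d (Suc k) ?r"
    have sL: "?S d (Suc k) ?l" and sR: "?S d (Suc k) ?r" using Suc.IH[OF kd] lr by blast+
    define u w v where "u = vertex k m" and "w = vertex (Suc k) ?r" and "v = vertex k (Suc m)"
    have ends: "vertex (Suc k) ?l = u" "vertex (Suc k) (Suc ?l) = w" "vertex (Suc k) (Suc ?r) = v"
      using vertex_double[of k m] vertex_double[of k "Suc m"] by (simp_all add: u_def w_def v_def)
    have uw: "u < w" "w < v"
      using vertex_less[of ?l ?r "Suc k"] vertex_less[of ?r "Suc ?r" "Suc k"] lr kd ends by simp_all
    let ?E = "node_edge k m" and ?El = "node_edge (Suc k) ?l" and ?Er = "node_edge (Suc k) ?r"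
    have E: "e_tail ?E = u" "e_head ?E = v" "e_tail ?El = u" "e_head ?El = w" "e_tail ?Er = w" "e_head ?Er = v"
      using ends by (simp_all add: u_def v_def)
    have diagL: "is_diagram L" "d_top L = [?El]" "?El \<in> d_edges L" "set (d_bot L) \<subseteq> d_edges L"
        "d_cells L \<subseteq> tree_cells" "sorted_wrt (<) (map e_tail (d_bot L))"
        "set (d_bot L) = {node_edge k' m' | k' m'. tree_leaf (Suc k) ?l k' m'}"
      and edgesL: "\<And>e. e \<in> d_edges L \<Longrightarrow> u \<le> e_tail e \<and> e_tail e < e_head e \<and> e_head e \<le> w \<and>
        snd (snd e) \<in> {0, tag} \<and> (snd (snd e) = 0 \<longrightarrow> e \<in> set (d_bot L))"
      using sL unfolding L_def[symmetric] ends by blast+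
    have diagR: "is_diagram R" "d_top R = [?Er]" "?Er \<in> d_edges R" "set (d_bot R) \<subseteq> d_edges R"
        "d_cells R \<subseteq> tree_cells" "sorted_wrt (<) (map e_tail (d_bot R))"
        "set (d_bot R) = {node_edge k' m' | k' m'. tree_leaf (Suc k) ?r k' m'}"
      and edgesR: "\<And>e. e \<in> d_edges R \<Longrightarrow> w \<le> e_tail e \<and> e_tail e < e_head e \<and> e_head e \<le> v \<and>
        snd (snd e) \<in> {0, tag} \<and> (snd (snd e) = 0 \<longrightarrow> e \<in> set (d_bot R))"
      using sR unfolding R_def[symmetric] w_def[symmetric] ends by blast+
    have vertsL: "d_verts L \<subseteq> {u..w}" by (rule d_verts_bounds) (use edgesL in blast)
    have vertsR: "d_verts R \<subseteq> {w..v}" by (rule d_verts_bounds) (use edgesR in blast)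
    have uwL: "u \<in> d_verts L" "w \<in> d_verts L" using edge_verts[OF diagL(3)] E(3,4) by simp_all
    have wvR: "w \<in> d_verts R" "v \<in> d_verts R" using edge_verts[OF diagR(3)] E(5,6) by simp_all
    have "x = w" if "x \<in> d_verts L" "x \<in> d_verts R" for x
      using subsetD[OF vertsL that(1)] subsetD[OF vertsR that(2)] by simp
    then have "d_verts L \<inter> d_verts R = {w}" using uwL wvR by blast
    then have add: "addable L R"
      using diagL(2) diagR(2) E by (simp add: addable_def d_init_def d_term_def)
    define A where "A = d_add L R"
    have diagA: "is_diagram A" unfolding A_def by (rule is_diagram.add[OF diagL(1) diagR(1) add])
    let ?C = "\<lparr>d_edges = {?E, ?El, ?Er}, d_cells = {([?E], [?El, ?Er])}, d_top = [?E], d_bot = [?El, ?Er]\<rparr>"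
    have C: "is_diagram ?C"
    proof -
      have "?E = (u, v, snd (snd ?E))" "?El = (u, w, snd (snd ?El))" "?Er = (w, v, snd (snd ?Er))"
        using ends by (simp_all add: node_edge_def u_def v_def w_def)
      moreover have "distinct [u, w, v]" using uw by auto
      ultimately show ?thesis using is_diagram.cell[of u w v] by metis
    qed
    have En: "?E \<notin> d_edges A" using edgesL[of ?E] edgesR[of ?E] E uw by (auto simp: A_def)
    have mult: "multipliable ?C A"
      unfolding multipliable_def
    proof (intro conjI)
      show "d_bot ?C = d_top A" using diagL(2) diagR(2) by (simp add: A_def)
      show "d_edges ?C \<inter> d_edges A = set (d_bot ?C)" using En diagL(3) diagR(3) by (auto simp: A_def)
      have "d_verts ?C = {u, w, v}" using E by auto
      then show "d_verts ?C \<inter> d_verts A = e_tail ` set (d_bot ?C) \<union> e_head ` set (d_bot ?C)"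
        using E uwL wvR by (auto simp: A_def d_verts_add)
    qed
    have T: "tree_diagram (Suc d) k m = d_mult ?C A" using False by (simp add: A_def L_def R_def)
    have botA: "d_bot (d_mult ?C A) = d_bot L @ d_bot R" by (simp add: A_def)
    have tagE: "snd (snd ?E) = tag" using False by (simp add: node_edge_def)
    have edge: "vertex k m \<le> e_tail e \<and> e_tail e < e_head e \<and> e_head e \<le> vertex k (Suc m) \<and>
        snd (snd e) \<in> {0, tag} \<and> (snd (snd e) = 0 \<longrightarrow> e \<in> set (d_bot (d_mult ?C A)))"
      if "e \<in> d_edges (d_mult ?C A)" for e
    proof -
      have "e = ?E \<or> e \<in> d_edges L \<or> e \<in> d_edges R" using that diagL(3) diagR(3) by (auto simp: A_def)
      then show ?thesis
      proof (elim disjE)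
        assume "e = ?E"
        then show ?thesis using tagE tag E uw by (simp add: lt)
      next
        assume "e \<in> d_edges L"
        from edgesL[OF this] show ?thesis unfolding botA u_def[symmetric] v_def[symmetric] using uw by auto
      next
        assume "e \<in> d_edges R"
        from edgesR[OF this] show ?thesis unfolding botA u_def[symmetric] v_def[symmetric] using uw by auto
      qed
    qed
    have "sorted_wrt (<) (map e_tail (d_bot L @ d_bot R))"
    proof -
      have "e_tail x < e_tail y" if "x \<in> set (d_bot L)" "y \<in> set (d_bot R)" for x y
        using edgesL[of x] edgesR[of y] that diagL(4) diagR(4) by fastforce
      then show ?thesis using diagL(6) diagR(6) by (auto simp: sorted_wrt_append)
    qed
    moreover have "set (d_bot L @ d_bot R) = {node_edge k' m' | k' m'. tree_leaf k m k' m'}"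
      using diagL(7) diagR(7) unfolding inner_node_bottom[OF False] by auto
    moreover have "d_cells (d_mult ?C A) \<subseteq> tree_cells"
    proof -
      have "k < M" using kd by simp
      then have "([?E], [?El, ?Er]) \<in> tree_cells"
        unfolding tree_cells_def using False Suc.prems(2) by blast
      then show ?thesis using diagL(5) diagR(5) by (simp add: A_def)
    qed
    moreover have "set (d_bot (d_mult ?C A)) \<subseteq> d_edges (d_mult ?C A)"
      using diagL(4) diagR(4) by (auto simp: A_def)
    moreover have "is_diagram (d_mult ?C A)" by (rule is_diagram.mult[OF C diagA mult])
    ultimately show ?thesis unfolding T using edge botA by simp
  qed
qed

lemma tree_leaf_level:
  assumes "tree_leaf k m k' m'" "k \<le> M" "m < 2 ^ k"
  shows "k' \<le> M" "m' < 2 ^ k'"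
proof -
  have d: "k \<le> k'" "m' div 2 ^ (k' - k) = m" using assms(1) by (auto simp: tree_leaf_def descendant_def)
  have "m' < 2 ^ (k' - k) * Suc m"
    using d(2) by (metis Suc_le_eq div_less_iff_less_mult lessI mult.commute zero_less_numeral zero_less_power)
  also have "\<dots> \<le> 2 ^ (k' - k) * 2 ^ k" using assms(3) by (intro mult_le_mono2) simp
  also have "\<dots> = 2 ^ k'" using d(1) by (simp add: power_add[symmetric])
  finally show m': "m' < 2 ^ k'" .
  show "k' \<le> M"
  proof (rule ccontr)
    assume "\<not> k' \<le> M"
    then have k': "M < k'" by simp
    then have n: "\<not> leaf (k' - 1) (m' div 2)" using assms by (auto simp: tree_leaf_def)
    define a where "a = (m' div 2) div 2 ^ (k' - 1 - M)"
    have "m' div 2 < 2 ^ (k' - 1)" using m' k' by (cases k') auto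
    moreover have "(2::nat) ^ (k' - 1) = 2 ^ M * 2 ^ (k' - 1 - M)" using k' by (simp add: power_add[symmetric])
    ultimately have "a < 2 ^ M" unfolding a_def by (simp add: less_mult_imp_div_less)
    moreover have "descendant M a (k' - 1) (m' div 2)" using k' by (simp add: descendant_def a_def)
    ultimately show False using n leaf_level descendant_leaf by blast
  qed
qed

lemma tree_diagram_interval:
  assumes "d_cells (tree_diagram d k m) \<subseteq> d_cells W" "edge_interval W (node_edge k m) (real m / 2 ^ k) ((real m + 1) / 2 ^ k)"
    and "e \<in> set (d_bot (tree_diagram d k m))" "k + d = M" "m < 2 ^ k"
  shows "\<exists>k' m'. tree_leaf k m k' m' \<and> e = node_edge k' m' \<and>
    edge_interval W e (real m' / 2 ^ k') ((real m' + 1) / 2 ^ k')"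
  using assms
proof (induction d arbitrary: k m)
  case 0
  then have "leaf k m" using leaf_level by simp
  then show ?case using 0 leaf_node_bottom by auto
next
  case (Suc d)
  show ?case
  proof (cases "leaf k m")
    case True
    then show ?thesis using Suc.prems leaf_node_bottom by auto
  next
    case False
    let ?El = "node_edge (Suc k) (2 * m)" and ?Er = "node_edge (Suc k) (Suc (2 * m))"
    have cell: "([node_edge k m], [?El, ?Er]) \<in> d_cells W" using Suc.prems(1) False by auto
    have mid: "(real m / 2 ^ k + (real m + 1) / 2 ^ k) / 2 = (real (2 * m) + 1) / 2 ^ Suc k"
      "real m / 2 ^ k = real (2 * m) / 2 ^ Suc k" "(real m + 1) / 2 ^ k = (real (Suc (2 * m)) + 1) / 2 ^ Suc k"
      "(real m / 2 ^ k + (real m + 1) / 2 ^ k) / 2 = real (Suc (2 * m)) / 2 ^ Suc k"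
      by (simp_all add: field_simps)
    have l: "edge_interval W ?El (real (2 * m) / 2 ^ Suc k) ((real (2 * m) + 1) / 2 ^ Suc k)"
      using edge_interval.left[OF Suc.prems(2) cell] unfolding mid(1) unfolding mid(2) .
    have r: "edge_interval W ?Er (real (Suc (2 * m)) / 2 ^ Suc k) ((real (Suc (2 * m)) + 1) / 2 ^ Suc k)"
      using edge_interval.right[OF Suc.prems(2) cell] unfolding mid(4) unfolding mid(3) .
    have kd: "Suc k + d = M" "2 * m < 2 ^ Suc k" "Suc (2 * m) < 2 ^ Suc k" using Suc.prems by simp_all
    have sub: "d_cells (tree_diagram d (Suc k) (2 * m)) \<subseteq> d_cells W"
      "d_cells (tree_diagram d (Suc k) (Suc (2 * m))) \<subseteq> d_cells W"
      using Suc.prems(1) False by auto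
    have "e \<in> set (d_bot (tree_diagram d (Suc k) (2 * m))) \<or> e \<in> set (d_bot (tree_diagram d (Suc k) (Suc (2 * m))))"
      using Suc.prems(3) False by auto
    then show ?thesis
      using Suc.IH[OF sub(1) l _ kd(1,2)] Suc.IH[OF sub(2) r _ kd(1,3)] inner_node_bottom[OF False] by blast
  qed
qed

definition whole :: diagram where "whole = tree_diagram M 0 0"

lemma whole_facts:
  shows "is_diagram whole" "d_top whole = [node_edge 0 0]" "set (d_bot whole) \<subseteq> d_edges whole"
    "d_cells whole \<subseteq> tree_cells" "sorted_wrt (<) (map e_tail (d_bot whole))"
    "set (d_bot whole) = {node_edge k m | k m. tree_leaf 0 0 k m}"
    "\<And>e. e \<in> d_edges whole \<Longrightarrow> e_tail e < e_head e"
    "\<And>e. e \<in> d_edges whole \<Longrightarrow> snd (snd e) \<in> {0, tag}"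
    "\<And>e. e \<in> d_edges whole \<Longrightarrow> snd (snd e) = 0 \<Longrightarrow> e \<in> set (d_bot whole)"
proof -
  have "0 + M = M" "(0::nat) < 2 ^ 0" by simp_all
  note S = tree_diagram_structure[OF this, folded whole_def]
  from S show "is_diagram whole" "d_top whole = [node_edge 0 0]" "set (d_bot whole) \<subseteq> d_edges whole"
    "d_cells whole \<subseteq> tree_cells" "sorted_wrt (<) (map e_tail (d_bot whole))"
    "set (d_bot whole) = {node_edge k m | k m. tree_leaf 0 0 k m}" by blast+
  from S show "e_tail e < e_head e" "snd (snd e) \<in> {0, tag}"
    "snd (snd e) = 0 \<Longrightarrow> e \<in> set (d_bot whole)" if "e \<in> d_edges whole" for e
    using that by blast+
qed

lemma whole_interval:
  assumes "e \<in> set (d_bot whole)"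
  obtains k m where "tree_leaf 0 0 k m" "e = node_edge k m"
    "edge_interval whole e (real m / 2 ^ k) ((real m + 1) / 2 ^ k)"
proof -
  have "edge_interval whole (node_edge 0 0) (real 0 / 2 ^ 0) ((real 0 + 1) / 2 ^ 0)"
    using edge_interval.top[OF whole_facts(2)] by simp
  from tree_diagram_interval[of M 0 0, folded whole_def, OF order_refl this assms]
  have "\<exists>k m. tree_leaf 0 0 k m \<and> e = node_edge k m \<and>
    edge_interval whole e (real m / 2 ^ k) ((real m + 1) / 2 ^ k)" by simp
  then show ?thesis using that by blast
qed

lemma tree_leaf_root: "tree_leaf 0 0 k m \<longleftrightarrow> m < 2 ^ k \<and> leaf k m \<and> (k = 0 \<or> \<not> leaf (k - 1) (m div 2))"
  unfolding tree_leaf_def descendant_def by (simp add: div_eq_0_iff)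

end

section \<open>The reduced diagram of an element of the group\<close>

lemma sorted_key_unique:
  fixes g :: "'a \<Rightarrow> nat"
  assumes "sorted_wrt (<) (map g xs)" "sorted_wrt (<) (map g ys)" "set xs = set ys"
  shows "xs = ys"
proof -
  have "set (map g xs) = set (map g ys)" using assms(3) by simp
  then have "map g xs = map g ys" using strict_sorted_equal assms(1,2) by metis
  moreover have "distinct (map g xs)" using assms(1) by (simp only: strict_sorted_iff)
  then have "inj_on g (set xs \<union> set ys)" using assms(3) by (simp add: distinct_map)
  ultimately show ?thesis by (rule map_inj_on)
qed

lemma cas_d_graph: "pre_digraph.cas (d_graph D) u p v \<longleftrightarrow> epath u p v"
  by (induction p arbitrary: u) (simp_all add: pre_digraph.cas.simps d_graph_def)

lemma epath_increasing:
  "epath u p v \<Longrightarrow> (\<And>e. e \<in> set p \<Longrightarrow> e_tail e < e_head e) \<Longrightarrow> sorted_wrt (<) (u # map e_head p)"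
proof (induction p arbitrary: u)
  case (Cons e p)
  have "sorted_wrt (<) (e_head e # map e_head p)" using Cons.prems by (intro Cons.IH) auto
  moreover have "u < e_head e" using Cons.prems(1) Cons.prems(2)[of e] by simp
  ultimately show ?case by auto
qed simp

text \<open>
  Every positive path visits an increasing sequence of vertices, and the path along which the two
  halves are glued visits all of them.
\<close>

lemma bottom_path_is_longest:
  assumes P: "forest P" and Q: "forest Q" and m: "multipliable P (d_inv Q)"
    and inc: "\<And>e. e \<in> d_edges P \<union> d_edges Q \<Longrightarrow> e_tail e < e_head e"
  shows "longest_positive_path (d_mult P (d_inv Q)) (d_bot P)"
proof -
  let ?D = "d_mult P (d_inv Q)"
  note pv = product_verts[OF P Q m] and b = forest_basic[OF P]
  have walk: "pre_digraph.awalk (d_graph ?D) (d_init ?D) q (d_term ?D) \<longleftrightarrow>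
      set q \<subseteq> d_edges P \<union> d_edges Q \<and> epath (d_init P) q (d_term P)" for q
    using forest_ends(1)[OF P] pv by (simp add: pre_digraph.awalk_def cas_d_graph) (simp add: d_graph_def)
  have "length q \<le> length (d_bot P)" if q: "set q \<subseteq> d_edges P \<union> d_edges Q" "epath (d_init P) q (d_term P)" for q
  proof -
    have "sorted_wrt (<) (d_init P # map e_head q)" using epath_increasing[OF q(2)] inc q(1) by blast
    then have d: "distinct (d_init P # map e_head q)" by (simp only: strict_sorted_iff)
    have "set (d_init P # map e_head q) \<subseteq> d_verts P"
      using forest_ends(1)[OF P] edge_verts(2) q(1) pv(4) by fastforce
    then have "card (set (d_init P # map e_head q)) \<le> card (set (d_init P # map e_head (d_bot P)))"
      unfolding b(8) by (intro card_mono) auto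
    then show ?thesis using distinct_card[OF d] distinct_card[OF b(5)] by simp
  qed
  then show ?thesis
    unfolding longest_positive_path_def is_arg_max_def walk using b(4,7) by (auto simp: not_less)
qed

text \<open>
  The intervals of the coarsest dyadic subdivision on which \<open>f\<close> acts interval by interval.
\<close>

definition maximal_standard :: "(real \<Rightarrow> real) \<Rightarrow> nat \<Rightarrow> nat \<Rightarrow> bool" where
  "maximal_standard f k m \<longleftrightarrow> m < 2 ^ k \<and> standard_on f k m \<and> (k = 0 \<or> \<not> standard_on f (k - 1) (m div 2))"

text \<open>
  Since mapping a standard interval onto a standard interval is a symmetric relation between \<open>f\<close>
  and its inverse, and containment of intervals is preserved, maximality is preserved too.
\<close>

lemma maximal_standard_image:
  assumes f: "increasing_bij f" and g: "increasing_bij g"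
    and gf: "\<And>x. 0 \<le> x \<Longrightarrow> x \<le> 1 \<Longrightarrow> g (f x) = x" and fg: "\<And>x. 0 \<le> x \<Longrightarrow> x \<le> 1 \<Longrightarrow> f (g x) = x"
    and max: "maximal_standard f k m" and km: "maps_standard f k m k' m'"
  shows "maximal_standard g k' m'"
proof -
  have m: "m < 2 ^ k" using max by (simp add: maximal_standard_def)
  have m': "m' < 2 ^ k'" by (rule maps_standard_image_bound[OF f km m])
  have g1: "maps_standard g k' m' k m" by (rule maps_standard_inverse[OF km m gf])
  have False if k': "k' \<noteq> 0" and std: "standard_on g (k' - 1) (m' div 2)"
  proof -
    obtain j where j: "k' = Suc j" using k' by (cases k') auto
    define h where "h = m' div 2"
    obtain a b where ab: "maps_standard g j h a b" using std by (auto simp: standard_on_def j h_def)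
    have h: "h < 2 ^ j" using m' by (simp add: h_def j less_mult_imp_div_less mult.commute)
    have b: "b < 2 ^ a" by (rule maps_standard_image_bound[OF g ab h])
    have m'h: "m' = h * 2 ^ 1 + m' mod 2" by (simp add: h_def)
    have "maps_standard g (j + 1) (h * 2 ^ 1 + m' mod 2) (a + 1) (b * 2 ^ 1 + m' mod 2)"
      by (rule maps_standard_refine[OF ab]) simp
    then have "maps_standard g k' m' (a + 1) (b * 2 ^ 1 + m' mod 2)" using m'h j by simp
    from maps_standard_unique[OF g1 this] have k: "k = a + 1" "m = b * 2 ^ 1 + m' mod 2" by auto
    then have "k - 1 = a" "m div 2 = b" by auto
    moreover have "maps_standard f a b j h" by (rule maps_standard_inverse[OF ab h fg])
    ultimately have "standard_on f (k - 1) (m div 2)" by (auto simp: standard_on_def)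
    then show False using max k by (simp add: maximal_standard_def)
  qed
  then show ?thesis using m' g1 by (auto simp: maximal_standard_def standard_on_def)
qed

text \<open>
  The two halves come from the maximal intervals for \<open>f\<close> and for its inverse \<open>g\<close>; by
  \<open>maximal_standard_image\<close> these correspond to each other under \<open>f\<close>, so the two bottom paths coincide when a
  vertex of the lower half is named like its preimage. There is no dipole: in the first kind, two
  sibling intervals would be mapped onto two sibling intervals, and their parents could not have been
  halved; in the second kind, an edge common to both halves would be split in both.
\<close>

theorem reduced_diagram_exists:
  assumes f: "f \<in> thompson_homeos"
  obtains P Q e1 e2 where "is_diagram P" "is_diagram Q" "d_top P = [e1]" "d_top Q = [e2]"
    "multipliable P (d_inv Q)"
    "\<forall>(p, q)\<in>d_cells P. length p = 1 \<and> length q = 2" "\<forall>(p, q)\<in>d_cells Q. length p = 1 \<and> length q = 2"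
    "\<not> has_dipole (d_mult P (d_inv Q))" "longest_positive_path (d_mult P (d_inv Q)) (d_bot P)"
    "\<And>e. e \<in> set (d_bot P) \<Longrightarrow> \<exists>k m k' m'. m < 2 ^ k \<and> maps_standard f k m k' m' \<and>
      edge_interval P e (real m / 2 ^ k) ((real m + 1) / 2 ^ k) \<and>
      edge_interval Q e (real m' / 2 ^ k') ((real m' + 1) / 2 ^ k')"
proof -
  have finc: "increasing_bij f" using f by (rule thompson_homeos_increasing_bij)
  define g where "g = restrict (inv_into {0..1} f) {0..1}"
  have gF: "g \<in> thompson_homeos" unfolding g_def by (rule inverse_thompson_homeos[OF f])
  have ginc: "increasing_bij g" using gF by (rule thompson_homeos_increasing_bij)
  have gf: "g (f x) = x" if "0 \<le> x" "x \<le> 1" for x unfolding g_def by (rule increasing_bij_inverse(2)[OF finc that])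
  have fg: "f (g x) = x" if "0 \<le> x" "x \<le> 1" for x unfolding g_def by (rule increasing_bij_inverse(3)[OF finc that])
  obtain M1 M2 where M12: "standard_at_level f M1" "standard_at_level g M2"
    using f gF by (meson thompson_homeos_standard)
  define M where "M = max M1 M2"
  have fM: "standard_at_level f M" and gM: "standard_at_level g M"
    using M12 standard_at_level_mono by (auto simp: M_def)
  define X where "X = (\<lambda>i. real i / 2 ^ M) ` {..2 ^ M} \<union> (\<lambda>i. g (real i / 2 ^ M)) ` {..2 ^ M}"
  have Xfin: "finite X" by (simp add: X_def)
  \<comment> \<open>Vertex names are numbers, so a position is named by its rank in a finite set that contains
    all relevant positions of both halves.\<close>
  define \<nu> where "\<nu> x = card {z \<in> X. z < x}" for x
  have \<nu>_less: "\<nu> x < \<nu> y" if "x \<in> X" "x < y" for x y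
    unfolding \<nu>_def using that Xfin by (intro psubset_card_mono) auto
  have \<nu>_eq: "x = y" if "x \<in> X" "y \<in> X" "\<nu> x = \<nu> y" for x y
    using that \<nu>_less[of x y] \<nu>_less[of y x] by (cases x y rule: linorder_cases) auto
  have frac01: "0 \<le> real i / 2 ^ k \<and> real i / 2 ^ k \<le> 1" if "i \<le> 2 ^ k" for i k
  proof -
    have "real i \<le> real (2 ^ k)" using that by (simp only: of_nat_le_iff)
    then show ?thesis by simp
  qed
  have gridX: "real i / 2 ^ k \<in> X" "g (real i / 2 ^ k) \<in> X" if i: "i \<le> 2 ^ k" and k: "k \<le> M" for i k
  proof -
    obtain d where d: "M = k + d" using k le_Suc_ex by blast
    have eq: "real i / 2 ^ k = real (i * 2 ^ d) / 2 ^ M" by (simp add: d power_add)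
    have mem: "i * 2 ^ d \<in> {..2 ^ M}" using i by (simp add: d power_add)
    show "real i / 2 ^ k \<in> X" "g (real i / 2 ^ k) \<in> X" unfolding X_def eq using mem by blast+
  qed
  \<comment> \<open>The tags \<open>2\<close> and \<open>3\<close> are arbitrary distinct nonzero numbers.\<close>
  interpret P: dyadic_tree \<nu> "standard_on f" 2 M
  proof
    fix i j :: nat assume ij: "i < j" "j \<le> 2 ^ M"
    then show "\<nu> (real i / 2 ^ M) < \<nu> (real j / 2 ^ M)"
      by (intro \<nu>_less gridX) (auto simp: divide_strict_right_mono)
  qed (use fM standard_on_halves in \<open>auto simp: standard_at_level_def\<close>)
  interpret Q: dyadic_tree "\<lambda>y. \<nu> (g y)" "standard_on g" 3 M
  proof
    fix i j :: nat assume ij: "i < j" "j \<le> 2 ^ M"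
    have "real i / 2 ^ M < real j / 2 ^ M" using ij by (simp add: divide_strict_right_mono)
    then have "g (real i / 2 ^ M) < g (real j / 2 ^ M)"
      using increasing_bij_facts(4)[OF ginc] frac01[of i M] frac01[of j M] ij by simp
    then show "\<nu> (g (real i / 2 ^ M)) < \<nu> (g (real j / 2 ^ M))"
      using gridX(2)[of i M] ij by (intro \<nu>_less) auto
  qed (use gM standard_on_halves in \<open>auto simp: standard_at_level_def\<close>)
  have leafP: "P.tree_leaf 0 0 k m \<longleftrightarrow> maximal_standard f k m" for k m
    by (simp add: P.tree_leaf_root maximal_standard_def)
  have leafQ: "Q.tree_leaf 0 0 k m \<longleftrightarrow> maximal_standard g k m" for k m
    by (simp add: Q.tree_leaf_root maximal_standard_def)
  have match: "maps_standard f k m k' m'"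
    if km: "k \<le> M" "m < 2 ^ k" and km': "k' \<le> M" "m' < 2 ^ k'" and std: "standard_on f k m"
      and eq: "P.vertex k m = Q.vertex k' m'" "P.vertex k (Suc m) = Q.vertex k' (Suc m')" for k m k' m'
  proof -
    have l: "real m / 2 ^ k = g (real m' / 2 ^ k')"
      using eq(1) km km' by (intro \<nu>_eq gridX) (auto simp: P.vertex_def Q.vertex_def)
    have r: "real (Suc m) / 2 ^ k = g (real (Suc m') / 2 ^ k')"
      using eq(2) km km' unfolding P.vertex_def Q.vertex_def by (intro \<nu>_eq gridX) auto
    have "f (real m / 2 ^ k) = real m' / 2 ^ k'"
      unfolding l using frac01[of m' k'] km' by (intro fg) auto
    moreover have "f (real (Suc m) / 2 ^ k) = real (Suc m') / 2 ^ k'"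
      unfolding r using frac01[of "Suc m'" k'] km' by (intro fg) (auto simp: Suc_le_eq)
    ultimately show ?thesis
      using std maps_standard_from_endpoints unfolding standard_on_def by (auto simp: add.commute)
  qed
  have vertex_eq: "P.vertex k m = Q.vertex k' m'" "P.vertex k (Suc m) = Q.vertex k' (Suc m')"
    if km: "maps_standard f k m k' m'" and m: "m < 2 ^ k" for k m k' m'
  proof -
    have "f (real (Suc m) / 2 ^ k) = real (Suc m') / 2 ^ k'" using maps_standard_right[OF km] by (simp add: add.commute)
    then show "P.vertex k m = Q.vertex k' m'" "P.vertex k (Suc m) = Q.vertex k' (Suc m')"
      unfolding P.vertex_def Q.vertex_def
      using maps_standard_left[OF km] gf[of "real m / 2 ^ k"] gf[of "real (Suc m) / 2 ^ k"] frac01[of m k] frac01[of "Suc m" k] m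
      by (metis Suc_leI less_imp_le)+
  qed
  have edge_eq: "P.node_edge k m = Q.node_edge k' m'"
    if km: "maps_standard f k m k' m'" and m: "m < 2 ^ k" for k m k' m'
  proof -
    have "standard_on f k m" "standard_on g k' m'"
      using km maps_standard_inverse[OF km m gf] unfolding standard_on_def by blast+
    then show ?thesis using vertex_eq[OF km m] by (simp add: P.node_edge_def Q.node_edge_def)
  qed
  have sets: "set (d_bot P.whole) = set (d_bot Q.whole)"
  proof
    show "set (d_bot P.whole) \<subseteq> set (d_bot Q.whole)"
    proof
      fix e assume "e \<in> set (d_bot P.whole)"
      then obtain k m where e: "e = P.node_edge k m" and max: "maximal_standard f k m"
        using P.whole_facts(6) leafP by auto
      then obtain k' m' where km: "maps_standard f k m k' m'" by (auto simp: maximal_standard_def standard_on_def)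
      have "maximal_standard g k' m'" by (rule maximal_standard_image[OF finc ginc gf fg max km])
      moreover have "e = Q.node_edge k' m'" using edge_eq[OF km] max e by (simp add: maximal_standard_def)
      ultimately show "e \<in> set (d_bot Q.whole)" unfolding Q.whole_facts(6) leafQ by blast
    qed
    show "set (d_bot Q.whole) \<subseteq> set (d_bot P.whole)"
    proof
      fix e assume "e \<in> set (d_bot Q.whole)"
      then obtain k' m' where e: "e = Q.node_edge k' m'" and max: "maximal_standard g k' m'"
        using Q.whole_facts(6) leafQ by auto
      then obtain k m where km': "maps_standard g k' m' k m" by (auto simp: maximal_standard_def standard_on_def)
      have m': "m' < 2 ^ k'" using max by (simp add: maximal_standard_def)
      have "maximal_standard f k m" by (rule maximal_standard_image[OF ginc finc fg gf max km'])
      moreover have "e = P.node_edge k m"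
        using edge_eq[OF maps_standard_inverse[OF km' m' fg]] maps_standard_image_bound[OF ginc km' m'] e by simp
      ultimately show "e \<in> set (d_bot P.whole)" unfolding P.whole_facts(6) leafP by blast
    qed
  qed
  have bots: "d_bot P.whole = d_bot Q.whole"
    by (rule sorted_key_unique[OF P.whole_facts(5) Q.whole_facts(5) sets])
  have cellsP: "\<forall>(p, q)\<in>d_cells P.whole. length p = 1 \<and> length q = 2"
    using P.whole_facts(4) by (auto simp: P.tree_cells_def)
  have cellsQ: "\<forall>(p, q)\<in>d_cells Q.whole. length p = 1 \<and> length q = 2"
    using Q.whole_facts(4) by (auto simp: Q.tree_cells_def)
  have forestP: "forest P.whole" and forestQ: "forest Q.whole"
    using is_diagram_forest[OF P.whole_facts(1)] is_diagram_forest[OF Q.whole_facts(1)] cellsP cellsQ by blast+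
  have edges: "d_edges P.whole \<inter> d_edges Q.whole = set (d_bot P.whole)"
  proof
    show "d_edges P.whole \<inter> d_edges Q.whole \<subseteq> set (d_bot P.whole)"
      using P.whole_facts(8,9) Q.whole_facts(8) by fastforce
    show "set (d_bot P.whole) \<subseteq> d_edges P.whole \<inter> d_edges Q.whole"
      using P.whole_facts(3) Q.whole_facts(3) bots by simp
  qed
  have mult: "multipliable P.whole (d_inv Q.whole)"
  proof -
    note bP = forest_basic[OF forestP] and bQ = forest_basic[OF forestQ]
    have "d_init P.whole = d_init Q.whole"
      using forest_init_term(1)[OF forestP] forest_init_term(1)[OF forestQ] bots by (simp add: d_init_def)
    then have V: "d_verts P.whole = d_verts Q.whole" using bP(8) bQ(8) bots by simp
    have "d_verts P.whole = e_tail ` set (d_bot P.whole) \<union> e_head ` set (d_bot P.whole)"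
    proof
      show "e_tail ` set (d_bot P.whole) \<union> e_head ` set (d_bot P.whole) \<subseteq> d_verts P.whole"
        using bP(7) by (auto simp: d_verts_def)
      have "d_init P.whole = e_tail (hd (d_bot P.whole))" using epath_ends[OF bP(4,3)] by simp
      then show "d_verts P.whole \<subseteq> e_tail ` set (d_bot P.whole) \<union> e_head ` set (d_bot P.whole)"
        using bP(3) unfolding bP(8) by auto
    qed
    then show ?thesis using V bots edges by (simp add: multipliable_def)
  qed
  have long: "longest_positive_path (d_mult P.whole (d_inv Q.whole)) (d_bot P.whole)"
    using P.whole_facts(7) Q.whole_facts(7) by (intro bottom_path_is_longest[OF forestP forestQ mult]) auto
  have dipole: "\<not> has_dipole (d_mult P.whole (d_inv Q.whole))"
  proof
    assume "has_dipole (d_mult P.whole (d_inv Q.whole))"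
    moreover have "([a, b], q) \<notin> d_cells P.whole" "([a, b], q) \<notin> d_cells Q.whole" for a b q
      using cellsP cellsQ by auto
    ultimately consider
      (1) e h h' e' where "([e], [h, h']) \<in> d_cells P.whole" "([e'], [h, h']) \<in> d_cells Q.whole"
    | (2) e h h' k k' where "([e], [h, h']) \<in> d_cells Q.whole" "([e], [k, k']) \<in> d_cells P.whole"
      unfolding has_dipole_def d_mult_simps d_inv_simps Un_iff converse_iff by blast
    then show False
    proof cases
      case 1
      obtain k m where P: "h = P.node_edge (Suc k) (2 * m)" "h' = P.node_edge (Suc k) (Suc (2 * m))"
        "k < M" "m < 2 ^ k" "\<not> standard_on f k m"
        using subsetD[OF P.whole_facts(4) 1(1)] unfolding P.tree_cells_def by blast
      obtain k' m' where Q: "h = Q.node_edge (Suc k') (2 * m')" "h' = Q.node_edge (Suc k') (Suc (2 * m'))"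
        "k' < M" "m' < 2 ^ k'"
        using subsetD[OF Q.whole_facts(4) 1(2)] unfolding Q.tree_cells_def by blast
      have v: "P.vertex (Suc k) (2 * m) = Q.vertex (Suc k') (2 * m')"
        "P.vertex (Suc k) (Suc (2 * m)) = Q.vertex (Suc k') (Suc (2 * m'))"
        "P.vertex (Suc k) (Suc (Suc (2 * m))) = Q.vertex (Suc k') (Suc (Suc (2 * m')))"
        using P(1,2) Q(1,2) P.node_edge_simps Q.node_edge_simps by metis+
      have s: "standard_on f (Suc k) (2 * m)" "standard_on f (Suc k) (Suc (2 * m))"
        using P(1,2) Q(1,2) by (auto simp: P.node_edge_def Q.node_edge_def split: if_splits)
      have "maps_standard f (Suc k) (2 * m) (Suc k') (2 * m')"
        using P Q s v by (intro match) auto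
      moreover have "maps_standard f (Suc k) (Suc (2 * m)) (Suc k') (Suc (2 * m'))"
        using P Q s v by (intro match) auto
      ultimately have "maps_standard f k m k' m'" by (rule maps_standard_glue)
      then show False using P(5) by (auto simp: standard_on_def)
    next
      case 2
      obtain j m where Q: "e = Q.node_edge j m" "\<not> standard_on g j m"
        using subsetD[OF Q.whole_facts(4) 2(1)] unfolding Q.tree_cells_def by blast
      obtain j' m' where P: "e = P.node_edge j' m'" "\<not> standard_on f j' m'"
        using subsetD[OF P.whole_facts(4) 2(2)] unfolding P.tree_cells_def by blast
      show False using P Q by (simp add: P.node_edge_def Q.node_edge_def)
    qed
  qed
  have int: "\<exists>k m k' m'. m < 2 ^ k \<and> maps_standard f k m k' m' \<and>
      edge_interval P.whole e (real m / 2 ^ k) ((real m + 1) / 2 ^ k) \<and>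
      edge_interval Q.whole e (real m' / 2 ^ k') ((real m' + 1) / 2 ^ k')"
    if e: "e \<in> set (d_bot P.whole)" for e
  proof -
    obtain k m where P: "P.tree_leaf 0 0 k m" "e = P.node_edge k m"
      "edge_interval P.whole e (real m / 2 ^ k) ((real m + 1) / 2 ^ k)" using P.whole_interval[OF e] by blast
    obtain k' m' where Q: "Q.tree_leaf 0 0 k' m'" "e = Q.node_edge k' m'"
      "edge_interval Q.whole e (real m' / 2 ^ k') ((real m' + 1) / 2 ^ k')"
      using Q.whole_interval e bots by metis
    have lev: "k \<le> M" "m < 2 ^ k" "k' \<le> M" "m' < 2 ^ k'"
      using P.tree_leaf_level[OF P(1)] Q.tree_leaf_level[OF Q(1)] by simp_all
    have "P.vertex k m = Q.vertex k' m'" "P.vertex k (Suc m) = Q.vertex k' (Suc m')"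
      using P(2) Q(2) P.node_edge_simps Q.node_edge_simps by metis+
    moreover have "standard_on f k m" using P(1) by (simp add: leafP maximal_standard_def)
    ultimately have "maps_standard f k m k' m'" using lev by (intro match) auto
    then show ?thesis using lev(2) P(3) Q(3) by blast
  qed
  show ?thesis
    by (rule that[OF P.whole_facts(1) Q.whole_facts(1) P.whole_facts(2) Q.whole_facts(2) mult cellsP cellsQ dipole long int])
qed

theorem Jones_subgroup_eq: "Jones_subgroup n = digit_preserving n"
proof
  show "Jones_subgroup n \<subseteq> digit_preserving n" by (rule Jones_subgroup_subset)
  show "digit_preserving n \<subseteq> Jones_subgroup n"
  proof
    fix f assume fn: "f \<in> digit_preserving n"
    then have f: "f \<in> thompson_homeos" by (simp add: digit_preserving_def)
    obtain P Q e1 e2 where dP: "is_diagram P" and dQ: "is_diagram Q" and top: "d_top P = [e1]" "d_top Q = [e2]"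
      and mult: "multipliable P (d_inv Q)"
      and cP: "\<forall>(p, q)\<in>d_cells P. length p = 1 \<and> length q = 2"
      and cQ: "\<forall>(p, q)\<in>d_cells Q. length p = 1 \<and> length q = 2"
      and dip: "\<not> has_dipole (d_mult P (d_inv Q))" and long: "longest_positive_path (d_mult P (d_inv Q)) (d_bot P)"
      and int: "\<And>e. e \<in> set (d_bot P) \<Longrightarrow> \<exists>k m k' m'. m < 2 ^ k \<and> maps_standard f k m k' m' \<and>
        edge_interval P e (real m / 2 ^ k) ((real m + 1) / 2 ^ k) \<and>
        edge_interval Q e (real m' / 2 ^ k') ((real m' + 1) / 2 ^ k')"
      by (rule reduced_diagram_exists[OF f]) (rule that)
    let ?D = "d_mult P (d_inv Q)"
    have P: "forest P" and Q: "forest Q" using is_diagram_forest dP dQ cP cQ by blast+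
    have Qi: "is_diagram (d_inv Q)" by (rule is_diagram.inv[OF dQ])
    have "is_diagram ?D" by (rule is_diagram.mult[OF dP Qi mult])
    then have red: "reduced_diagram_in_F ?D" using dip top by (simp add: reduced_diagram_in_F_def)
    have single: "\<And>e a b c d. e \<in> d_edges P \<Longrightarrow> edge_interval P e a b \<Longrightarrow> edge_interval P e c d \<Longrightarrow> a = c"
      "\<And>e a b c d. e \<in> d_edges Q \<Longrightarrow> edge_interval Q e a b \<Longrightarrow> edge_interval Q e c d \<Longrightarrow> a = c"
      using forest_positions[OF P top(1)] forest_positions[OF Q top(2)] by metis+
    have bot: "d_bot P = d_bot Q" using mult by (simp add: multipliable_def)
    have good: "n_good n ?D"
      unfolding n_good_iff[OF P Q top mult]
    proof (intro ballI allI impI)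
      fix e a b c d assume e: "e \<in> set (d_bot P)" and I: "edge_interval P e a b" "edge_interval Q e c d"
      have ed: "e \<in> d_edges P" "e \<in> d_edges Q"
        using forest_basic(7)[OF P] forest_basic(7)[OF Q] e bot by auto
      obtain k m k' m' where km: "m < 2 ^ k" "maps_standard f k m k' m'"
        "edge_interval P e (real m / 2 ^ k) ((real m + 1) / 2 ^ k)"
        "edge_interval Q e (real m' / 2 ^ k') ((real m' + 1) / 2 ^ k')" using int[OF e] by blast
      have a: "a = real m / 2 ^ k" by (rule single(1)[OF ed(1) I(1) km(3)])
      have c: "c = real m' / 2 ^ k'" by (rule single(2)[OF ed(2) I(2) km(4)])
      have "c = f a" using maps_standard_left[OF km(2)] a c by simp
      moreover have "a \<in> unit_dyadics" using km(1) a by (auto simp: unit_dyadics_def)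
      ultimately show "[dyadic_sum a = dyadic_sum c] (mod n)"
        using fn by (simp add: digit_preserving_def cong_sym_eq)
    qed
    have split: "splits_as ?D P (d_inv Q)"
      unfolding splits_as_def using dP Qi mult long cP cQ by auto
    have "diagram_homeo ?D f"
      unfolding diagram_homeo_def
    proof (rule exI[of _ P], rule exI[of _ "d_inv Q"], intro conjI ballI)
      show "splits_as ?D P (d_inv Q)" by (fact split)
      fix e assume "e \<in> set (d_bot P)"
      then obtain k m k' m' where km: "maps_standard f k m k' m'"
        "edge_interval P e (real m / 2 ^ k) ((real m + 1) / 2 ^ k)"
        "edge_interval Q e (real m' / 2 ^ k') ((real m' + 1) / 2 ^ k')" using int by blast
      let ?a = "real m / 2 ^ k" and ?b = "(real m + 1) / 2 ^ k"
      let ?c = "real m' / 2 ^ k'" and ?d = "(real m' + 1) / 2 ^ k'"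
      have "f x = ?c + (?d - ?c) / (?b - ?a) * (x - ?a)" if x: "x \<in> {?a..?b}" for x
      proof -
        define y where "y = x * 2 ^ k - real m"
        have y: "0 \<le> y" "y \<le> 1" "x = (real m + y) / 2 ^ k" using x by (auto simp: y_def field_simps)
        have "f x = (real m' + y) / 2 ^ k'" using maps_standardD[OF km(1) y(1,2)] y(3) by simp
        moreover have "?b - ?a = 1 / 2 ^ k" "x - ?a = y / 2 ^ k" "?d - ?c = 1 / 2 ^ k'"
          using y(3) by (simp_all add: add_divide_distrib)
        ultimately show ?thesis by (simp add: add_divide_distrib)
      qed
      then show "\<exists>a b c d. edge_interval P e a b \<and> edge_interval (d_inv (d_inv Q)) e c d \<and>
        (\<forall>x\<in>{a..b}. f x = c + (d - c) / (b - a) * (x - a))"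
        using km(2,3) unfolding d_inv_inv by blast
    qed
    then show "f \<in> Jones_subgroup n" using f red good by (auto simp: Jones_subgroup_def)
  qed
qed

text \<open>
  The element \<open>push n\<close> lies in Jones' subgroup and moves all other cosets freely, so both claims follow
  from the criteria for an abstract group.
\<close>

theorem theorem5p12:
  fixes n :: nat
  assumes "n \<ge> 1"
  shows "commensurator thompson_F (Jones_subgroup n) = Jones_subgroup n \<and>
    irreducible_rep thompson_F
      (lcosets\<^bsub>thompson_F\<^esub> (Jones_subgroup n))
      (linearization thompson_F (Jones_subgroup n))"
  unfolding Jones_subgroup_eq
  using group.commensurator_eqI[OF group_thompson_F subgroup_digit_preserving push_digit_preserving[OF assms] push_moves_cosets[OF assms]]
    group.irreducible_linearizationI[OF group_thompson_F subgroup_digit_preserving push_digit_preserving[OF assms] push_moves_cosets[OF assms]]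
  by blast

end
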